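(* Let $d\ge2$. For any nonempty family of states $\mathcal X\subseteq\mathcal D(\mathbb C^d\otimes\mathbb C^d)$, with closure $\overline{\mathcal X}$ in the trace-norm topology, the universal distillable entanglement of $\mathcal X$ is $$\hat E_d(\mathcal X)=\min_{\rho\in\overline{\mathcal X}}E_d(\rho)$$ (in particular, the minimum on the right-hand side is attained).
   Context: $\mathcal D(\mathcal H)$ is the set of density operators on $\mathcal H$. Bipartite systems are shared between Alice (first factor) and Bob (second factor). An LOCC channel is a quantum channel between bipartite systems implementable by local quantum operations of Alice and Bob and classical communication between them (in the usual sense: rounds of local instruments, each allowed to depend on previously communicated outcomes). $\|X\|_1=\mathrm{Tr}\sqrt{X^\dagger X}$. The ebit is $\Phi_2=|\Phi_2\rangle\!\langle\Phi_2|$ with $|\Phi_2\rangle=(|00\rangle+|11\rangle)/\sqrt2$, one qubit per party. The distillable entanglement $E_d(\rho)$ of a bipartite state $\rho$ is the supremum of all rates $R\ge0$ for which there exists a sequence of LOCC channels $\Lambda_n$ (allowed to depend on $\rho$), mapping $n$ copies of the system to $\lceil Rn\rceil$ shared qubit pairs, with $\lim_{n\to\infty}\frac12\|\Lambda_n(\rho^{\otimes n})-\Phi_2^{\otimes\lceil Rn\rceil}\|_1=0$. The universal distillable entanglement of a nonempty family $\mathcal X$ is $$\hat E_d(\mathcal X)=\sup\Big\{R\ge0:\ \lim_{n\to\infty}\inf_{\Lambda_n}\sup_{\rho\in\mathcal X}\tfrac12\big\|\Lambda_n(\rho^{\otimes n})-\Phi_2^{\otimes\lceil Rn\rceil}\big\|_1=0\Big\},$$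 where the infimum is over all LOCC channels $\Lambda_n$ from $n$ copies of $\mathbb C^d\otimes\mathbb C^d$ to $\lceil Rn\rceil$ shared qubit pairs. The rate $R=0$ corresponds to an empty output (zero error). *)

theory Defs
  imports
    "Jordan_Normal_Form.Schur_Decomposition"
    "HOL-Library.Extended_Real"
begin

text \<open>
  Operators on an \<open>n\<close>-dimensional Hilbert space are elements of \<open>carrier_mat n n\<close>. The space
  of a bipartite system with local dimensions \<open>a\<close> (Alice) and \<open>b\<close> (Bob) has dimension \<open>a * b\<close>,
  and its basis vector number \<open>i * b + j\<close>, where \<open>i < a\<close> and \<open>j < b\<close>, is the product of Alice's
  \<open>i\<close>-th and Bob's \<open>j\<close>-th basis vector; \<open>i\<close> and \<open>j\<close> are recovered by \<open>div b\<close> and \<open>mod b\<close>.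
\<close>

section \<open>Density operators and the trace norm\<close>

definition mat_trace :: "complex mat \<Rightarrow> complex" where
  "mat_trace A = (\<Sum>i<dim_row A. A $$ (i, i))"

text \<open>
  The order on complex numbers makes \<open>0 \<le> z\<close> mean that \<open>z\<close> is real and nonnegative, so that
  hermiticity is implied below.
\<close>

definition psd :: "nat \<Rightarrow> complex mat \<Rightarrow> bool" where
  "psd n A \<longleftrightarrow> A \<in> carrier_mat n n \<and> (\<forall>v \<in> carrier_vec n. 0 \<le> (A *\<^sub>v v) \<bullet>c v)"

definition density_operators :: "nat \<Rightarrow> complex mat set" where
  "density_operators n = {\<rho>. psd n \<rho> \<and> mat_trace \<rho> = 1}"

definition psd_sqrt :: "complex mat \<Rightarrow> complex mat" where
  "psd_sqrt A = (THE S. psd (dim_row A) S \<and> S * S = A)"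

definition trace_norm :: "complex mat \<Rightarrow> real" where
  "trace_norm X = Re (mat_trace (psd_sqrt (mat_adjoint X * X)))"

definition trace_norm_closure :: "nat \<Rightarrow> complex mat set \<Rightarrow> complex mat set" where
  "trace_norm_closure n X =
    {\<rho> \<in> carrier_mat n n. \<forall>\<epsilon>>0. \<exists>\<sigma>\<in>X. trace_norm (\<rho> - \<sigma>) < \<epsilon>}"

section \<open>Local operations\<close>

text \<open>
  \<open>on_alice a a' b E\<close> is \<open>E\<close> tensored with the identity on Bob's \<open>b\<close>-dimensional system, for a
  map \<open>E\<close> from operators in dimension \<open>a\<close> to operators in dimension \<open>a'\<close>: it applies \<open>E\<close> to
  each of the blocks obtained by fixing Bob's row and column index. \<open>on_bob\<close> is the
  corresponding map with the roles of the parties exchanged.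
\<close>

definition on_alice ::
  "nat \<Rightarrow> nat \<Rightarrow> nat \<Rightarrow> (complex mat \<Rightarrow> complex mat) \<Rightarrow> complex mat \<Rightarrow> complex mat" where
  "on_alice a a' b E X = mat (a' * b) (a' * b) (\<lambda>(r, c).
    E (mat a a (\<lambda>(i, k). X $$ (i * b + r mod b, k * b + c mod b))) $$ (r div b, c div b))"

definition on_bob ::
  "nat \<Rightarrow> nat \<Rightarrow> nat \<Rightarrow> (complex mat \<Rightarrow> complex mat) \<Rightarrow> complex mat \<Rightarrow> complex mat" where
  "on_bob a b b' E X = mat (a * b') (a * b') (\<lambda>(r, c).
    E (mat b b (\<lambda>(j, l). X $$ ((r div b') * b + j, (c div b') * b + l))) $$ (r mod b', c mod b'))"

definition linear_superoperator :: "nat \<Rightarrow> nat \<Rightarrow> (complex mat \<Rightarrow> complex mat) \<Rightarrow> bool" where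
  "linear_superoperator a a' E \<longleftrightarrow>
    (\<forall>X \<in> carrier_mat a a. E X \<in> carrier_mat a' a') \<and>
    (\<forall>X \<in> carrier_mat a a. \<forall>Y \<in> carrier_mat a a. E (X + Y) = E X + E Y) \<and>
    (\<forall>z. \<forall>X \<in> carrier_mat a a. E (z \<cdot>\<^sub>m X) = z \<cdot>\<^sub>m E X)"

definition completely_positive :: "nat \<Rightarrow> nat \<Rightarrow> (complex mat \<Rightarrow> complex mat) \<Rightarrow> bool" where
  "completely_positive a a' E \<longleftrightarrow> linear_superoperator a a' E \<and>
    (\<forall>k X. psd (a * k) X \<longrightarrow> psd (a' * k) (on_alice a a' k E X))"

text \<open>
  A quantum instrument with outcomes \<open>0, \<dots>, m - 1\<close>: completely positive maps whose sum
  preserves the trace.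
\<close>

definition instrument ::
  "nat \<Rightarrow> nat \<Rightarrow> nat \<Rightarrow> (nat \<Rightarrow> complex mat \<Rightarrow> complex mat) \<Rightarrow> bool" where
  "instrument a a' m E \<longleftrightarrow> (\<forall>k<m. completely_positive a a' (E k)) \<and>
    (\<forall>X \<in> carrier_mat a a. (\<Sum>k<m. mat_trace (E k X)) = mat_trace X)"

section \<open>LOCC channels\<close>

text \<open>
  \<open>locc a' b' a b \<Lambda>\<close>: the map \<open>\<Lambda>\<close> from operators on local dimensions \<open>a, b\<close> to operators on
  local dimensions \<open>a', b'\<close> is implemented by a protocol with finitely many rounds. In a round,
  one party applies an instrument and announces the outcome \<open>k\<close>; the rest of the protocol is
  chosen depending on \<open>k\<close>, hence on the whole history of outcomes. Quantum or classical memory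
  is part of the intermediate local systems, whose dimensions are arbitrary. The channel is the
  sum over all outcomes.
\<close>

definition mat_family_sum :: "nat \<Rightarrow> nat \<Rightarrow> (nat \<Rightarrow> complex mat) \<Rightarrow> complex mat" where
  "mat_family_sum n m A = mat n n (\<lambda>rc. \<Sum>k<m. A k $$ rc)"

inductive locc :: "nat \<Rightarrow> nat \<Rightarrow> nat \<Rightarrow> nat \<Rightarrow> (complex mat \<Rightarrow> complex mat) \<Rightarrow> bool"
  for a' b' :: nat where
  stop: "locc a' b' a' b' (\<lambda>X. X)"
| alice: "instrument a c m E \<Longrightarrow> (\<And>k. k < m \<Longrightarrow> locc a' b' c b (\<Lambda> k)) \<Longrightarrow>
    locc a' b' a b (\<lambda>X. mat_family_sum (a' * b') m (\<lambda>k. \<Lambda> k (on_alice a c b (E k) X)))"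
| bob: "instrument b c m E \<Longrightarrow> (\<And>k. k < m \<Longrightarrow> locc a' b' a c (\<Lambda> k)) \<Longrightarrow>
    locc a' b' a b (\<lambda>X. mat_family_sum (a' * b') m (\<lambda>k. \<Lambda> k (on_bob a b c (E k) X)))"

section \<open>Copies of a bipartite state\<close>

text \<open>
  For \<open>\<rho>\<close> with local dimensions \<open>d, d\<close> and \<open>\<sigma>\<close> with local dimensions \<open>e, e\<close>, this is their
  tensor product with the factors regrouped so that Alice holds the first factors of both and Bob
  the second factors of both; the result has local dimensions \<open>d * e, d * e\<close>.
\<close>

definition bipartite_tensor ::
  "nat \<Rightarrow> nat \<Rightarrow> complex mat \<Rightarrow> complex mat \<Rightarrow> complex mat" where
  "bipartite_tensor d e \<rho> \<sigma> = mat ((d * e) * (d * e)) ((d * e) * (d * e)) (\<lambda>(r, c).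
    let i = r div (d * e); j = r mod (d * e); k = c div (d * e); l = c mod (d * e)
    in \<rho> $$ ((i div e) * d + j div e, (k div e) * d + l div e) *
       \<sigma> $$ ((i mod e) * e + j mod e, (k mod e) * e + l mod e))"

text \<open>The \<open>n\<close>-fold tensor power has local dimensions \<open>d ^ n, d ^ n\<close>.\<close>

primrec bipartite_power :: "nat \<Rightarrow> complex mat \<Rightarrow> nat \<Rightarrow> complex mat" where
  "bipartite_power d \<rho> 0 = 1\<^sub>m 1"
| "bipartite_power d \<rho> (Suc n) = bipartite_tensor d (d ^ n) \<rho> (bipartite_power d \<rho> n)"

definition ebit_ket :: "complex vec" where
  "ebit_ket = vec 4 (\<lambda>i. if i = 0 \<or> i = 3 then 1 / complex_of_real (sqrt 2) else 0)"

definition ebit :: "complex mat" where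
  "ebit = mat 4 4 (\<lambda>(i, j). ebit_ket $ i * cnj (ebit_ket $ j))"

section \<open>Distillable entanglement\<close>

definition qubit_pairs :: "real \<Rightarrow> nat \<Rightarrow> nat" where
  "qubit_pairs R n = nat \<lceil>R * real n\<rceil>"

definition distillation_channels ::
  "nat \<Rightarrow> real \<Rightarrow> nat \<Rightarrow> (complex mat \<Rightarrow> complex mat) set" where
  "distillation_channels d R n =
    {\<Lambda>. locc (2 ^ qubit_pairs R n) (2 ^ qubit_pairs R n) (d ^ n) (d ^ n) \<Lambda>}"

definition distillation_error ::
  "nat \<Rightarrow> real \<Rightarrow> nat \<Rightarrow> (complex mat \<Rightarrow> complex mat) \<Rightarrow> complex mat \<Rightarrow> real" where
  "distillation_error d R n \<Lambda> \<rho> =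
    1 / 2 * trace_norm (\<Lambda> (bipartite_power d \<rho> n) - bipartite_power 2 ebit (qubit_pairs R n))"

definition distillable_entanglement :: "nat \<Rightarrow> complex mat \<Rightarrow> ereal" where
  "distillable_entanglement d \<rho> =
    Sup (ereal ` {R. 0 \<le> R \<and>
      (\<exists>\<Lambda>. (\<forall>n. \<Lambda> n \<in> distillation_channels d R n) \<and>
        (\<lambda>n. distillation_error d R n (\<Lambda> n) \<rho>) \<longlonglongrightarrow> 0)})"

definition universal_distillable_entanglement :: "nat \<Rightarrow> complex mat set \<Rightarrow> ereal" where
  "universal_distillable_entanglement d X =
    Sup (ereal ` {R. 0 \<le> R \<and>
      (\<lambda>n. INF \<Lambda> \<in> distillation_channels d R n.
        SUP \<rho> \<in> X. ereal (distillation_error d R n \<Lambda> \<rho>)) \<longlonglongrightarrow> 0})"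

end

theory Submission
  imports Defs "HOL-Analysis.Function_Topology"
begin

text \<open>
  The fidelity of the output of a fixed protocol is continuous in the input state, so a universal
  rate for \<open>X\<close> is achievable for every state in the closure. Conversely, suppose that \<open>m\<close> copies of
  \<open>\<rho>\<close> can be converted to \<open>k\<close> ebits with small error. The same protocol converts \<open>m\<close> copies of any
  state near \<open>\<rho>\<close> to blocks of \<open>k\<close> qubit pairs in which few blocks have a bit or a phase error.
  Hashing over the field with two elements corrects every error pattern supported on few blocks;
  there are at most \<open>2 ^ N * 2 ^ (k * t)\<close> patterns on \<open>t\<close> of \<open>N\<close> blocks, so the loss in rate is
  negligible when \<open>k\<close> is large and the fraction of bad blocks is small. Hence every rate below
  \<open>E\<^sub>d(\<rho>)\<close> is achievable uniformly in a neighbourhood of \<open>\<rho>\<close>. This makes \<open>E\<^sub>d\<close> lower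
  semicontinuous, and finitely many such neighbourhoods cover the compact closure of \<open>X\<close>; measuring
  the error rate of a bounded number of blocks selects a protocol that works for the given state.
\<close>

section \<open>Sesquilinear forms and positive semidefinite matrices\<close>

text \<open>A protocol that distils \<open>\<rho>\<close> has vanishing error only on powers of
  \<open>\<rho>\<close> itself, and with no control of the speed; on a neighbouring state some error
  persists. Hence the protocol is frozen at one block length \<open>m\<close>, and an outer code has
  to remove a small constant error rate of unknown law. Using only the marginal laws of bit and of
  phase errors lets this code depend on a set of patterns and not on the state; a union bound over
  the two kinds of error replaces a joint analysis. With tolerated error \<open>(1 / 4) ^ p\<close>
  per block, at most \<open>N div p\<close> of \<open>N\<close> blocks need correction, since the
  tail then beats the factor \<open>2 ^ N\<close> for the choice of bad blocks; the relative loss of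
  rate is about \<open>4 / p\<close>. A finite sample cannot separate error rates at a sharp
  threshold, so the test has two, \<open>e \<le> e'\<close>: the neighbourhood has errors up to
  \<open>e\<close>, whereas hashing tolerates errors up to \<open>e'\<close>, so that either branch
  is right for an already handled state in between. A test uses up boundedly many copies, which is
  paid for by passing to a strictly smaller rate. Fidelity takes the place of the trace norm because
  it is linear in the output.\<close>

definition sesq :: "nat \<Rightarrow> complex mat \<Rightarrow> (nat \<Rightarrow> complex) \<Rightarrow> (nat \<Rightarrow> complex) \<Rightarrow> complex" where
  "sesq n A x y = (\<Sum>i<n. \<Sum>j<n. cnj (x i) * A $$ (i, j) * y j)"

definition ip :: "nat \<Rightarrow> (nat \<Rightarrow> complex) \<Rightarrow> (nat \<Rightarrow> complex) \<Rightarrow> complex" where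
  "ip n x y = (\<Sum>i<n. cnj (x i) * y i)"

lemma complex_nonneg_iff: "0 \<le> (z::complex) \<longleftrightarrow> 0 \<le> Re z \<and> Im z = 0"
  by (auto simp: less_eq_complex_def)

lemma sum_rotate: "(\<Sum>k\<in>A. \<Sum>i\<in>B. \<Sum>j\<in>C. f k i j) = (\<Sum>i\<in>B. \<Sum>j\<in>C. \<Sum>k\<in>A. f k i j)"
  by (subst sum.swap) (intro sum.cong refl sum.swap)

text \<open>Vectors become functions of which only the first \<open>n\<close> values count, so no
  carrier condition accompanies the algebra of forms that follows.\<close>

lemma psd_iff: "psd n A \<longleftrightarrow> A \<in> carrier_mat n n \<and> (\<forall>v. 0 \<le> sesq n A v v)"
proof -
  have key: "(A *\<^sub>v v) \<bullet>c v = sesq n A (\<lambda>i. v $ i) (\<lambda>i. v $ i)"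
    if "A \<in> carrier_mat n n" "v \<in> carrier_vec n" for v
    using that unfolding sesq_def
    by (auto simp: scalar_prod_def lessThan_atLeast0 sum_distrib_left sum_distrib_right ac_simps intro!: sum.cong)
  have cong: "sesq n A (\<lambda>i. vec n v $ i) (\<lambda>i. vec n v $ i) = sesq n A v v" for v
    unfolding sesq_def by (intro sum.cong) auto
  show ?thesis
  proof (intro iffI conjI allI)
    assume *: "psd n A"
    then show "A \<in> carrier_mat n n" by (simp add: psd_def)
    fix v :: "nat \<Rightarrow> complex"
    have "0 \<le> (A *\<^sub>v vec n v) \<bullet>c vec n v" using * by (simp add: psd_def)
    then show "0 \<le> sesq n A v v" using * key[of "vec n v"] cong by (simp add: psd_def)
  next
    assume "A \<in> carrier_mat n n \<and> (\<forall>v. 0 \<le> sesq n A v v)"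
    then show "psd n A" using key by (auto simp: psd_def)
  qed
qed

lemma psd_carrier: "psd n A \<Longrightarrow> A \<in> carrier_mat n n"
  by (simp add: psd_def)

lemma psd_sesq: "psd n A \<Longrightarrow> 0 \<le> sesq n A v v"
  by (simp add: psd_iff)

lemma sesq_delta:
  assumes "i < n" "j < n"
  shows "sesq n A (\<lambda>k. if k = i then 1 else 0) (\<lambda>k. if k = j then 1 else 0) = A $$ (i, j)"
proof -
  have "sesq n A (\<lambda>k. if k = i then 1 else 0) (\<lambda>k. if k = j then 1 else 0)
    = (\<Sum>k<n. if k = i then (\<Sum>l<n. if l = j then A $$ (i, j) else 0) else 0)"
    unfolding sesq_def
    by (rule sum.cong[OF refl]) (auto simp: if_distrib[of "\<lambda>x. _ * x"] assms(2) cong: if_cong)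
  then show ?thesis using assms by simp
qed

lemma sesq_linear:
  "sesq n A (\<lambda>i. s * x i + t * y i) (\<lambda>i. s' * x' i + t' * y' i) =
    cnj s * s' * sesq n A x x' + cnj s * t' * sesq n A x y' +
    cnj t * s' * sesq n A y x' + cnj t * t' * sesq n A y y'"
  unfolding sesq_def
  by (simp add: algebra_simps sum.distrib sum_distrib_left)

text \<open>Polarisation: reality of the form at \<open>x + y\<close> makes the imaginary parts of
  the two cross terms cancel, and reality at \<open>x + \<i> y\<close> makes their real parts
  agree.\<close>

lemma psd_hermitian_sesq:
  assumes "psd n A"
  shows "sesq n A x y = cnj (sesq n A y x)"
proof -
  have 1: "Im (sesq n A x x) = 0" "Im (sesq n A y y) = 0"
    using psd_sesq[OF assms] by (auto simp: complex_nonneg_iff)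
  have "Im (sesq n A (\<lambda>i. 1 * x i + 1 * y i) (\<lambda>i. 1 * x i + 1 * y i)) = 0"
    using psd_sesq[OF assms] by (auto simp: complex_nonneg_iff)
  then have 2: "Im (sesq n A x y) + Im (sesq n A y x) = 0"
    unfolding sesq_linear using 1 by simp
  have "Im (sesq n A (\<lambda>i. 1 * x i + \<i> * y i) (\<lambda>i. 1 * x i + \<i> * y i)) = 0"
    using psd_sesq[OF assms] by (auto simp: complex_nonneg_iff)
  then have 3: "Re (sesq n A x y) = Re (sesq n A y x)"
    unfolding sesq_linear using 1 by simp
  show ?thesis using 2 3 by (auto simp: complex_eq_iff)
qed

lemma psd_hermitian:
  assumes "psd n A" "i < n" "j < n"
  shows "A $$ (i, j) = cnj (A $$ (j, i))"
  using psd_hermitian_sesq[OF assms(1)] sesq_delta assms(2,3) by metis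

lemma psd_cauchy_schwarz:
  assumes "psd n A"
  shows "(cmod (sesq n A x y))\<^sup>2 \<le> Re (sesq n A x x) * Re (sesq n A y y)"
proof -
  define a where "a = Re (sesq n A x x)"
  define d where "d = Re (sesq n A y y)"
  define b where "b = sesq n A x y"
  have a: "sesq n A x x = complex_of_real a" "0 \<le> a" and d: "sesq n A y y = complex_of_real d" "0 \<le> d"
    using psd_sesq[OF assms, of x] psd_sesq[OF assms, of y]
    by (auto simp: complex_nonneg_iff a_def d_def complex_eq_iff)
  have b': "sesq n A y x = cnj b" using psd_hermitian_sesq[OF assms, of y x] by (simp add: b_def)
  \<comment> \<open>The coefficient \<open>- b * of_real s\<close> carries the phase of
    \<open>b\<close>, so the cross terms become real and a real quadratic form in \<open>s\<close>
    and \<open>t\<close> remains.\<close>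
  have q: "0 \<le> a * (cmod b)\<^sup>2 * s\<^sup>2 - 2 * (cmod b)\<^sup>2 * s * t + d * t\<^sup>2" for s t :: real
  proof -
    have "0 \<le> Re (sesq n A (\<lambda>i. (- b * of_real s) * x i + of_real t * y i) (\<lambda>i. (- b * of_real s) * x i + of_real t * y i))"
      using psd_sesq[OF assms] by (simp add: complex_nonneg_iff)
    also have "\<dots> = a * (cmod b)\<^sup>2 * s\<^sup>2 - 2 * (cmod b)\<^sup>2 * s * t + d * t\<^sup>2"
      unfolding sesq_linear a d b' b_def[symmetric]
      by (simp add: cmod_power2) (simp add: algebra_simps power2_eq_square)
    finally show ?thesis .
  qed
  have "(cmod b)\<^sup>2 \<le> a * d"
  proof (cases "a = 0")
    case True
    have "b = 0"
    proof (rule ccontr)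
      assume "b \<noteq> 0"
      then have p: "(cmod b)\<^sup>2 > 0" by simp
      \<comment> \<open>For \<open>a = 0\<close> this \<open>s\<close>, with \<open>t = 1\<close>,
        gives the form the value \<open>d - (d + 1)\<close>.\<close>
      have "0 \<le> a * (cmod b)\<^sup>2 * ((d+1) / (2 * (cmod b)\<^sup>2))\<^sup>2 - 2 * (cmod b)\<^sup>2 * ((d+1) / (2 * (cmod b)\<^sup>2)) * 1 + d * 1\<^sup>2"
        by (rule q)
      also have "\<dots> = -1" using True p by simp
      finally show False by simp
    qed
    then show ?thesis using True by simp
  next
    case False
    have "0 \<le> a * (a * d - (cmod b)\<^sup>2)" using q[of 1 a] by (simp add: algebra_simps power2_eq_square)
    then show ?thesis using False a(2) by (simp add: zero_le_mult_iff)
  qed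
  then show ?thesis by (simp add: a_def b_def d_def)
qed

lemma psd_entry_bound:
  assumes "psd n A" "i < n" "j < n"
  shows "(cmod (A $$ (i, j)))\<^sup>2 \<le> Re (A $$ (i, i)) * Re (A $$ (j, j))"
  using psd_cauchy_schwarz[OF assms(1)] sesq_delta assms(2,3) by metis

lemma psd_diag:
  assumes "psd n A" "i < n"
  shows "0 \<le> A $$ (i, i)"
  using psd_sesq[OF assms(1)] sesq_delta[OF assms(2,2), of A] by metis

section \<open>The spectral theorem\<close>

lemma mat_adjoint_carrier [simp]: "A \<in> carrier_mat n m \<Longrightarrow> mat_adjoint A \<in> carrier_mat m n"
  by (auto simp: mat_adjoint_def mat_of_rows_def)

lemma mat_adjoint_dim [simp]:
  "dim_row (mat_adjoint A) = dim_col A" "dim_col (mat_adjoint A) = dim_row A"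
  by (auto simp: mat_adjoint_def mat_of_rows_def)

lemma mat_adjoint_index [simp]:
  assumes "(A :: complex mat) \<in> carrier_mat n m" "i < m" "j < n"
  shows "mat_adjoint A $$ (i, j) = cnj (A $$ (j, i))"
  using assms by (auto simp: mat_adjoint_def mat_of_rows_def)

lemma mult_index:
  assumes "A \<in> carrier_mat n m" "B \<in> carrier_mat m k" "i < n" "j < k"
  shows "(A * B) $$ (i, j) = (\<Sum>l<m. A $$ (i, l) * B $$ (l, j))"
  using assms by (auto simp: scalar_prod_def lessThan_atLeast0 intro!: sum.cong)

lemma mat_adjoint_mult:
  assumes "(A :: complex mat) \<in> carrier_mat n m" "B \<in> carrier_mat m k"
  shows "mat_adjoint (A * B) = mat_adjoint B * mat_adjoint A"
proof (rule eq_matI)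
  have AB: "A * B \<in> carrier_mat n k" using assms by simp
  have A': "mat_adjoint A \<in> carrier_mat m n" and B': "mat_adjoint B \<in> carrier_mat k m" using assms by simp_all
  show "dim_row (mat_adjoint (A * B)) = dim_row (mat_adjoint B * mat_adjoint A)"
    "dim_col (mat_adjoint (A * B)) = dim_col (mat_adjoint B * mat_adjoint A)"
    using mat_adjoint_carrier[OF AB] A' B' by auto
  fix i j assume "i < dim_row (mat_adjoint B * mat_adjoint A)" "j < dim_col (mat_adjoint B * mat_adjoint A)"
  then have ij: "i < k" "j < n" using A' B' by auto
  show "mat_adjoint (A * B) $$ (i, j) = (mat_adjoint B * mat_adjoint A) $$ (i, j)"
    unfolding mat_adjoint_index[OF AB ij] mult_index[OF assms ij(2,1)] mult_index[OF B' A' ij]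
    using assms ij by (auto simp: mult.commute intro!: sum.cong)
qed

lemma mat_adjoint_adjoint:
  assumes "(A :: complex mat) \<in> carrier_mat n m"
  shows "mat_adjoint (mat_adjoint A) = A"
  by (rule eq_matI) (use assms mat_adjoint_carrier[OF mat_adjoint_carrier[OF assms]] in \<open>auto simp: mat_adjoint_index[OF mat_adjoint_carrier[OF assms]]\<close>)

definition unitary :: "nat \<Rightarrow> complex mat \<Rightarrow> bool" where
  "unitary n U \<longleftrightarrow> U \<in> carrier_mat n n \<and> mat_adjoint U * U = 1\<^sub>m n"

lemma unitary_right:
  assumes "unitary n U"
  shows "U * mat_adjoint U = 1\<^sub>m n"
  using assms mat_mult_left_right_inverse[of "mat_adjoint U" n U] by (auto simp: unitary_def)

lemma unitary_mult:
  assumes "unitary n U" "unitary n V"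
  shows "unitary n (U * V)"
proof -
  have U: "U \<in> carrier_mat n n" "mat_adjoint U * U = 1\<^sub>m n" and V: "V \<in> carrier_mat n n" "mat_adjoint V * V = 1\<^sub>m n"
    using assms by (auto simp: unitary_def)
  note U' = mat_adjoint_carrier[OF U(1)] and V' = mat_adjoint_carrier[OF V(1)]
  have "mat_adjoint (U * V) * (U * V) = mat_adjoint V * (mat_adjoint U * U * V)"
    unfolding mat_adjoint_mult[OF U(1) V(1)]
    using U(1) V(1) U' V' by (simp add: assoc_mult_mat[of _ n n _ n _ n])
  then show ?thesis using U V by (simp add: unitary_def)
qed

lemma unitary_with_eigenvector:
  assumes A: "(A :: complex mat) \<in> carrier_mat n n" and n: "n > 0"
  shows "\<exists>U e. unitary n U \<and> (\<forall>i<n. (A * U) $$ (i, 0) = e * U $$ (i, 0))"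
proof -
  obtain es where cp: "char_poly A = (\<Prod>a\<leftarrow>es. [:- a, 1:])" "length es = n"
    using char_poly_factorized[OF A] by auto
  then obtain e es' where es: "es = e # es'" using n by (cases es) auto
  have "eigenvalue A e" unfolding eigenvalue_root_char_poly[OF A] cp(1) es by simp
  then obtain v where ev: "eigenvector A v e" unfolding eigenvalue_def by auto
  have v[simp]: "v \<in> carrier_vec n" and v0: "v \<noteq> 0\<^sub>v n" and Av: "A *\<^sub>v v = e \<cdot>\<^sub>v v"
    using ev A by (auto simp: eigenvector_def)
  interpret cof_vec_space n "TYPE(complex)" .
  define b where "b = basis_completion v"
  define ws where "ws = gram_schmidt n b"
  define W where "W = mat_of_cols n ws"
  from basis_completion[OF v v0, folded b_def]
  have dist_b: "distinct b" and indep: "\<not> lin_dep (set b)" and b: "set b \<subseteq> carrier_vec n"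
    and hdb: "hd b = v" and len_b: "length b = n" by auto
  from hdb len_b n obtain vs where bv: "b = v # vs" by (cases b) auto
  from gram_schmidt_result[OF b dist_b indep refl, folded ws_def]
  have ws: "set ws \<subseteq> carrier_vec n" "corthogonal ws" "length ws = n" by (auto simp: len_b)
  from gram_schmidt_hd[OF v, of vs, folded bv] have hdws: "hd ws = v" unfolding ws_def .
  \<comment> \<open>The Gram-Schmidt vectors are orthogonal but not normalised; \<open>c k\<close>
    is the length of the \<open>k\<close>-th. By \<open>hdws\<close> the first one is the
    eigenvector itself.\<close>
  define c where "c k = sqrt (Re (ws ! k \<bullet>c ws ! k))" for k
  have wsk: "ws ! k \<in> carrier_vec n" if "k < n" for k using ws that by auto
  have ipk: "ws ! k \<bullet>c ws ! l = (\<Sum>i<n. ws ! k $ i * cnj (ws ! l $ i))" if "k < n" "l < n" for k l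
    using wsk[OF that(1)] wsk[OF that(2)] by (auto simp: scalar_prod_def lessThan_atLeast0 intro!: sum.cong)
  have ck: "ws ! k \<bullet>c ws ! k = complex_of_real ((c k)\<^sup>2)" "c k > 0" if "k < n" for k
  proof -
    have "ws ! k \<bullet>c ws ! k = complex_of_real (\<Sum>i<n. (cmod (ws ! k $ i))\<^sup>2)"
      unfolding ipk[OF that that] by (simp add: complex_norm_square del: of_real_power)
    moreover have "complex_of_real (\<Sum>i<n. (cmod (ws ! k $ i))\<^sup>2) \<noteq> 0" unfolding calculation[symmetric] using corthogonalD[OF ws(2), of k k] that ws(3) by auto
    moreover have "(\<Sum>i<n. (cmod (ws ! k $ i))\<^sup>2) \<ge> 0" by (intro sum_nonneg) auto
    ultimately show "ws ! k \<bullet>c ws ! k = complex_of_real ((c k)\<^sup>2)" "c k > 0"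
      unfolding c_def by (auto simp: less_le simp del: of_real_sum simp flip: of_real_power)
  qed
  define U where "U = mat n n (\<lambda>(i, k). ws ! k $ i / of_real (c k))"
  have U: "U \<in> carrier_mat n n" by (simp add: U_def)
  have "mat_adjoint U * U = 1\<^sub>m n"
  proof (rule eq_matI)
    fix k l assume "k < dim_row (1\<^sub>m n :: complex mat)" "l < dim_col (1\<^sub>m n :: complex mat)"
    then have kl: "k < n" "l < n" by auto
    have "(mat_adjoint U * U) $$ (k, l) = (\<Sum>i<n. cnj (U $$ (i, k)) * U $$ (i, l))"
      using mult_index[OF mat_adjoint_carrier[OF U] U kl] U kl by simp
    also have "\<dots> = (ws ! l \<bullet>c ws ! k) / (of_real (c k) * of_real (c l))"
      unfolding ipk[OF kl(2,1)] sum_divide_distrib using kl by (intro sum.cong) (auto simp: U_def)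
    also have "\<dots> = (if k = l then 1 else 0)"
      using ck[OF kl(1)] ck[OF kl(2)] corthogonalD[OF ws(2), of l k] kl ws(3)
      by (auto simp: power2_eq_square)
    finally show "(mat_adjoint U * U) $$ (k, l) = 1\<^sub>m n $$ (k, l)" using kl by simp
  qed (use U mat_adjoint_carrier[OF U] in auto)
  moreover have "(A * U) $$ (i, 0) = e * U $$ (i, 0)" if i: "i < n" for i
  proof -
    have ws0: "ws ! 0 = v" using hdws ws(3) n by (metis hd_conv_nth length_0_conv less_nat_zero_code)
    have "(A * U) $$ (i, 0) = (\<Sum>l<n. A $$ (i, l) * v $ l) / of_real (c 0)"
      unfolding mult_index[OF A U i n] sum_divide_distrib using n by (intro sum.cong) (auto simp: U_def ws0)
    also have "(\<Sum>l<n. A $$ (i, l) * v $ l) = (A *\<^sub>v v) $ i"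
      using A i by (auto simp: scalar_prod_def lessThan_atLeast0 carrier_vecD[OF v] intro!: sum.cong)
    finally show ?thesis using i n v by (simp add: Av U_def ws0)
  qed
  ultimately show ?thesis using U unfolding unitary_def by blast
qed

text \<open>Deflation: with an eigenvector rotated to the first basis vector, the first column of
  the hermitian \<open>B\<close> vanishes off the diagonal, hence so does its first row, and the
  remaining block \<open>C\<close> falls under the induction hypothesis.\<close>

lemma spectral_unitary:
  assumes "A \<in> carrier_mat n n" "mat_adjoint A = A"
  shows "\<exists>U (d :: nat \<Rightarrow> real). unitary n U \<and> mat_adjoint U * A * U = mat n n (\<lambda>(i, j). if i = j then of_real (d i) else 0)"
  using assms
proof (induction n arbitrary: A)
  case 0
  have "mat_adjoint (1\<^sub>m 0 :: complex mat) \<in> carrier_mat 0 0" by simp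
  then show ?case using 0
    by (intro exI[of _ "1\<^sub>m 0"] exI[of _ "\<lambda>_. 0"]) (auto simp: unitary_def intro!: eq_matI)
next
  case (Suc n)
  note A = Suc.prems(1)
  obtain U e where U: "unitary (Suc n) U" and eig: "\<And>i. i < Suc n \<Longrightarrow> (A * U) $$ (i, 0) = e * U $$ (i, 0)"
    using unitary_with_eigenvector[OF A] by blast
  have Uc: "U \<in> carrier_mat (Suc n) (Suc n)" and UU: "mat_adjoint U * U = 1\<^sub>m (Suc n)" using U by (auto simp: unitary_def)
  note Ua = mat_adjoint_carrier[OF Uc]
  define B where "B = mat_adjoint U * (A * U)"
  have AU: "A * U \<in> carrier_mat (Suc n) (Suc n)" using A Uc by simp
  have B: "B \<in> carrier_mat (Suc n) (Suc n)" unfolding B_def using Ua AU by simp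
  have Bh: "mat_adjoint B = B"
    unfolding B_def mat_adjoint_mult[OF Ua AU] mat_adjoint_mult[OF A Uc] mat_adjoint_adjoint[OF Uc] Suc.prems(2)
    using assoc_mult_mat[OF Ua A Uc] by simp
  have Bh': "B $$ (i, j) = cnj (B $$ (j, i))" if "i < Suc n" "j < Suc n" for i j
    using mat_adjoint_index[OF B that] Bh by simp
  have B0: "B $$ (i, 0) = (if i = 0 then e else 0)" if i: "i < Suc n" for i
  proof -
    have "B $$ (i, 0) = e * (mat_adjoint U * U) $$ (i, 0)"
      unfolding B_def mult_index[OF Ua AU i zero_less_Suc] mult_index[OF Ua Uc i zero_less_Suc] sum_distrib_left
      by (intro sum.cong) (auto simp: eig)
    then show ?thesis using i by (simp add: UU)
  qed
  define C where "C = mat n n (\<lambda>(i, j). B $$ (Suc i, Suc j))"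
  have C: "C \<in> carrier_mat n n" by (simp add: C_def)
  have "mat_adjoint C = C"
    by (rule eq_matI) (auto simp: mat_adjoint_index[OF C] carrier_matD[OF C], auto simp: C_def Bh'[symmetric])
  from Suc.IH[OF C this] obtain V d where V: "unitary n V"
    and d: "mat_adjoint V * C * V = mat n n (\<lambda>(i, j). if i = j then of_real (d i) else 0)" by blast
  have Vc: "V \<in> carrier_mat n n" and VV: "mat_adjoint V * V = 1\<^sub>m n" using V by (auto simp: unitary_def)
  note Va = mat_adjoint_carrier[OF Vc]
  \<comment> \<open>The direct sum of \<open>1\<close> and \<open>V\<close>: it fixes the
    eigenvector and diagonalises the remaining block.\<close>
  define V' where "V' = mat (Suc n) (Suc n) (\<lambda>(i, j). if i = 0 \<or> j = 0 then (if i = j then 1 else 0) else V $$ (i - 1, j - 1))"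
  have V'c: "V' \<in> carrier_mat (Suc n) (Suc n)" by (simp add: V'_def)
  note V'a = mat_adjoint_carrier[OF V'c]
  have V'0: "V' $$ (i, j) = (case i of 0 \<Rightarrow> (case j of 0 \<Rightarrow> 1 | Suc j' \<Rightarrow> 0) | Suc i' \<Rightarrow> (case j of 0 \<Rightarrow> 0 | Suc j' \<Rightarrow> V $$ (i', j')))"
    if "i < Suc n" "j < Suc n" for i j
    using that by (auto simp: V'_def split: nat.splits)
  have V'u: "unitary (Suc n) V'"
    unfolding unitary_def
  proof (intro conjI V'c eq_matI)
    fix k l assume "k < dim_row (1\<^sub>m (Suc n) :: complex mat)" "l < dim_col (1\<^sub>m (Suc n) :: complex mat)"
    then have kl: "k < Suc n" "l < Suc n" by auto
    have V1: "(\<Sum>i<n. cnj (V $$ (i, k')) * V $$ (i, l')) = (if k' = l' then 1 else 0)" if "k' < n" "l' < n" for k' l'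
      using mult_index[OF Va Vc that] Vc that by (simp add: VV)
    have "(mat_adjoint V' * V') $$ (k, l) = (\<Sum>i<Suc n. cnj (V' $$ (i, k)) * V' $$ (i, l))"
      unfolding mult_index[OF V'a V'c kl] using mat_adjoint_index[OF V'c kl(1)] by (intro sum.cong) auto
    also have "\<dots> = (if k = l then 1 else 0)"
      unfolding sum.lessThan_Suc_shift using kl by (auto simp: V'0 V1 split: nat.splits)
    finally show "(mat_adjoint V' * V') $$ (k, l) = 1\<^sub>m (Suc n) $$ (k, l)" using kl by simp
  qed (use V'a V'c in auto)
  have BV': "B * V' \<in> carrier_mat (Suc n) (Suc n)" using B V'c by simp
  define d' where "d' i = (case i of 0 \<Rightarrow> Re e | Suc i' \<Rightarrow> d i')" for i
  have e: "e = of_real (Re e)" using Bh'[of 0 0] B0[of 0] by (auto simp: complex_eq_iff)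
  have fin: "mat_adjoint V' * (B * V') = mat (Suc n) (Suc n) (\<lambda>(i, j). if i = j then of_real (d' i) else 0)"
  proof (rule eq_matI)
    fix k l assume "k < dim_row (mat (Suc n) (Suc n) (\<lambda>(i, j). if i = j then complex_of_real (d' i) else 0))"
      "l < dim_col (mat (Suc n) (Suc n) (\<lambda>(i, j). if i = j then complex_of_real (d' i) else 0))"
    then have kl: "k < Suc n" "l < Suc n" by auto
    have CV: "C * V \<in> carrier_mat n n" using C Vc by simp
    have V1: "(\<Sum>i<n. cnj (V $$ (i, k')) * (\<Sum>j<n. B $$ (Suc i, Suc j) * V $$ (j, l'))) = (if k' = l' then of_real (d k') else 0)"
      if kl': "k' < n" "l' < n" for k' l'
    proof -
      have "(mat_adjoint V * C * V) $$ (k', l') = (mat_adjoint V * (C * V)) $$ (k', l')"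
        using assoc_mult_mat[OF Va C Vc] by simp
      also have "\<dots> = (\<Sum>i<n. cnj (V $$ (i, k')) * (\<Sum>j<n. B $$ (Suc i, Suc j) * V $$ (j, l')))"
        unfolding mult_index[OF Va CV kl'] using mult_index[OF C Vc _ kl'(2)] mat_adjoint_index[OF Vc kl'(1)]
        by (intro sum.cong) (auto simp: C_def)
      finally show ?thesis using kl' by (simp add: d)
    qed
    have B0': "B $$ (0, Suc j) = 0" if "j < n" for j using Bh'[of 0 "Suc j"] B0[of "Suc j"] that by simp
    have "(mat_adjoint V' * (B * V')) $$ (k, l) = (\<Sum>i<Suc n. cnj (V' $$ (i, k)) * (\<Sum>j<Suc n. B $$ (i, j) * V' $$ (j, l)))"
      unfolding mult_index[OF V'a BV' kl] using mat_adjoint_index[OF V'c kl(1)] mult_index[OF B V'c _ kl(2)] by (intro sum.cong) auto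
    also have "\<dots> = (if k = l then of_real (d' k) else 0)"
      unfolding sum.lessThan_Suc_shift using kl e by (auto simp: V'0 V1 B0 B0' d'_def split: nat.splits)
    finally show "(mat_adjoint V' * (B * V')) $$ (k, l) = mat (Suc n) (Suc n) (\<lambda>(i, j). if i = j then of_real (d' i) else 0) $$ (k, l)"
      using kl by simp
  qed (use V'a BV' in auto)
  have "mat_adjoint (U * V') * A * (U * V') = mat_adjoint V' * (B * V')"
  proof -
    have UA: "mat_adjoint U * A \<in> carrier_mat (Suc n) (Suc n)" by (rule mult_carrier_mat[OF Ua A])
    have UV: "U * V' \<in> carrier_mat (Suc n) (Suc n)" by (rule mult_carrier_mat[OF Uc V'c])
    show ?thesis
      unfolding B_def mat_adjoint_mult[OF Uc V'c] assoc_mult_mat[OF V'a Ua A] assoc_mult_mat[OF V'a UA UV]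
        assoc_mult_mat[OF UA Uc V'c, symmetric] assoc_mult_mat[OF Ua A Uc] ..
  qed
  then have "mat_adjoint (U * V') * A * (U * V') = mat (Suc n) (Suc n) (\<lambda>(i, j). if i = j then of_real (d' i) else 0)"
    unfolding fin .
  with unitary_mult[OF U V'u] show ?case by blast
qed

text \<open>Orthonormality evaluates forms on the basis vectors, the resolution of the identity
  evaluates traces; both are kept at hand.\<close>

definition orthobasis :: "nat \<Rightarrow> (nat \<Rightarrow> nat \<Rightarrow> complex) \<Rightarrow> bool" where
  "orthobasis n u \<longleftrightarrow> (\<forall>k<n. \<forall>l<n. ip n (u k) (u l) = (if k = l then 1 else 0)) \<and>
    (\<forall>i<n. \<forall>j<n. (\<Sum>k<n. u k i * cnj (u k j)) = (if i = j then 1 else 0))"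

definition eigenbasis :: "nat \<Rightarrow> (nat \<Rightarrow> nat \<Rightarrow> complex) \<Rightarrow> (nat \<Rightarrow> real) \<Rightarrow> complex mat \<Rightarrow> bool" where
  "eigenbasis n u d A \<longleftrightarrow> orthobasis n u \<and> A \<in> carrier_mat n n \<and>
    (\<forall>i<n. \<forall>j<n. A $$ (i, j) = (\<Sum>k<n. of_real (d k) * u k i * cnj (u k j)))"

theorem spectral_theorem:
  assumes A: "A \<in> carrier_mat n n" and h: "\<And>i j. i < n \<Longrightarrow> j < n \<Longrightarrow> A $$ (i, j) = cnj (A $$ (j, i))"
  shows "\<exists>u d. eigenbasis n u d A"
proof -
  have "mat_adjoint A = A"
    by (rule eq_matI) (use A in \<open>auto simp: h[symmetric]\<close>)
  from spectral_unitary[OF A this] obtain U d where U: "unitary n U"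
    and d: "mat_adjoint U * A * U = mat n n (\<lambda>(i, j). if i = j then of_real (d i) else 0)" (is "_ = ?D") by blast
  have Uc: "U \<in> carrier_mat n n" and UU: "mat_adjoint U * U = 1\<^sub>m n" using U by (auto simp: unitary_def)
  note Ua = mat_adjoint_carrier[OF Uc]
  have D: "?D \<in> carrier_mat n n" by simp
  have AU: "A * U \<in> carrier_mat n n" using A Uc by simp
  have "U * ?D = U * (mat_adjoint U * (A * U))"
    unfolding d[symmetric] assoc_mult_mat[OF Ua A Uc] ..
  also have "\<dots> = A * U"
    unfolding assoc_mult_mat[OF Uc Ua AU, symmetric] unitary_right[OF U] by (rule left_mult_one_mat[OF AU])
  finally have "U * ?D * mat_adjoint U = A * (U * mat_adjoint U)"
    using assoc_mult_mat[OF A Uc Ua] by simp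
  then have AD: "A = U * ?D * mat_adjoint U" using unitary_right[OF U] A by simp
  have UD: "U * ?D \<in> carrier_mat n n" using Uc by simp
  have "eigenbasis n (\<lambda>k i. U $$ (i, k)) d A"
    unfolding eigenbasis_def orthobasis_def
  proof (intro conjI allI impI A)
    fix k l assume kl: "k < n" "l < n"
    show "ip n (\<lambda>i. U $$ (i, k)) (\<lambda>i. U $$ (i, l)) = (if k = l then 1 else 0)"
      using mult_index[OF Ua Uc kl] Uc kl by (simp add: UU ip_def)
    show "(\<Sum>i<n. U $$ (k, i) * cnj (U $$ (l, i))) = (if k = l then 1 else 0)"
      using mult_index[OF Uc Ua kl] Uc kl by (simp add: unitary_right[OF U])
    have "A $$ (k, l) = (\<Sum>i<n. (U * ?D) $$ (k, i) * cnj (U $$ (l, i)))"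
      using mult_index[OF UD Ua kl] Uc kl by (simp add: AD[symmetric])
    moreover have "(U * ?D) $$ (k, i) = U $$ (k, i) * of_real (d i)" if "i < n" for i
      unfolding mult_index[OF Uc D kl(1) that] using that
      by (simp add: if_distrib[of "\<lambda>x. _ * x"] cong: if_cong)
    ultimately show "A $$ (k, l) = (\<Sum>i<n. of_real (d i) * U $$ (k, i) * cnj (U $$ (l, i)))"
      by (simp add: mult.commute)
  qed
  then show ?thesis by blast
qed

section \<open>The trace norm\<close>

lemma eigenbasis_carrier: "eigenbasis n u d A \<Longrightarrow> A \<in> carrier_mat n n"
  by (simp add: eigenbasis_def)

lemma eigenbasis_sesq:
  assumes "eigenbasis n u d A"
  shows "sesq n A x y = (\<Sum>k<n. of_real (d k) * ip n x (u k) * ip n (u k) y)"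
proof -
  have "sesq n A x y = (\<Sum>i<n. \<Sum>j<n. \<Sum>k<n. cnj (x i) * (of_real (d k) * u k i * cnj (u k j)) * y j)"
    unfolding sesq_def using assms
    by (intro sum.cong) (auto simp: eigenbasis_def sum_distrib_left sum_distrib_right)
  also have "\<dots> = (\<Sum>k<n. \<Sum>i<n. \<Sum>j<n. cnj (x i) * (of_real (d k) * u k i * cnj (u k j)) * y j)"
    by (rule sum_rotate[symmetric])
  also have "\<dots> = (\<Sum>k<n. of_real (d k) * ip n x (u k) * ip n (u k) y)"
    unfolding ip_def by (auto simp: sum_distrib_left sum_distrib_right algebra_simps intro!: sum.cong)
  finally show ?thesis .
qed

lemma eigenbasis_eigenvalue:
  assumes "eigenbasis n u d A" "k < n"
  shows "sesq n A (u k) (u k) = of_real (d k)"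
proof -
  have "sesq n A (u k) (u k) = (\<Sum>l<n. if l = k then of_real (d k) else 0)"
    unfolding eigenbasis_sesq[OF assms(1)] using assms by (intro sum.cong) (auto simp: eigenbasis_def orthobasis_def)
  then show ?thesis using assms(2) by simp
qed

lemma eigenbasis_mult:
  assumes A: "eigenbasis n u d A" and B: "eigenbasis n u e B"
  shows "eigenbasis n u (\<lambda>k. d k * e k) (A * B)"
  unfolding eigenbasis_def
proof (intro conjI allI impI)
  show "orthobasis n u" using A by (simp add: eigenbasis_def)
  have Ac: "A \<in> carrier_mat n n" and Bc: "B \<in> carrier_mat n n" using assms by (auto simp: eigenbasis_def)
  then show "A * B \<in> carrier_mat n n" by simp
  fix i j assume ij: "i < n" "j < n"
  have "(A * B) $$ (i, j) = (\<Sum>l<n. (\<Sum>k<n. of_real (d k) * u k i * cnj (u k l)) * (\<Sum>k<n. of_real (e k) * u k l * cnj (u k j)))"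
    unfolding mult_index[OF Ac Bc ij] using assms ij by (intro sum.cong) (auto simp: eigenbasis_def)
  also have "\<dots> = (\<Sum>l<n. \<Sum>k<n. \<Sum>m<n. of_real (d k) * of_real (e m) * u k i * cnj (u m j) * (cnj (u k l) * u m l))"
    by (simp add: sum_product algebra_simps)
  also have "\<dots> = (\<Sum>k<n. \<Sum>m<n. \<Sum>l<n. of_real (d k) * of_real (e m) * u k i * cnj (u m j) * (cnj (u k l) * u m l))"
    by (subst sum.swap) (intro sum.cong sum.swap refl)
  also have "\<dots> = (\<Sum>k<n. \<Sum>m<n. of_real (d k) * of_real (e m) * u k i * cnj (u m j) * ip n (u k) (u m))"
    by (simp add: ip_def sum_distrib_left)
  also have "\<dots> = (\<Sum>k<n. \<Sum>m<n. if m = k then of_real (d k * e k) * u k i * cnj (u k j) else 0)"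
    using A by (intro sum.cong) (auto simp: eigenbasis_def orthobasis_def)
  also have "\<dots> = (\<Sum>k<n. of_real (d k * e k) * u k i * cnj (u k j))" by simp
  finally show "(A * B) $$ (i, j) = (\<Sum>k<n. of_real (d k * e k) * u k i * cnj (u k j))" .
qed

definition of_eigenbasis :: "nat \<Rightarrow> (nat \<Rightarrow> nat \<Rightarrow> complex) \<Rightarrow> (nat \<Rightarrow> real) \<Rightarrow> complex mat" where
  "of_eigenbasis n u d = mat n n (\<lambda>(i, j). \<Sum>k<n. of_real (d k) * u k i * cnj (u k j))"

lemma eigenbasis_of_eigenbasis: "orthobasis n u \<Longrightarrow> eigenbasis n u d (of_eigenbasis n u d)"
  by (simp add: eigenbasis_def of_eigenbasis_def)

lemma eigenbasis_unique: "eigenbasis n u d A \<Longrightarrow> eigenbasis n u d B \<Longrightarrow> A = B"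
  by (rule eq_matI) (auto simp: eigenbasis_def)

lemma eigenbasis_cong:
  "eigenbasis n u d A \<Longrightarrow> (\<And>k. k < n \<Longrightarrow> d k = e k) \<Longrightarrow> eigenbasis n u e A"
  by (auto simp: eigenbasis_def)

lemma ip_conj: "ip n x y = cnj (ip n y x)"
  by (simp add: ip_def mult.commute)

lemma eigenbasis_psd:
  assumes "eigenbasis n u d A" "\<And>k. k < n \<Longrightarrow> 0 \<le> d k"
  shows "psd n A"
  unfolding psd_iff
proof (intro conjI allI)
  show "A \<in> carrier_mat n n" using assms by (simp add: eigenbasis_def)
  fix v
  have "sesq n A v v = (\<Sum>k<n. of_real (d k * (cmod (ip n v (u k)))\<^sup>2))"
    unfolding eigenbasis_sesq[OF assms(1)] using ip_conj[of n v]
    by (intro sum.cong) (auto simp: complex_norm_square simp del: of_real_power)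
  also have "0 \<le> \<dots>" using assms(2) by (intro sum_nonneg) (auto simp: complex_nonneg_iff)
  finally show "0 \<le> sesq n A v v" .
qed

lemma psd_eigenvalue_nonneg:
  assumes "eigenbasis n u d A" "psd n A" "k < n"
  shows "0 \<le> d k"
  using psd_sesq[OF assms(2), of "u k"] eigenbasis_eigenvalue[OF assms(1,3)] by (simp add: complex_nonneg_iff)

lemma psd_eigenbasis_exists:
  assumes "psd n A"
  shows "\<exists>u d. eigenbasis n u d A"
  using spectral_theorem[OF psd_carrier[OF assms]] psd_hermitian[OF assms] by blast

text \<open>Uniqueness of the positive root. The vector \<open>w = (T - s k) u k\<close> satisfies
  \<open>T w = - s k w\<close>, so positivity of \<open>T\<close> forces \<open>w = 0\<close> when
  \<open>s k > 0\<close>. When \<open>s k = 0\<close>, the squared length of \<open>T u k\<close> is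
  the form of \<open>T * T\<close> at \<open>u k\<close>, which is zero.\<close>

lemma psd_root_eigenbasis:
  assumes T: "psd n T" and TT: "eigenbasis n u (\<lambda>k. (s k)\<^sup>2) (T * T)" and s: "\<And>k. k < n \<Longrightarrow> 0 \<le> s k"
  shows "eigenbasis n u s T"
proof -
  have Tc: "T \<in> carrier_mat n n" using T by (simp add: psd_def)
  have u: "orthobasis n u" using TT by (simp add: eigenbasis_def)
  have Th: "cnj (T $$ (i, j)) = T $$ (j, i)" if "i < n" "j < n" for i j using psd_hermitian[OF T that] by simp
  have T2u: "(\<Sum>j<n. (T * T) $$ (i, j) * u k j) = of_real ((s k)\<^sup>2) * u k i" if "i < n" "k < n" for i k
  proof -
    have "(\<Sum>j<n. (T * T) $$ (i, j) * u k j) = (\<Sum>j<n. \<Sum>l<n. of_real ((s l)\<^sup>2) * u l i * (cnj (u l j) * u k j))"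
      using TT that by (auto simp: eigenbasis_def sum_distrib_left sum_distrib_right algebra_simps intro!: sum.cong)
    also have "\<dots> = (\<Sum>l<n. of_real ((s l)\<^sup>2) * u l i * ip n (u l) (u k))"
      by (subst sum.swap) (simp add: ip_def sum_distrib_left)
    also have "\<dots> = (\<Sum>l<n. if l = k then of_real ((s k)\<^sup>2) * u k i else 0)"
      using u that by (intro sum.cong) (auto simp: orthobasis_def)
    finally show ?thesis using that by simp
  qed
  have TTu: "(\<Sum>j<n. T $$ (i, j) * (\<Sum>l<n. T $$ (j, l) * u k l)) = of_real ((s k)\<^sup>2) * u k i" if "i < n" "k < n" for i k
  proof -
    have "(\<Sum>j<n. T $$ (i, j) * (\<Sum>l<n. T $$ (j, l) * u k l)) = (\<Sum>l<n. (T * T) $$ (i, l) * u k l)"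
      using mult_index[OF Tc Tc that(1)]
      by (simp add: sum_distrib_left sum_distrib_right algebra_simps) (subst sum.swap, simp add: algebra_simps)
    then show ?thesis using T2u that by simp
  qed
  have eig: "(\<Sum>l<n. T $$ (i, l) * u k l) = of_real (s k) * u k i" if "i < n" "k < n" for i k
  proof -
    define Tu where "Tu i = (\<Sum>l<n. T $$ (i, l) * u k l)" for i
    define w where "w i = Tu i - of_real (s k) * u k i" for i
    have Tw: "(\<Sum>j<n. T $$ (i, j) * w j) = - of_real (s k) * w i" if "i < n" for i
    proof -
      have "(\<Sum>j<n. T $$ (i, j) * w j) = (\<Sum>j<n. T $$ (i, j) * Tu j) - of_real (s k) * Tu i"
        unfolding w_def Tu_def by (simp add: algebra_simps sum_subtractf sum_distrib_left)
      also have "(\<Sum>j<n. T $$ (i, j) * Tu j) = of_real ((s k)\<^sup>2) * u k i"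
        using TTu[OF that \<open>k < n\<close>] by (simp only: Tu_def)
      also have "\<dots> - of_real (s k) * Tu i = - of_real (s k) * w i"
        by (simp add: w_def algebra_simps power2_eq_square)
      finally show ?thesis .
    qed
    have "w i = 0" if "i < n" for i
    proof -
      have sq: "sesq n T w w = - of_real (s k * (\<Sum>i<n. (cmod (w i))\<^sup>2))"
      proof -
        have "sesq n T w w = (\<Sum>i<n. cnj (w i) * (\<Sum>j<n. T $$ (i, j) * w j))"
          by (simp add: sesq_def sum_distrib_left mult.assoc)
        also have "\<dots> = (\<Sum>i<n. - of_real (s k) * of_real ((cmod (w i))\<^sup>2))"
          by (intro sum.cong) (auto simp: Tw complex_norm_square simp del: of_real_power)
        finally show ?thesis by (simp add: sum_distrib_left sum_negf)
      qed
      have "(\<Sum>i<n. (cmod (w i))\<^sup>2) = 0"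
      proof (cases "s k = 0")
        case True
        then have wTu: "w = Tu" by (auto simp: w_def)
        have "complex_of_real (\<Sum>i<n. (cmod (w i))\<^sup>2) = (\<Sum>i<n. cnj (Tu i) * Tu i)"
          by (auto simp: wTu complex_norm_square mult.commute simp del: of_real_power intro!: sum.cong)
        also have "\<dots> = (\<Sum>i<n. \<Sum>l<n. cnj (u k l) * (T $$ (l, i) * Tu i))"
        proof (rule sum.cong[OF refl])
          fix i assume "i \<in> {..<n}"
          then have "cnj (Tu i) = (\<Sum>l<n. cnj (u k l) * T $$ (l, i))"
            by (simp add: Tu_def Th mult.commute)
          then show "cnj (Tu i) * Tu i = (\<Sum>l<n. cnj (u k l) * (T $$ (l, i) * Tu i))"
            by (simp add: sum_distrib_right mult.assoc)
        qed
        also have "\<dots> = (\<Sum>l<n. cnj (u k l) * (\<Sum>i<n. T $$ (l, i) * Tu i))"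
          by (subst sum.swap) (simp add: sum_distrib_left)
        also have "\<dots> = 0" using TTu[OF _ \<open>k < n\<close>] True by (intro sum.neutral ballI) (simp add: Tu_def)
        finally show ?thesis by (simp del: of_real_sum)
      next
        case False
        then have "s k > 0" using s \<open>k < n\<close> by (simp add: order_less_le)
        moreover have "s k * (\<Sum>i<n. (cmod (w i))\<^sup>2) \<le> 0"
          using psd_sesq[OF T, of w] unfolding sq by (simp add: complex_nonneg_iff)
        ultimately have "(\<Sum>i<n. (cmod (w i))\<^sup>2) \<le> 0" by (simp add: mult_le_0_iff)
        moreover have "(\<Sum>i<n. (cmod (w i))\<^sup>2) \<ge> 0" by (intro sum_nonneg) auto
        ultimately show ?thesis by simp
      qed
      then show ?thesis using that by (subst (asm) sum_nonneg_eq_0_iff) auto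
    qed
    then show ?thesis using that by (simp add: w_def Tu_def)
  qed
  show ?thesis unfolding eigenbasis_def
  proof (intro conjI u Tc allI impI)
    fix i j assume ij: "i < n" "j < n"
    have "(\<Sum>k<n. of_real (s k) * u k i * cnj (u k j)) = (\<Sum>k<n. (\<Sum>l<n. T $$ (i, l) * u k l) * cnj (u k j))"
      using eig ij by simp
    also have "\<dots> = (\<Sum>l<n. T $$ (i, l) * (\<Sum>k<n. u k l * cnj (u k j)))"
      by (simp add: sum_distrib_left sum_distrib_right mult.assoc) (rule sum.swap)
    also have "\<dots> = (\<Sum>l<n. if l = j then T $$ (i, j) else 0)"
      using u ij by (intro sum.cong) (auto simp: orthobasis_def)
    finally show "T $$ (i, j) = (\<Sum>k<n. of_real (s k) * u k i * cnj (u k j))" using ij by simp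
  qed
qed

text \<open>Resolves the definite description in \<open>psd_sqrt\<close>: an explicit root exists,
  and any other positive root has the same eigenbasis and eigenvalues.\<close>

lemma psd_sqrt_eigenbasis:
  assumes A: "eigenbasis n u (\<lambda>k. (s k)\<^sup>2) A" and s: "\<And>k. k < n \<Longrightarrow> 0 \<le> s k"
  shows "eigenbasis n u s (psd_sqrt A)"
proof -
  let ?S = "of_eigenbasis n u s"
  have dim: "dim_row A = n" using A by (auto simp: eigenbasis_def)
  have S: "eigenbasis n u s ?S" using A by (intro eigenbasis_of_eigenbasis) (simp add: eigenbasis_def)
  have "psd n ?S" using eigenbasis_psd[OF S s] .
  moreover have "?S * ?S = A"
    by (rule eigenbasis_unique[OF eigenbasis_mult[OF S S]]) (use A in \<open>simp add: power2_eq_square\<close>)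
  moreover have "T = ?S" if "psd n T" "T * T = A" for T
  proof -
    have "eigenbasis n u s T" by (rule psd_root_eigenbasis[OF that(1)]) (use that A s in auto)
    then show ?thesis using S by (rule eigenbasis_unique)
  qed
  ultimately have "psd_sqrt A = ?S" unfolding psd_sqrt_def dim by (intro the_equality) blast+
  then show ?thesis using S by simp
qed

lemma psd_sqrt:
  assumes "psd n A"
  shows "psd n (psd_sqrt A)" "psd_sqrt A * psd_sqrt A = A"
proof -
  obtain u d where ud: "eigenbasis n u d A" using psd_eigenbasis_exists[OF assms] by blast
  have d: "0 \<le> d k" if "k < n" for k using psd_eigenvalue_nonneg[OF ud assms that] .
  have A: "eigenbasis n u (\<lambda>k. (sqrt (d k))\<^sup>2) A" by (rule eigenbasis_cong[OF ud]) (simp add: d)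
  have S: "eigenbasis n u (\<lambda>k. sqrt (d k)) (psd_sqrt A)" by (rule psd_sqrt_eigenbasis[OF A]) (simp add: d)
  show "psd n (psd_sqrt A)" by (rule eigenbasis_psd[OF S]) (simp add: d)
  show "psd_sqrt A * psd_sqrt A = A"
    by (rule eigenbasis_unique[OF eigenbasis_mult[OF S S]]) (use A in \<open>simp add: power2_eq_square\<close>)
qed

lemma adjoint_mult_index:
  assumes "X \<in> carrier_mat n n" "i < n" "j < n"
  shows "(mat_adjoint X * X) $$ (i, j) = (\<Sum>k<n. cnj (X $$ (k, i)) * X $$ (k, j))"
  using mult_index[OF mat_adjoint_carrier[OF assms(1)] assms(1-3)] assms by simp

lemma adjoint_mult_psd:
  assumes "X \<in> carrier_mat n n"
  shows "psd n (mat_adjoint X * X)"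
  unfolding psd_iff
proof (intro conjI allI)
  show "mat_adjoint X * X \<in> carrier_mat n n" by (rule mult_carrier_mat[OF mat_adjoint_carrier[OF assms] assms])
  fix v
  have "sesq n (mat_adjoint X * X) v v = (\<Sum>i<n. \<Sum>j<n. \<Sum>k<n. cnj (X $$ (k, i) * v i) * (X $$ (k, j) * v j))"
    unfolding sesq_def using adjoint_mult_index[OF assms]
    by (intro sum.cong) (auto simp: sum_distrib_left sum_distrib_right algebra_simps intro!: sum.cong)
  also have "\<dots> = (\<Sum>k<n. \<Sum>i<n. \<Sum>j<n. cnj (X $$ (k, i) * v i) * (X $$ (k, j) * v j))"
    by (rule sum_rotate[symmetric])
  also have "\<dots> = (\<Sum>k<n. cnj (\<Sum>i<n. X $$ (k, i) * v i) * (\<Sum>j<n. X $$ (k, j) * v j))"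
    by (simp add: sum_product)
  also have "\<dots> = (\<Sum>k<n. of_real ((cmod (\<Sum>i<n. X $$ (k, i) * v i))\<^sup>2))"
    by (intro sum.cong) (auto simp: complex_norm_square mult.commute simp del: of_real_power)
  also have "0 \<le> \<dots>" by (intro sum_nonneg) (auto simp: complex_nonneg_iff)
  finally show "0 \<le> sesq n (mat_adjoint X * X) v v" .
qed

lemma mat_trace_eq: "A \<in> carrier_mat n n \<Longrightarrow> mat_trace A = (\<Sum>i<n. A $$ (i, i))"
  by (auto simp: mat_trace_def)

text \<open>With \<open>S\<close> the absolute value of \<open>X\<close>, the squared length of
  column \<open>j\<close> of \<open>X\<close> is the entry \<open>(j, j)\<close> of
  \<open>S * S\<close>, and the entry bound for positive matrices makes this at most
  \<open>S $$ (j, j)\<close> times the trace of \<open>S\<close>. Together with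
  \<open>trace_norm_le_entries\<close> it reduces trace-norm limits to entrywise limits.\<close>

lemma entry_le_trace_norm:
  assumes X: "X \<in> carrier_mat n n" and ij: "i < n" "j < n"
  shows "cmod (X $$ (i, j)) \<le> trace_norm X"
proof -
  define S where "S = psd_sqrt (mat_adjoint X * X)"
  have S: "psd n S" and SS: "S * S = mat_adjoint X * X"
    unfolding S_def using psd_sqrt[OF adjoint_mult_psd[OF X]] by auto
  note Sc = psd_carrier[OF S]
  have nn: "0 \<le> Re (S $$ (k, k))" if "k < n" for k using psd_diag[OF S that] by (simp add: complex_nonneg_iff)
  have tn: "trace_norm X = (\<Sum>k<n. Re (S $$ (k, k)))"
    unfolding trace_norm_def S_def[symmetric] mat_trace_eq[OF Sc] by simp
  have tn0: "0 \<le> trace_norm X" unfolding tn by (intro sum_nonneg) (simp add: nn)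
  have "(cmod (X $$ (i, j)))\<^sup>2 \<le> (\<Sum>k<n. (cmod (X $$ (k, j)))\<^sup>2)"
    using ij by (intro member_le_sum[of i "{..<n}" "\<lambda>k. (cmod (X $$ (k, j)))\<^sup>2"]) auto
  also have "\<dots> = Re ((mat_adjoint X * X) $$ (j, j))"
    unfolding adjoint_mult_index[OF X ij(2) ij(2)] by (simp add: cmod_power2) (simp add: power2_eq_square)
  also have "(mat_adjoint X * X) $$ (j, j) = (\<Sum>k<n. S $$ (j, k) * S $$ (k, j))"
    unfolding SS[symmetric] using mult_index[OF Sc Sc ij(2) ij(2)] .
  also have "Re \<dots> = (\<Sum>k<n. (cmod (S $$ (j, k)))\<^sup>2)"
  proof -
    have "S $$ (j, k) * S $$ (k, j) = of_real ((cmod (S $$ (j, k)))\<^sup>2)" if "k < n" for k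
      using psd_hermitian[OF S that ij(2)] by (simp add: complex_norm_square del: of_real_power)
    then show ?thesis by simp
  qed
  also have "\<dots> \<le> (\<Sum>k<n. Re (S $$ (j, j)) * Re (S $$ (k, k)))"
    using ij by (intro sum_mono psd_entry_bound[OF S]) auto
  also have "\<dots> = Re (S $$ (j, j)) * trace_norm X" by (simp add: tn sum_distrib_left)
  also have "\<dots> \<le> trace_norm X * trace_norm X"
    using ij nn tn0 unfolding tn by (intro mult_right_mono member_le_sum) auto
  finally have "(cmod (X $$ (i, j)))\<^sup>2 \<le> (trace_norm X)\<^sup>2" by (simp add: power2_eq_square)
  then show ?thesis using tn0 by (rule power2_le_imp_le)
qed

text \<open>The square of \<open>S $$ (j, j)\<close> is at most the squared length of column
  \<open>j\<close> of \<open>X\<close>. The growth with \<open>n\<close> is harmless: the bound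
  serves limits in a fixed dimension.\<close>

lemma trace_norm_le_entries:
  assumes X: "X \<in> carrier_mat n n" and b: "\<And>i j. i < n \<Longrightarrow> j < n \<Longrightarrow> cmod (X $$ (i, j)) \<le> b" and b0: "0 \<le> b"
  shows "trace_norm X \<le> real n * (sqrt (real n) * b)"
proof -
  define S where "S = psd_sqrt (mat_adjoint X * X)"
  have S: "psd n S" and SS: "S * S = mat_adjoint X * X"
    unfolding S_def using psd_sqrt[OF adjoint_mult_psd[OF X]] by auto
  note Sc = psd_carrier[OF S]
  have tn: "trace_norm X = (\<Sum>k<n. Re (S $$ (k, k)))"
    unfolding trace_norm_def S_def[symmetric] mat_trace_eq[OF Sc] by simp
  have "Re (S $$ (j, j)) \<le> sqrt (real n) * b" if j: "j < n" for j
  proof -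
    have "(Re (S $$ (j, j)))\<^sup>2 \<le> (cmod (S $$ (j, j)))\<^sup>2" by (simp add: cmod_power2)
    also have "\<dots> \<le> (\<Sum>k<n. (cmod (S $$ (j, k)))\<^sup>2)"
      using j by (intro member_le_sum[of j "{..<n}" "\<lambda>k. (cmod (S $$ (j, k)))\<^sup>2"]) auto
    also have "\<dots> = Re (\<Sum>k<n. S $$ (j, k) * S $$ (k, j))"
    proof -
      have "S $$ (j, k) * S $$ (k, j) = of_real ((cmod (S $$ (j, k)))\<^sup>2)" if "k < n" for k
        using psd_hermitian[OF S that j] by (simp add: complex_norm_square del: of_real_power)
      then show ?thesis by simp
    qed
    also have "(\<Sum>k<n. S $$ (j, k) * S $$ (k, j)) = (mat_adjoint X * X) $$ (j, j)"
      unfolding SS[symmetric] using mult_index[OF Sc Sc j j] by simp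
    also have "Re \<dots> = (\<Sum>k<n. (cmod (X $$ (k, j)))\<^sup>2)"
      unfolding adjoint_mult_index[OF X j j] by (simp add: cmod_power2) (simp add: power2_eq_square)
    also have "\<dots> \<le> (\<Sum>k<n. b\<^sup>2)" using b j by (intro sum_mono power_mono) auto
    also have "\<dots> = (sqrt (real n) * b)\<^sup>2" by (simp add: power_mult_distrib)
    finally show ?thesis by (rule power2_le_imp_le) (simp add: b0)
  qed
  then have "(\<Sum>k<n. Re (S $$ (k, k))) \<le> (\<Sum>k<n. sqrt (real n) * b)" by (intro sum_mono) auto
  then show ?thesis by (simp add: tn)
qed

lemma trace_norm_nonneg:
  assumes "X \<in> carrier_mat n n"
  shows "0 \<le> trace_norm X"
proof -
  note S = psd_sqrt(1)[OF adjoint_mult_psd[OF assms]]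
  show ?thesis unfolding trace_norm_def mat_trace_eq[OF psd_carrier[OF S]]
    using psd_diag[OF S] by (auto simp: complex_nonneg_iff intro!: sum_nonneg)
qed

lemma orthobasis_trace:
  assumes "orthobasis n u" "A \<in> carrier_mat n n"
  shows "(\<Sum>k<n. sesq n A (u k) (u k)) = mat_trace A"
proof -
  have "(\<Sum>k<n. sesq n A (u k) (u k)) = (\<Sum>i<n. \<Sum>j<n. A $$ (i, j) * (\<Sum>k<n. u k j * cnj (u k i)))"
    unfolding sesq_def sum_distrib_left
    by (rule trans[OF sum_rotate], intro sum.cong refl) (simp add: algebra_simps)
  also have "\<dots> = (\<Sum>i<n. \<Sum>j<n. if j = i then A $$ (i, i) else 0)"
    using assms(1) by (intro sum.cong) (auto simp: orthobasis_def)
  finally show ?thesis by (simp add: mat_trace_eq[OF assms(2)])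
qed

text \<open>The absolute value of a hermitian matrix has the same eigenvectors, with absolute
  eigenvalues.\<close>

lemma hermitian_eigenbasis:
  assumes Y: "Y \<in> carrier_mat n n" and h: "\<And>i j. i < n \<Longrightarrow> j < n \<Longrightarrow> Y $$ (i, j) = cnj (Y $$ (j, i))"
  shows "\<exists>u d. eigenbasis n u d Y \<and> trace_norm Y = (\<Sum>k<n. \<bar>d k\<bar>)"
proof -
  obtain u d where ud: "eigenbasis n u d Y" using spectral_theorem[OF Y h] by blast
  have "mat_adjoint Y = Y" by (rule eq_matI) (use Y in \<open>auto simp: h[symmetric]\<close>)
  then have "eigenbasis n u (\<lambda>k. \<bar>d k\<bar>\<^sup>2) (mat_adjoint Y * Y)"
    using eigenbasis_mult[OF ud ud] by (simp add: power2_eq_square)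
  from psd_sqrt_eigenbasis[OF this] have S: "eigenbasis n u (\<lambda>k. \<bar>d k\<bar>) (psd_sqrt (mat_adjoint Y * Y))" by simp
  have u: "orthobasis n u" using ud by (simp add: eigenbasis_def)
  have "trace_norm Y = Re (\<Sum>k<n. sesq n (psd_sqrt (mat_adjoint Y * Y)) (u k) (u k))"
    unfolding trace_norm_def orthobasis_trace[OF u eigenbasis_carrier[OF S]] ..
  also have "\<dots> = (\<Sum>k<n. \<bar>d k\<bar>)" using eigenbasis_eigenvalue[OF S] by simp
  finally show ?thesis using ud by blast
qed

text \<open>
  Write each eigenvector of \<open>\<omega> - |\<phi>\<rangle>\<langle>\<phi>|\<close> as \<open>a \<phi> + u'\<close>; the cross terms are controlled by the
  Cauchy-Schwarz inequality for the form of \<open>\<omega>\<close>, and \<open>\<omega>\<close> has only weight \<open>1 - F\<close> on the \<open>u'\<close>.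
\<close>

lemma trace_norm_pure_state:
  assumes w: "psd n \<omega>" and tr: "mat_trace \<omega> = 1" and phi: "ip n \<phi> \<phi> = 1"
    and F: "1 - Re (sesq n \<omega> \<phi> \<phi>) \<le> t\<^sup>2" and t: "0 < t"
  shows "trace_norm (\<omega> - mat n n (\<lambda>(i, j). \<phi> i * cnj (\<phi> j))) \<le> 2 * t\<^sup>2 + 2 * t"
proof -
  define P where "P = mat n n (\<lambda>(i, j). \<phi> i * cnj (\<phi> j))"
  have wc: "\<omega> \<in> carrier_mat n n" and Pc: "P \<in> carrier_mat n n" using w by (auto simp: psd_def P_def)
  have Yc: "\<omega> - P \<in> carrier_mat n n" by (rule minus_carrier_mat[OF Pc])
  have Yh: "(\<omega> - P) $$ (i, j) = cnj ((\<omega> - P) $$ (j, i))" if "i < n" "j < n" for i j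
    using psd_hermitian[OF w that] wc that by (simp add: P_def)
  obtain u d where ud: "eigenbasis n u d (\<omega> - P)" and "trace_norm (\<omega> - P) = (\<Sum>k<n. \<bar>d k\<bar>)"
    using hermitian_eigenbasis[OF Yc Yh] by blast
  then have tn: "trace_norm (\<omega> - P) = (\<Sum>k<n. cmod (sesq n (\<omega> - P) (u k) (u k)))"
    using eigenbasis_eigenvalue[OF ud] by simp
  have u: "orthobasis n u" using ud by (simp add: eigenbasis_def)
  define F where "F = Re (sesq n \<omega> \<phi> \<phi>)"
  have F': "sesq n \<omega> \<phi> \<phi> = of_real F" and F0: "0 \<le> F"
    using psd_sesq[OF w, of \<phi>] by (auto simp: F_def complex_nonneg_iff complex_eq_iff)
  define a where "a k = ip n \<phi> (u k)" for k
  \<comment> \<open>This is the \<open>u'\<close> of the remark above, the part of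
    \<open>u k\<close> orthogonal to \<open>\<phi>\<close>.\<close>
  define v where "v k i = 1 * u k i + (- a k) * \<phi> i" for k i
  define q where "q k = Re (sesq n \<omega> (v k) (v k))" for k
  have q': "sesq n \<omega> (v k) (v k) = of_real (q k)" and q0: "0 \<le> q k" for k
    using psd_sesq[OF w, of "v k"] by (auto simp: q_def complex_nonneg_iff complex_eq_iff)
  have uv: "u k = (\<lambda>i. 1 * v k i + a k * \<phi> i)" for k by (auto simp: v_def)
  have sP: "sesq n P x y = ip n x \<phi> * ip n \<phi> y" for x y
    unfolding sesq_def ip_def sum_product by (intro sum.cong) (auto simp: P_def)
  have sY: "sesq n (\<omega> - P) x y = sesq n \<omega> x y - sesq n P x y" for x y
    unfolding sesq_def sum_subtractf[symmetric] using wc Pc by (intro sum.cong) (auto simp: algebra_simps)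
  have suma: "(\<Sum>k<n. (cmod (a k))\<^sup>2) = 1"
  proof -
    have "complex_of_real (\<Sum>k<n. (cmod (a k))\<^sup>2) = (\<Sum>k<n. sesq n P (u k) (u k))"
      unfolding sP using ip_conj[of n _ \<phi>]
      by (auto simp: a_def complex_norm_square mult.commute simp del: of_real_power intro!: sum.cong)
    also have "\<dots> = mat_trace P" by (rule orthobasis_trace[OF u Pc])
    also have "\<dots> = 1" unfolding mat_trace_eq[OF Pc] using phi by (simp add: P_def ip_def mult.commute)
    finally show ?thesis using of_real_eq_1_iff by blast
  qed
  have expand: "sesq n \<omega> (u k) (u k) = of_real (q k) + a k * sesq n \<omega> (v k) \<phi> + cnj (a k) * cnj (sesq n \<omega> (v k) \<phi>) + of_real (F * (cmod (a k))\<^sup>2)" for k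
    apply (subst (1 2) uv)
    unfolding sesq_linear q' F' using psd_hermitian_sesq[OF w, of \<phi> "v k"]
    by (simp add: complex_norm_square mult.commute del: of_real_power)
  have comp: "(\<Sum>k<n. a k * cnj (u k i)) = cnj (\<phi> i)" if "i < n" for i
  proof -
    have "(\<Sum>k<n. a k * cnj (u k i)) = (\<Sum>k<n. \<Sum>j<n. cnj (\<phi> j) * (u k j * cnj (u k i)))"
      by (simp add: a_def ip_def sum_distrib_right mult.assoc)
    also have "\<dots> = (\<Sum>j<n. cnj (\<phi> j) * (\<Sum>k<n. u k j * cnj (u k i)))"
      by (subst sum.swap) (simp add: sum_distrib_left)
    also have "\<dots> = (\<Sum>j<n. if j = i then cnj (\<phi> i) else 0)"
      using u that by (intro sum.cong) (auto simp: orthobasis_def)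
    finally show ?thesis using that by simp
  qed
  have cross: "(\<Sum>k<n. a k * sesq n \<omega> (u k) \<phi>) = of_real F"
  proof -
    have "(\<Sum>k<n. a k * sesq n \<omega> (u k) \<phi>) = (\<Sum>k<n. \<Sum>i<n. \<Sum>j<n. a k * cnj (u k i) * (\<omega> $$ (i, j) * \<phi> j))"
      by (simp add: sesq_def sum_distrib_left mult.assoc)
    also have "\<dots> = (\<Sum>i<n. \<Sum>j<n. (\<Sum>k<n. a k * cnj (u k i)) * (\<omega> $$ (i, j) * \<phi> j))"
      unfolding sum_distrib_right by (rule sum_rotate)
    also have "\<dots> = sesq n \<omega> \<phi> \<phi>" unfolding sesq_def by (intro sum.cong) (auto simp: comp mult.assoc)
    finally show ?thesis by (simp add: F')
  qed
  \<comment> \<open>The trace of \<open>\<omega>\<close> compressed to the complement of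
    \<open>\<phi>\<close>: each of the two cross sums contributes \<open>- F\<close> and the
    diagonal one \<open>F\<close>.\<close>
  have sumq: "(\<Sum>k<n. q k) = 1 - F"
  proof -
    have "complex_of_real (q k) = sesq n \<omega> (u k) (u k) - a k * sesq n \<omega> (u k) \<phi> - cnj (a k * sesq n \<omega> (u k) \<phi>)
        + of_real (F * (cmod (a k))\<^sup>2)" for k
      unfolding q'[symmetric] v_def sesq_linear F' using psd_hermitian_sesq[OF w, of \<phi> "u k"]
      by (simp add: complex_norm_square mult.commute del: of_real_power)
    then have "complex_of_real (\<Sum>k<n. q k) = (\<Sum>k<n. sesq n \<omega> (u k) (u k)) - (\<Sum>k<n. a k * sesq n \<omega> (u k) \<phi>)
       - cnj (\<Sum>k<n. a k * sesq n \<omega> (u k) \<phi>) + of_real (F * (\<Sum>k<n. (cmod (a k))\<^sup>2))"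
      by (simp add: sum.distrib sum_subtractf sum_distrib_left del: complex_cnj_mult)
    also have "\<dots> = of_real (1 - F)"
      unfolding cross suma orthobasis_trace[OF u wc] tr by simp
    finally show ?thesis using of_real_eq_iff by blast
  qed
  have F1: "F \<le> 1" using sumq sum_nonneg[of "{..<n}" q] q0 by simp
  have each: "cmod (sesq n (\<omega> - P) (u k) (u k)) \<le> q k + (t * (cmod (a k))\<^sup>2 + q k / t) + (1 - F) * (cmod (a k))\<^sup>2" for k
  proof -
    define s where "s = a k * sesq n \<omega> (v k) \<phi>"
    have "(cmod (sesq n \<omega> (v k) \<phi>))\<^sup>2 \<le> q k * F"
      using psd_cauchy_schwarz[OF w, of "v k" \<phi>] by (simp add: q' F')
    also have "\<dots> \<le> (sqrt (q k))\<^sup>2" using q0[of k] F1 by (simp add: mult_left_le)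
    finally have "cmod (sesq n \<omega> (v k) \<phi>) \<le> sqrt (q k)" by (rule power2_le_imp_le) (simp add: q0)
    then have "cmod s \<le> cmod (a k) * sqrt (q k)" by (simp add: s_def norm_mult mult_left_mono)
    \<comment> \<open>Arithmetic-geometric mean with weight \<open>t\<close>: summed over
      \<open>k\<close>, the two terms become \<open>t\<close> and \<open>(1 - F) / t\<close>, both
      at most \<open>t\<close>.\<close>
    moreover have "2 * (cmod (a k) * sqrt (q k)) \<le> t * (cmod (a k))\<^sup>2 + q k / t"
    proof -
      have "0 \<le> (t * cmod (a k) - sqrt (q k))\<^sup>2 / t" using t by simp
      also have "\<dots> = t * (cmod (a k))\<^sup>2 + q k / t - 2 * (cmod (a k) * sqrt (q k))"
        using t q0[of k] by (simp add: power2_diff power_mult_distrib field_simps) (simp add: power2_eq_square)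
      finally show ?thesis by simp
    qed
    moreover have "sesq n (\<omega> - P) (u k) (u k) = of_real (q k) + (s + cnj s) - of_real ((1 - F) * (cmod (a k))\<^sup>2)"
    proof -
      have "sesq n P (u k) (u k) = of_real ((cmod (a k))\<^sup>2)"
        unfolding sP using ip_conj[of n "u k" \<phi>] by (simp add: a_def complex_norm_square mult.commute del: of_real_power)
      then show ?thesis unfolding sY expand s_def by (simp add: algebra_simps)
    qed
    moreover have "cmod (of_real (q k) + (s + cnj s) - of_real ((1 - F) * (cmod (a k))\<^sup>2)) \<le> q k + (cmod s + cmod s) + (1 - F) * (cmod (a k))\<^sup>2"
    proof -
      have "cmod (s + cnj s) \<le> cmod s + cmod s" using norm_triangle_ineq[of s "cnj s"] by simp
      moreover have "cmod (complex_of_real (q k)) = q k" "cmod (complex_of_real ((1 - F) * (cmod (a k))\<^sup>2)) = (1 - F) * (cmod (a k))\<^sup>2"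
        using q0[of k] F1 by (simp_all del: of_real_mult of_real_power)
      moreover have "cmod (complex_of_real (q k) + (s + cnj s) - complex_of_real ((1 - F) * (cmod (a k))\<^sup>2)) \<le>
        cmod (complex_of_real (q k)) + cmod (s + cnj s) + cmod (complex_of_real ((1 - F) * (cmod (a k))\<^sup>2))"
        using norm_triangle_ineq4 norm_triangle_ineq by (meson add_right_mono order_trans)
      ultimately show ?thesis by linarith
    qed
    ultimately have "cmod (sesq n (\<omega> - P) (u k) (u k)) \<le> q k + (cmod s + cmod s) + (1 - F) * (cmod (a k))\<^sup>2"
      by (simp only:)
    then show ?thesis using \<open>cmod s \<le> cmod (a k) * sqrt (q k)\<close>
        \<open>2 * (cmod (a k) * sqrt (q k)) \<le> t * (cmod (a k))\<^sup>2 + q k / t\<close> by linarith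
  qed
  have "trace_norm (\<omega> - P) \<le> (\<Sum>k<n. q k + (t * (cmod (a k))\<^sup>2 + q k / t) + (1 - F) * (cmod (a k))\<^sup>2)"
    unfolding tn by (intro sum_mono each)
  also have "\<dots> = (1 - F) + (t + (1 - F) / t) + (1 - F)"
    by (simp only: sum.distrib sum_distrib_left[symmetric] sum_divide_distrib[symmetric] suma sumq mult_1_right)
  also have "\<dots> \<le> t\<^sup>2 + (t + t\<^sup>2 / t) + t\<^sup>2"
    using F t unfolding F_def[symmetric] by (intro add_mono divide_right_mono) auto
  also have "\<dots> = 2 * t\<^sup>2 + 2 * t" using t by (simp add: power2_eq_square)
  finally show ?thesis by (simp add: P_def)
qed

section \<open>Bipartite indices\<close>

lemma idx_less [simp]: "i < a \<Longrightarrow> j < b \<Longrightarrow> i * b + j < a * (b::nat)"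
proof -
  assume "i < a" "j < b"
  then have "i * b + j < Suc i * b" by simp
  also have "\<dots> \<le> a * b" using \<open>i < a\<close> by (intro mult_le_mono1) simp
  finally show ?thesis .
qed

lemma idx_div [simp]: "j < b \<Longrightarrow> (i * b + j) div b = (i::nat)"
  by (simp add: div_mult_self3)

lemma idx_mod [simp]: "j < b \<Longrightarrow> (i * b + j) mod b = (j::nat)"
  by simp

lemma idx_exhaust:
  assumes "r < a * (b::nat)"
  obtains i j where "i < a" "j < b" "r = i * b + j"
proof
  have b: "b > 0" using assms by (cases b) auto
  show "r div b < a" using assms by (simp add: less_mult_imp_div_less)
  show "r mod b < b" using b by simp
  show "r = r div b * b + r mod b" by simp
qed

lemma sum_idx: "(\<Sum>r<a * b. f r) = (\<Sum>i<a. \<Sum>j<(b::nat). f (i * b + j))"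
proof (induction a)
  case (Suc a)
  have "(\<Sum>r<Suc a * b. f r) = (\<Sum>r<a * b + b. f r)" by (simp add: add.commute)
  also have "\<dots> = (\<Sum>r<a * b. f r) + (\<Sum>j<b. f (a * b + j))"
  proof -
    have "(\<Sum>r<c + b. f r) = (\<Sum>r<c. f r) + (\<Sum>j<b. f (c + j))" for c
      by (induction b) (simp_all add: add.assoc)
    then show ?thesis .
  qed
  finally show ?case using Suc by simp
qed simp

lemma bipartite_eqI:
  assumes "A \<in> carrier_mat (a * b) (a * b)" "B \<in> carrier_mat (a * b) (a * b)"
    and "\<And>i j k l. i < a \<Longrightarrow> j < b \<Longrightarrow> k < a \<Longrightarrow> l < b \<Longrightarrow>
      A $$ (i * b + j, k * b + l) = B $$ (i * b + j, k * b + l)"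
  shows "A = B"
proof (rule eq_matI)
  fix r s assume "r < dim_row B" "s < dim_col B"
  then have "r < a * b" "s < a * b" using assms(2) by auto
  then show "A $$ (r, s) = B $$ (r, s)" using assms(3) by (elim idx_exhaust) simp
qed (use assms(1,2) in auto)

lemma on_alice_carrier [simp]: "on_alice a a' b E X \<in> carrier_mat (a' * b) (a' * b)"
  by (simp add: on_alice_def)

lemma on_bob_carrier [simp]: "on_bob a b b' E X \<in> carrier_mat (a * b') (a * b')"
  by (simp add: on_bob_def)

lemma on_alice_dim [simp]: "dim_row (on_alice a a' b E X) = a' * b" "dim_col (on_alice a a' b E X) = a' * b"
  by (simp_all add: on_alice_def)

lemma on_alice_index [simp]:
  assumes "i < a'" "j < b" "k < a'" "l < b"
  shows "on_alice a a' b E X $$ (i * b + j, k * b + l) = E (mat a a (\<lambda>(p, q). X $$ (p * b + j, q * b + l))) $$ (i, k)"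
  using assms by (simp add: on_alice_def)

lemma on_bob_index [simp]:
  assumes "i < a" "j < b'" "k < a" "l < b'"
  shows "on_bob a b b' E X $$ (i * b' + j, k * b' + l) = E (mat b b (\<lambda>(p, q). X $$ (i * b + p, k * b + q))) $$ (j, l)"
  using assms by (simp add: on_bob_def)

section \<open>Linearity, positivity and trace\<close>

text \<open>\<open>K\<close> moves from the matrix to the vectors as its adjoint. This gives
  positivity of conjugations and, for Hadamard matrices, their action on Bell weights.\<close>

lemma sesq_conj:
  "sesq m (mat m m (\<lambda>(i, j). \<Sum>k<n. \<Sum>l<n. K i k * X $$ (k, l) * cnj (K j l))) v v =
    sesq n X (\<lambda>k. \<Sum>i<m. cnj (K i k) * v i) (\<lambda>k. \<Sum>i<m. cnj (K i k) * v i)" (is "sesq m ?Y v v = sesq n X ?w ?w")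
proof -
  have "sesq m ?Y v v = (\<Sum>i<m. \<Sum>j<m. \<Sum>k<n. \<Sum>l<n. cnj (v i) * K i k * X $$ (k, l) * (cnj (K j l) * v j))"
    unfolding sesq_def by (intro sum.cong) (auto simp: sum_distrib_left sum_distrib_right mult.assoc)
  also have "\<dots> = (\<Sum>k<n. \<Sum>l<n. \<Sum>i<m. \<Sum>j<m. cnj (v i) * K i k * X $$ (k, l) * (cnj (K j l) * v j))"
    by (rule trans[OF sum.cong[OF refl sum_rotate] sum_rotate])
  also have "\<dots> = sesq n X ?w ?w"
    unfolding sesq_def by (simp add: sum_distrib_left sum_distrib_right algebra_simps)
  finally show ?thesis .
qed

lemma psd_conj:
  assumes "psd n X"
  shows "psd m (mat m m (\<lambda>(i, j). \<Sum>k<n. \<Sum>l<n. K i k * X $$ (k, l) * cnj (K j l)))"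
  unfolding psd_iff sesq_conj using psd_sesq[OF assms] by simp

lemma psd_reindex:
  assumes "psd n X" "\<And>i. i < m \<Longrightarrow> f i < n"
  shows "psd m (mat m m (\<lambda>(i, j). X $$ (f i, f j)))"
proof -
  have "mat m m (\<lambda>(i, j). X $$ (f i, f j)) =
    mat m m (\<lambda>(i, j). \<Sum>k<n. \<Sum>l<n. (if k = f i then 1 else 0) * X $$ (k, l) * cnj (if l = f j then 1 else 0))"
    by (rule eq_matI) (auto simp: assms(2) if_distrib[of "\<lambda>x. x * _"] if_distrib[of "\<lambda>x. _ * x"] if_distrib[of cnj] cong: if_cong)
  then show ?thesis using psd_conj[OF assms(1), of m "\<lambda>i k. if k = f i then 1 else 0"] by simp
qed

lemma superoperator_carrier: "linear_superoperator n m E \<Longrightarrow> X \<in> carrier_mat n n \<Longrightarrow> E X \<in> carrier_mat m m"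
  by (simp add: linear_superoperator_def)

lemma superoperator_add:
  "linear_superoperator n m E \<Longrightarrow> X \<in> carrier_mat n n \<Longrightarrow> Y \<in> carrier_mat n n \<Longrightarrow> E (X + Y) = E X + E Y"
  by (simp add: linear_superoperator_def)

lemma superoperator_smult:
  "linear_superoperator n m E \<Longrightarrow> X \<in> carrier_mat n n \<Longrightarrow> E (z \<cdot>\<^sub>m X) = z \<cdot>\<^sub>m E X"
  by (simp add: linear_superoperator_def)

lemma superoperator_zero:
  assumes "linear_superoperator n m E"
  shows "E (0\<^sub>m n n) = 0\<^sub>m m m"
proof -
  have "0 \<cdot>\<^sub>m 0\<^sub>m n n = (0\<^sub>m n n :: complex mat)" by (rule eq_matI) auto
  then have "E (0\<^sub>m n n) = 0 \<cdot>\<^sub>m E (0\<^sub>m n n)" using superoperator_smult[OF assms, of "0\<^sub>m n n" 0] by simp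
  moreover have "0 \<cdot>\<^sub>m E (0\<^sub>m n n) = 0\<^sub>m m m" 
    by (rule eq_matI) (use superoperator_carrier[OF assms, of "0\<^sub>m n n"] in auto)
  ultimately show ?thesis by simp
qed

lemma mat_family_sum_carrier [simp]: "mat_family_sum n m A \<in> carrier_mat n n"
  by (simp add: mat_family_sum_def)

lemma mat_family_sum_dim [simp]: "dim_row (mat_family_sum n m A) = n" "dim_col (mat_family_sum n m A) = n"
  by (simp_all add: mat_family_sum_def)

lemma mat_family_sum_index [simp]:
  "i < n \<Longrightarrow> j < n \<Longrightarrow> mat_family_sum n m A $$ (i, j) = (\<Sum>k<m. A k $$ (i, j))"
  by (simp add: mat_family_sum_def)

lemma mat_family_sum_cong:
  "(\<And>k. k < m \<Longrightarrow> A k = B k) \<Longrightarrow> mat_family_sum n m A = mat_family_sum n m B"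
  by (rule eq_matI) auto

lemma superoperator_family_sum:
  assumes E: "linear_superoperator n n' E" and A: "\<And>k. k < m \<Longrightarrow> A k \<in> carrier_mat n n"
  shows "E (mat_family_sum n m A) = mat_family_sum n' m (\<lambda>k. E (A k))"
  using A
proof (induction m)
  case 0
  have "mat_family_sum k 0 B = 0\<^sub>m k k" for k and B :: "nat \<Rightarrow> complex mat" by (rule eq_matI) auto
  then show ?case using superoperator_zero[OF E] by simp
next
  case (Suc m)
  have step: "mat_family_sum k (Suc m) B = mat_family_sum k m B + B m" if "B m \<in> carrier_mat k k" for k and B :: "nat \<Rightarrow> complex mat"
    by (rule eq_matI) (use that in auto)
  have "E (mat_family_sum n (Suc m) A) = E (mat_family_sum n m A) + E (A m)"
    using step Suc.prems superoperator_add[OF E] by simp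
  then show ?case using Suc step superoperator_carrier[OF E] by simp
qed

lemma linear_superoperator_family_sum:
  assumes "\<And>k. k < m \<Longrightarrow> linear_superoperator n n' (E k)"
  shows "linear_superoperator n n' (\<lambda>X. mat_family_sum n' m (\<lambda>k. E k X))"
  unfolding linear_superoperator_def
proof (intro conjI ballI allI)
  fix X Y :: "complex mat" assume XY: "X \<in> carrier_mat n n" "Y \<in> carrier_mat n n"
  show "mat_family_sum n' m (\<lambda>k. E k (X + Y)) = mat_family_sum n' m (\<lambda>k. E k X) + mat_family_sum n' m (\<lambda>k. E k Y)"
  proof (rule eq_matI)
    fix i j assume "i < dim_row (mat_family_sum n' m (\<lambda>k. E k X) + mat_family_sum n' m (\<lambda>k. E k Y))"
      "j < dim_col (mat_family_sum n' m (\<lambda>k. E k X) + mat_family_sum n' m (\<lambda>k. E k Y))"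
    then have ij: "i < n'" "j < n'" by auto
    have "E k (X + Y) $$ (i, j) = E k X $$ (i, j) + E k Y $$ (i, j)" if "k < m" for k
      unfolding superoperator_add[OF assms[OF that] XY]
      using superoperator_carrier[OF assms[OF that] XY(1)] superoperator_carrier[OF assms[OF that] XY(2)] ij by simp
    then show "mat_family_sum n' m (\<lambda>k. E k (X + Y)) $$ (i, j) = (mat_family_sum n' m (\<lambda>k. E k X) + mat_family_sum n' m (\<lambda>k. E k Y)) $$ (i, j)"
      using ij by (simp add: sum.distrib)
  qed simp_all
next
  fix X :: "complex mat" and z assume X: "X \<in> carrier_mat n n"
  show "mat_family_sum n' m (\<lambda>k. E k (z \<cdot>\<^sub>m X)) = z \<cdot>\<^sub>m mat_family_sum n' m (\<lambda>k. E k X)"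
  proof (rule eq_matI)
    fix i j assume "i < dim_row (z \<cdot>\<^sub>m mat_family_sum n' m (\<lambda>k. E k X))" "j < dim_col (z \<cdot>\<^sub>m mat_family_sum n' m (\<lambda>k. E k X))"
    then have ij: "i < n'" "j < n'" by auto
    have "E k (z \<cdot>\<^sub>m X) $$ (i, j) = z * E k X $$ (i, j)" if "k < m" for k
      unfolding superoperator_smult[OF assms[OF that] X]
      using superoperator_carrier[OF assms[OF that] X] ij by simp
    then show "mat_family_sum n' m (\<lambda>k. E k (z \<cdot>\<^sub>m X)) $$ (i, j) = (z \<cdot>\<^sub>m mat_family_sum n' m (\<lambda>k. E k X)) $$ (i, j)"
      using ij by (simp add: sum_distrib_left)
  qed simp_all
qed simp

lemma linear_superoperator_comp:
  assumes "linear_superoperator n m E" "linear_superoperator m k F"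
  shows "linear_superoperator n k (\<lambda>X. F (E X))"
  using assms by (simp add: linear_superoperator_def)

lemma psd_family_sum:
  assumes "\<And>k. k < m \<Longrightarrow> psd n (A k)"
  shows "psd n (mat_family_sum n m A)"
  unfolding psd_iff
proof (intro conjI allI)
  fix v
  have "sesq n (mat_family_sum n m A) v v = (\<Sum>i<n. \<Sum>j<n. \<Sum>k<m. cnj (v i) * A k $$ (i, j) * v j)"
    unfolding sesq_def by (intro sum.cong) (auto simp: sum_distrib_left sum_distrib_right)
  also have "\<dots> = (\<Sum>k<m. sesq n (A k) v v)"
    unfolding sesq_def by (rule sum_rotate[symmetric])
  also have "0 \<le> \<dots>" using psd_sesq[OF assms] by (intro sum_nonneg) auto
  finally show "0 \<le> sesq n (mat_family_sum n m A) v v" .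
qed simp

lemma trace_family_sum:
  assumes "\<And>k. k < m \<Longrightarrow> A k \<in> carrier_mat n n"
  shows "mat_trace (mat_family_sum n m A) = (\<Sum>k<m. mat_trace (A k))"
proof -
  have "mat_trace (mat_family_sum n m A) = (\<Sum>i<n. \<Sum>k<m. A k $$ (i, i))"
    by (simp add: mat_trace_eq[OF mat_family_sum_carrier])
  also have "\<dots> = (\<Sum>k<m. \<Sum>i<n. A k $$ (i, i))" by (rule sum.swap)
  also have "\<dots> = (\<Sum>k<m. mat_trace (A k))" using mat_trace_eq[OF assms] by (intro sum.cong) auto
  finally show ?thesis .
qed

lemma linear_on_alice:
  assumes E: "linear_superoperator a a' E"
  shows "linear_superoperator (a * b) (a' * b) (on_alice a a' b E)"
  unfolding linear_superoperator_def
proof (intro conjI ballI allI)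
  fix X Y :: "complex mat" assume XY: "X \<in> carrier_mat (a * b) (a * b)" "Y \<in> carrier_mat (a * b) (a * b)"
  show "on_alice a a' b E (X + Y) = on_alice a a' b E X + on_alice a a' b E Y"
  proof (rule bipartite_eqI)
    fix i j k l assume ij: "i < a'" "j < b" "k < a'" "l < b"
    have "mat a a (\<lambda>(p, q). (X + Y) $$ (p * b + j, q * b + l)) =
      mat a a (\<lambda>(p, q). X $$ (p * b + j, q * b + l)) + mat a a (\<lambda>(p, q). Y $$ (p * b + j, q * b + l))"
      using XY ij by (intro eq_matI) auto
    then show "on_alice a a' b E (X + Y) $$ (i * b + j, k * b + l) =
      (on_alice a a' b E X + on_alice a a' b E Y) $$ (i * b + j, k * b + l)"
      using ij superoperator_add[OF E]
        carrier_matD[OF superoperator_carrier[OF E, of "mat a a _"]] by (simp add: superoperator_add[OF E])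
  qed simp_all
next
  fix X :: "complex mat" and z assume X: "X \<in> carrier_mat (a * b) (a * b)"
  show "on_alice a a' b E (z \<cdot>\<^sub>m X) = z \<cdot>\<^sub>m on_alice a a' b E X"
  proof (rule bipartite_eqI)
    fix i j k l assume ij: "i < a'" "j < b" "k < a'" "l < b"
    have "mat a a (\<lambda>(p, q). (z \<cdot>\<^sub>m X) $$ (p * b + j, q * b + l)) = z \<cdot>\<^sub>m mat a a (\<lambda>(p, q). X $$ (p * b + j, q * b + l))"
      using X ij by (intro eq_matI) auto
    then show "on_alice a a' b E (z \<cdot>\<^sub>m X) $$ (i * b + j, k * b + l) = (z \<cdot>\<^sub>m on_alice a a' b E X) $$ (i * b + j, k * b + l)"
      using ij carrier_matD[OF superoperator_carrier[OF E, of "mat a a _"]] by (simp add: superoperator_smult[OF E])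
  qed simp_all
qed simp

definition swap_parties :: "nat \<Rightarrow> nat \<Rightarrow> complex mat \<Rightarrow> complex mat" where
  "swap_parties a b X = mat (b * a) (b * a) (\<lambda>(r, c). X $$ ((r mod a) * b + r div a, (c mod a) * b + c div a))"

lemma swap_parties_carrier [simp]: "swap_parties a b X \<in> carrier_mat (b * a) (b * a)"
  by (simp add: swap_parties_def)

lemma swap_parties_dim [simp]: "dim_row (swap_parties a b X) = b * a" "dim_col (swap_parties a b X) = b * a"
  by (simp_all add: swap_parties_def)

lemma swap_parties_index [simp]:
  "i < a \<Longrightarrow> j < b \<Longrightarrow> k < a \<Longrightarrow> l < b \<Longrightarrow>
    swap_parties a b X $$ (j * a + i, l * a + k) = X $$ (i * b + j, k * b + l)"
  by (simp add: swap_parties_def)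

text \<open>Through this identity linearity, positivity and the trace condition pass from Alice's
  operations to Bob's.\<close>

lemma on_bob_swap: "on_bob a b b' E X = swap_parties b' a (on_alice b b' a E (swap_parties a b X))"
proof (rule bipartite_eqI)
  fix i j k l assume ij: "i < a" "j < b'" "k < a" "l < b'"
  have "mat b b (\<lambda>(p, q). swap_parties a b X $$ (p * a + i, q * a + k)) = mat b b (\<lambda>(p, q). X $$ (i * b + p, k * b + q))"
    using ij by (intro eq_matI) auto
  then show "on_bob a b b' E X $$ (i * b' + j, k * b' + l) =
    swap_parties b' a (on_alice b b' a E (swap_parties a b X)) $$ (i * b' + j, k * b' + l)"
    using ij by simp
qed simp_all

lemma linear_swap: "linear_superoperator (a * b) (b * a) (swap_parties a b)"
  unfolding linear_superoperator_def
proof (intro conjI ballI allI)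
  fix X Y :: "complex mat" assume XY: "X \<in> carrier_mat (a * b) (a * b)" "Y \<in> carrier_mat (a * b) (a * b)"
  show "swap_parties a b (X + Y) = swap_parties a b X + swap_parties a b Y"
    by (rule bipartite_eqI[of _ b a]) (use XY in auto)
next
  fix X :: "complex mat" and z assume X: "X \<in> carrier_mat (a * b) (a * b)"
  show "swap_parties a b (z \<cdot>\<^sub>m X) = z \<cdot>\<^sub>m swap_parties a b X"
    by (rule bipartite_eqI[of _ b a]) (use X in auto)
qed simp

lemma psd_swap:
  assumes "psd (a * b) X"
  shows "psd (b * a) (swap_parties a b X)"
  unfolding swap_parties_def by (rule psd_reindex[OF assms]) (auto elim!: idx_exhaust)

lemma trace_swap:
  assumes "X \<in> carrier_mat (a * b) (a * b)"
  shows "mat_trace (swap_parties a b X) = mat_trace X"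
  unfolding mat_trace_eq[OF assms] mat_trace_eq[OF swap_parties_carrier] sum_idx
  by (subst sum.swap) simp

lemma linear_on_bob:
  assumes "linear_superoperator b b' E"
  shows "linear_superoperator (a * b) (a * b') (on_bob a b b' E)"
  unfolding on_bob_swap[abs_def]
  by (rule linear_superoperator_comp[OF linear_superoperator_comp[OF linear_swap linear_on_alice[OF assms]] linear_swap])

lemma psd_on_alice: "completely_positive a a' E \<Longrightarrow> psd (a * b) X \<Longrightarrow> psd (a' * b) (on_alice a a' b E X)"
  by (simp add: completely_positive_def)

lemma psd_on_bob: "completely_positive b b' E \<Longrightarrow> psd (a * b) X \<Longrightarrow> psd (a * b') (on_bob a b b' E X)"
  unfolding on_bob_swap by (intro psd_swap psd_on_alice)

lemma trace_on_alice:
  assumes "instrument a a' m E" "X \<in> carrier_mat (a * b) (a * b)"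
  shows "(\<Sum>k<m. mat_trace (on_alice a a' b (E k) X)) = mat_trace X"
proof -
  define B where "B j = mat a a (\<lambda>(p, q). X $$ (p * b + j, q * b + j))" for j
  have B: "B j \<in> carrier_mat a a" for j by (simp add: B_def)
  have "(\<Sum>k<m. mat_trace (on_alice a a' b (E k) X)) = (\<Sum>k<m. \<Sum>i<a'. \<Sum>j<b. E k (B j) $$ (i, i))"
    unfolding mat_trace_eq[OF on_alice_carrier] sum_idx B_def by (intro sum.cong) auto
  also have "\<dots> = (\<Sum>k<m. \<Sum>j<b. \<Sum>i<a'. E k (B j) $$ (i, i))"
    by (intro sum.cong refl sum.swap)
  also have "\<dots> = (\<Sum>j<b. \<Sum>k<m. mat_trace (E k (B j)))"
  proof (rule trans[OF sum.swap], intro sum.cong refl)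
    fix j k assume "j \<in> {..<b}" "k \<in> {..<m}"
    then have "E k (B j) \<in> carrier_mat a' a'"
      using assms(1) B by (auto simp: instrument_def completely_positive_def linear_superoperator_def)
    then show "(\<Sum>i<a'. E k (B j) $$ (i, i)) = mat_trace (E k (B j))" by (simp add: mat_trace_eq)
  qed
  also have "\<dots> = (\<Sum>j<b. mat_trace (B j))" using assms(1) B by (simp add: instrument_def)
  also have "\<dots> = (\<Sum>j<b. \<Sum>i<a. X $$ (i * b + j, i * b + j))"
    by (intro sum.cong refl) (simp add: mat_trace_eq[OF B], simp add: B_def)
  also have "\<dots> = mat_trace X" unfolding mat_trace_eq[OF assms(2)] sum_idx by (rule sum.swap)
  finally show ?thesis .
qed

lemma trace_on_bob:
  assumes "instrument b b' m E" "X \<in> carrier_mat (a * b) (a * b)"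
  shows "(\<Sum>k<m. mat_trace (on_bob a b b' (E k) X)) = mat_trace X"
  unfolding on_bob_swap trace_swap[OF on_alice_carrier] trace_on_alice[OF assms(1) swap_parties_carrier]
  by (rule trace_swap[OF assms(2)])

lemma instrument_linear: "instrument a a' m E \<Longrightarrow> k < m \<Longrightarrow> linear_superoperator a a' (E k)"
  by (simp add: instrument_def completely_positive_def)

lemma instrument_cp: "instrument a a' m E \<Longrightarrow> k < m \<Longrightarrow> completely_positive a a' (E k)"
  by (simp add: instrument_def)

lemma locc_linear: "locc a' b' a b \<Lambda> \<Longrightarrow> linear_superoperator (a * b) (a' * b') \<Lambda>"
proof (induction rule: locc.induct)
  case stop
  show ?case by (simp add: linear_superoperator_def)
next
  case (alice a c m E b \<Lambda>)
  show ?case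
    by (intro linear_superoperator_family_sum linear_superoperator_comp[OF linear_on_alice] alice instrument_linear[OF alice(1)])
next
  case (bob b c m E a \<Lambda>)
  show ?case
    by (intro linear_superoperator_family_sum linear_superoperator_comp[OF linear_on_bob] bob instrument_linear[OF bob(1)])
qed

lemma locc_carrier: "locc a' b' a b \<Lambda> \<Longrightarrow> X \<in> carrier_mat (a * b) (a * b) \<Longrightarrow> \<Lambda> X \<in> carrier_mat (a' * b') (a' * b')"
  using superoperator_carrier[OF locc_linear] .

lemma locc_psd: "locc a' b' a b \<Lambda> \<Longrightarrow> psd (a * b) X \<Longrightarrow> psd (a' * b') (\<Lambda> X)"
proof (induction arbitrary: X rule: locc.induct)
  case stop
  then show ?case by simp
next
  case (alice a c m E b \<Lambda>)
  show ?case by (intro psd_family_sum alice.IH psd_on_alice[OF instrument_cp[OF alice(1)]] alice.prems)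
next
  case (bob b c m E a \<Lambda>)
  show ?case by (intro psd_family_sum bob.IH psd_on_bob[OF instrument_cp[OF bob(1)]] bob.prems)
qed

lemma locc_trace: "locc a' b' a b \<Lambda> \<Longrightarrow> X \<in> carrier_mat (a * b) (a * b) \<Longrightarrow> mat_trace (\<Lambda> X) = mat_trace X"
proof (induction arbitrary: X rule: locc.induct)
  case stop
  then show ?case by simp
next
  case (alice a c m E b \<Lambda>)
  have "mat_trace (mat_family_sum (a' * b') m (\<lambda>k. \<Lambda> k (on_alice a c b (E k) X))) =
    (\<Sum>k<m. mat_trace (\<Lambda> k (on_alice a c b (E k) X)))"
    by (rule trace_family_sum) (rule locc_carrier[OF alice(2) on_alice_carrier])
  also have "\<dots> = (\<Sum>k<m. mat_trace (on_alice a c b (E k) X))"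
    by (intro sum.cong refl alice.IH) auto
  finally show ?case using trace_on_alice[OF alice(1,4)] by simp
next
  case (bob b c m E a \<Lambda>)
  have "mat_trace (mat_family_sum (a' * b') m (\<lambda>k. \<Lambda> k (on_bob a b c (E k) X))) =
    (\<Sum>k<m. mat_trace (\<Lambda> k (on_bob a b c (E k) X)))"
    by (rule trace_family_sum) (rule locc_carrier[OF bob(2) on_bob_carrier])
  also have "\<dots> = (\<Sum>k<m. mat_trace (on_bob a b c (E k) X))"
    by (intro sum.cong refl bob.IH) auto
  finally show ?case using trace_on_bob[OF bob(1,4)] by simp
qed

section \<open>Building LOCC protocols\<close>

text \<open>\<open>\<Gamma>\<close> is pushed through the outcome sums to the leaves of the protocol
  tree. Linearity justifies this only on matrices of the right size, so agreement is claimed on the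
  carrier alone.\<close>

lemma locc_comp:
  assumes "locc c e a b \<Lambda>" "locc a' b' c e \<Gamma>"
  shows "\<exists>\<Lambda>'. locc a' b' a b \<Lambda>' \<and> (\<forall>X\<in>carrier_mat (a * b) (a * b). \<Lambda>' X = \<Gamma> (\<Lambda> X))"
  using assms(1)
proof (induction rule: locc.induct)
  case stop
  then show ?case using assms(2) by blast
next
  case (alice a c1 m E b \<Lambda>)
  then obtain L where L: "\<And>k. k < m \<Longrightarrow> locc a' b' c1 b (L k)"
    "\<And>k X. k < m \<Longrightarrow> X \<in> carrier_mat (c1 * b) (c1 * b) \<Longrightarrow> L k X = \<Gamma> (\<Lambda> k X)" by metis
  show ?case
  proof (intro exI conjI ballI)
    show "locc a' b' a b (\<lambda>X. mat_family_sum (a' * b') m (\<lambda>k. L k (on_alice a c1 b (E k) X)))"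
      by (rule locc.alice[OF alice(1) L(1)])
    fix X :: "complex mat" assume "X \<in> carrier_mat (a * b) (a * b)"
    show "mat_family_sum (a' * b') m (\<lambda>k. L k (on_alice a c1 b (E k) X)) =
      \<Gamma> (mat_family_sum (c * e) m (\<lambda>k. \<Lambda> k (on_alice a c1 b (E k) X)))"
      by (subst superoperator_family_sum[OF locc_linear[OF assms(2)] locc_carrier[OF alice(2) on_alice_carrier]])
        (auto intro!: mat_family_sum_cong L(2))
  qed
next
  case (bob b c1 m E a \<Lambda>)
  then obtain L where L: "\<And>k. k < m \<Longrightarrow> locc a' b' a c1 (L k)"
    "\<And>k X. k < m \<Longrightarrow> X \<in> carrier_mat (a * c1) (a * c1) \<Longrightarrow> L k X = \<Gamma> (\<Lambda> k X)" by metis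
  show ?case
  proof (intro exI conjI ballI)
    show "locc a' b' a b (\<lambda>X. mat_family_sum (a' * b') m (\<lambda>k. L k (on_bob a b c1 (E k) X)))"
      by (rule locc.bob[OF bob(1) L(1)])
    fix X :: "complex mat" assume "X \<in> carrier_mat (a * b) (a * b)"
    show "mat_family_sum (a' * b') m (\<lambda>k. L k (on_bob a b c1 (E k) X)) =
      \<Gamma> (mat_family_sum (c * e) m (\<lambda>k. \<Lambda> k (on_bob a b c1 (E k) X)))"
      by (subst superoperator_family_sum[OF locc_linear[OF assms(2)] locc_carrier[OF bob(2) on_bob_carrier]])
        (auto intro!: mat_family_sum_cong L(2))
  qed
qed

text \<open>Four unrelated local dimensions are allowed because the intermediate systems of a
  protocol that runs on one factor can have any dimensions.\<close>

definition tensor :: "nat \<Rightarrow> nat \<Rightarrow> nat \<Rightarrow> nat \<Rightarrow> complex mat \<Rightarrow> complex mat \<Rightarrow> complex mat" where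
  "tensor a b c e X Y = mat ((a * c) * (b * e)) ((a * c) * (b * e)) (\<lambda>(r, s).
    let i = r div (b * e); j = r mod (b * e); k = s div (b * e); l = s mod (b * e)
    in X $$ ((i div c) * b + j div e, (k div c) * b + l div e) *
       Y $$ ((i mod c) * e + j mod e, (k mod c) * e + l mod e))"

lemma bipartite_tensor_eq: "bipartite_tensor d e = tensor d d e e"
  by (simp add: fun_eq_iff bipartite_tensor_def tensor_def)

lemma tensor_carrier [simp]: "tensor a b c e X Y \<in> carrier_mat ((a * c) * (b * e)) ((a * c) * (b * e))"
  by (simp add: tensor_def)

lemma tensor_index:
  assumes "i < a" "p < c" "j < b" "q < e" "i' < a" "p' < c" "j' < b" "q' < e"
  shows "tensor a b c e X Y $$ ((i * c + p) * (b * e) + (j * e + q), (i' * c + p') * (b * e) + (j' * e + q')) =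
    X $$ (i * b + j, i' * b + j') * Y $$ (p * e + q, p' * e + q')"
  using assms by (simp add: tensor_def Let_def)

lemma tensor_eqI:
  assumes "A \<in> carrier_mat ((a * c) * (b * e)) ((a * c) * (b * e))"
    "B \<in> carrier_mat ((a * c) * (b * e)) ((a * c) * (b * e))"
    and eq: "\<And>i p j q i' p' j' q'. i < a \<Longrightarrow> p < c \<Longrightarrow> j < b \<Longrightarrow> q < e \<Longrightarrow> i' < a \<Longrightarrow> p' < c \<Longrightarrow> j' < b \<Longrightarrow> q' < e \<Longrightarrow>
      A $$ ((i * c + p) * (b * e) + (j * e + q), (i' * c + p') * (b * e) + (j' * e + q')) =
      B $$ ((i * c + p) * (b * e) + (j * e + q), (i' * c + p') * (b * e) + (j' * e + q'))"
  shows "A = B"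
proof (rule bipartite_eqI[OF assms(1,2)])
  fix i j k l assume *: "i < a * c" "j < b * e" "k < a * c" "l < b * e"
  obtain i1 i2 where i: "i1 < a" "i2 < c" "i = i1 * c + i2" using idx_exhaust[OF *(1)] .
  obtain j1 j2 where j: "j1 < b" "j2 < e" "j = j1 * e + j2" using idx_exhaust[OF *(2)] .
  obtain k1 k2 where k: "k1 < a" "k2 < c" "k = k1 * c + k2" using idx_exhaust[OF *(3)] .
  obtain l1 l2 where l: "l1 < b" "l2 < e" "l = l1 * e + l2" using idx_exhaust[OF *(4)] .
  show "A $$ (i * (b * e) + j, k * (b * e) + l) = B $$ (i * (b * e) + j, k * (b * e) + l)"
    using eq[OF i(1,2) j(1,2) k(1,2) l(1,2)] i(3) j(3) k(3) l(3) by simp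
qed

text \<open>Spectators of dimensions \<open>c\<close> and \<open>k\<close> amount to one of
  dimension \<open>c * k\<close>; this is why an instrument extended by an ancilla stays completely
  positive.\<close>

lemma on_alice_on_alice:
  "on_alice (a * c) (a' * c) k (on_alice a a' c E) X = on_alice a a' (c * k) E X"
proof (rule bipartite_eqI)
  show "on_alice a a' (c * k) E X \<in> carrier_mat (a' * c * k) (a' * c * k)"
    using on_alice_carrier[of a a' "c * k" E X] by (simp add: mult.assoc)
  fix i j i' j' assume *: "i < a' * c" "j < k" "i' < a' * c" "j' < k"
  obtain i1 i2 where i: "i1 < a'" "i2 < c" "i = i1 * c + i2" using idx_exhaust[OF *(1)] .
  obtain i1' i2' where i': "i1' < a'" "i2' < c" "i' = i1' * c + i2'" using idx_exhaust[OF *(3)] .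
  have e: "i * k + j = i1 * (c * k) + (i2 * k + j)" "i' * k + j' = i1' * (c * k) + (i2' * k + j')"
    unfolding i(3) i'(3) by (simp_all add: algebra_simps)
  have e': "u * (c * k) + (i2 * k + j) = (u * c + i2) * k + j" "u * (c * k) + (i2' * k + j') = (u * c + i2') * k + j'" for u
    by (simp_all add: algebra_simps)
  have "mat a a (\<lambda>(p, q). mat (a * c) (a * c) (\<lambda>(p, q). X $$ (p * k + j, q * k + j')) $$ (p * c + i2, q * c + i2')) =
    mat a a (\<lambda>(p, q). X $$ (p * (c * k) + (i2 * k + j), q * (c * k) + (i2' * k + j')))"
    unfolding e' using i i' by (intro eq_matI) auto
  then have "on_alice (a * c) (a' * c) k (on_alice a a' c E) X $$ (i * k + j, i' * k + j') =
    on_alice a a' (c * k) E X $$ (i1 * (c * k) + (i2 * k + j), i1' * (c * k) + (i2' * k + j'))"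
    using * i i' by simp
  then show "on_alice (a * c) (a' * c) k (on_alice a a' c E) X $$ (i * k + j, i' * k + j') =
    on_alice a a' (c * k) E X $$ (i * k + j, i' * k + j')" unfolding e .
qed simp

text \<open>Here \<open>on_alice\<close> only appends a local spectator to the system acted on;
  Bob's instruments are extended by the same lemma.\<close>

lemma instrument_on_alice:
  assumes "instrument a a' m E"
  shows "instrument (a * c) (a' * c) m (\<lambda>k. on_alice a a' c (E k))"
  unfolding instrument_def completely_positive_def
proof (intro conjI allI impI ballI)
  fix k assume k: "k < m"
  show "linear_superoperator (a * c) (a' * c) (on_alice a a' c (E k))"
    by (rule linear_on_alice[OF instrument_linear[OF assms k]])
  fix l X assume "psd (a * c * l) X"
  then show "psd (a' * c * l) (on_alice (a * c) (a' * c) l (on_alice a a' c (E k)) X)"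
    unfolding on_alice_on_alice using psd_on_alice[OF instrument_cp[OF assms k], of "c * l"] by (simp add: mult.assoc)
qed (rule trace_on_alice[OF assms])

lemma on_alice_tensor:
  assumes E: "linear_superoperator a a1 E" and X: "X \<in> carrier_mat (a * b) (a * b)"
  shows "on_alice (a * c) (a1 * c) (b * e) (on_alice a a1 c E) (tensor a b c e X Y) = tensor a1 b c e (on_alice a a1 b E X) Y"
proof (rule tensor_eqI)
  fix i p j q i' p' j' q' assume *: "i < a1" "p < c" "j < b" "q < e" "i' < a1" "p' < c" "j' < b" "q' < e"
  define B where "B = mat a a (\<lambda>(u, v). X $$ (u * b + j, v * b + j'))"
  \<comment> \<open>With the indices of the second factor fixed, the block seen by \<open>E\<close>
    is the scalar \<open>y\<close> times a block of \<open>X\<close>.\<close>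
  define y where "y = Y $$ (p * e + q, p' * e + q')"
  have B: "B \<in> carrier_mat a a" by (simp add: B_def)
  have "mat a a (\<lambda>(u, v). mat (a * c) (a * c) (\<lambda>(s, t). tensor a b c e X Y $$ (s * (b * e) + (j * e + q), t * (b * e) + (j' * e + q'))) $$ (u * c + p, v * c + p'))
    = y \<cdot>\<^sub>m B" (is "?M = _")
    using * by (intro eq_matI) (auto simp: tensor_index B_def y_def)
  then have "on_alice (a * c) (a1 * c) (b * e) (on_alice a a1 c E) (tensor a b c e X Y) $$
     ((i * c + p) * (b * e) + (j * e + q), (i' * c + p') * (b * e) + (j' * e + q')) = E (y \<cdot>\<^sub>m B) $$ (i, i')"
    using * by simp
  also have "\<dots> = y * E B $$ (i, i')"
    using superoperator_smult[OF E B, of y] superoperator_carrier[OF E B] * by simp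
  finally show "on_alice (a * c) (a1 * c) (b * e) (on_alice a a1 c E) (tensor a b c e X Y) $$
     ((i * c + p) * (b * e) + (j * e + q), (i' * c + p') * (b * e) + (j' * e + q')) =
     tensor a1 b c e (on_alice a a1 b E X) Y $$ ((i * c + p) * (b * e) + (j * e + q), (i' * c + p') * (b * e) + (j' * e + q'))"
    using * by (simp add: tensor_index B_def y_def)
qed simp_all

lemma on_bob_tensor:
  assumes E: "linear_superoperator b b1 E" and X: "X \<in> carrier_mat (a * b) (a * b)"
  shows "on_bob (a * c) (b * e) (b1 * e) (on_alice b b1 e E) (tensor a b c e X Y) = tensor a b1 c e (on_bob a b b1 E X) Y"
proof (rule tensor_eqI)
  fix i p j q i' p' j' q' assume *: "i < a" "p < c" "j < b1" "q < e" "i' < a" "p' < c" "j' < b1" "q' < e"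
  define B where "B = mat b b (\<lambda>(u, v). X $$ (i * b + u, i' * b + v))"
  define y where "y = Y $$ (p * e + q, p' * e + q')"
  have B: "B \<in> carrier_mat b b" by (simp add: B_def)
  have "mat b b (\<lambda>(u, v). mat (b * e) (b * e) (\<lambda>(s, t). tensor a b c e X Y $$ ((i * c + p) * (b * e) + s, (i' * c + p') * (b * e) + t)) $$ (u * e + q, v * e + q'))
    = y \<cdot>\<^sub>m B"
    using * by (intro eq_matI) (auto simp: tensor_index B_def y_def)
  then have "on_bob (a * c) (b * e) (b1 * e) (on_alice b b1 e E) (tensor a b c e X Y) $$
     ((i * c + p) * (b1 * e) + (j * e + q), (i' * c + p') * (b1 * e) + (j' * e + q')) = E (y \<cdot>\<^sub>m B) $$ (j, j')"
    using * by simp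
  also have "\<dots> = y * E B $$ (j, j')"
    using superoperator_smult[OF E B, of y] superoperator_carrier[OF E B] * by simp
  finally show "on_bob (a * c) (b * e) (b1 * e) (on_alice b b1 e E) (tensor a b c e X Y) $$
     ((i * c + p) * (b1 * e) + (j * e + q), (i' * c + p') * (b1 * e) + (j' * e + q')) =
     tensor a b1 c e (on_bob a b b1 E X) Y $$ ((i * c + p) * (b1 * e) + (j * e + q), (i' * c + p') * (b1 * e) + (j' * e + q'))"
    using * by (simp add: tensor_index B_def y_def)
qed simp_all

lemma family_sum_tensor:
  "(\<And>k. k < m \<Longrightarrow> A k \<in> carrier_mat (a * b) (a * b)) \<Longrightarrow>
    mat_family_sum ((a * c) * (b * e)) m (\<lambda>k. tensor a b c e (A k) Y) = tensor a b c e (mat_family_sum (a * b) m A) Y"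
  by (rule tensor_eqI[of _ a c b e]) (auto simp: tensor_index sum_distrib_right)

text \<open>Each round is extended by a spectator on the side of the acting party. Describing the
  result on product operators suffices, since the inputs of interest are tensor powers.\<close>

lemma locc_tensor_right:
  assumes "locc a' b' a b \<Lambda>"
  shows "\<exists>\<Lambda>'. locc (a' * c) (b' * e) (a * c) (b * e) \<Lambda>' \<and>
    (\<forall>X\<in>carrier_mat (a * b) (a * b). \<forall>Y. \<Lambda>' (tensor a b c e X Y) = tensor a' b' c e (\<Lambda> X) Y)"
  using assms
proof (induction rule: locc.induct)
  case stop
  show ?case by (intro exI[of _ "\<lambda>X. X"]) (simp add: locc.stop)
next
  case (alice a a1 m E b \<Lambda>)
  then obtain L where L: "\<And>k. k < m \<Longrightarrow> locc (a' * c) (b' * e) (a1 * c) (b * e) (L k)"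
    "\<And>k X Y. k < m \<Longrightarrow> X \<in> carrier_mat (a1 * b) (a1 * b) \<Longrightarrow> L k (tensor a1 b c e X Y) = tensor a' b' c e (\<Lambda> k X) Y"
    by metis
  show ?case
  proof (intro exI conjI ballI allI)
    show "locc (a' * c) (b' * e) (a * c) (b * e) (\<lambda>X. mat_family_sum ((a' * c) * (b' * e)) m
      (\<lambda>k. L k (on_alice (a * c) (a1 * c) (b * e) (on_alice a a1 c (E k)) X)))"
      by (rule locc.alice[OF instrument_on_alice[OF alice(1)] L(1)])
    fix X Y :: "complex mat" assume X: "X \<in> carrier_mat (a * b) (a * b)"
    show "mat_family_sum ((a' * c) * (b' * e)) m
      (\<lambda>k. L k (on_alice (a * c) (a1 * c) (b * e) (on_alice a a1 c (E k)) (tensor a b c e X Y))) =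
      tensor a' b' c e (mat_family_sum (a' * b') m (\<lambda>k. \<Lambda> k (on_alice a a1 b (E k) X))) Y"
      by (subst family_sum_tensor[symmetric], rule locc_carrier[OF alice(2)], simp_all)
        (auto intro!: mat_family_sum_cong simp: on_alice_tensor[OF instrument_linear[OF alice(1)] X] L(2))
  qed
next
  case (bob b b1 m E a \<Lambda>)
  then obtain L where L: "\<And>k. k < m \<Longrightarrow> locc (a' * c) (b' * e) (a * c) (b1 * e) (L k)"
    "\<And>k X Y. k < m \<Longrightarrow> X \<in> carrier_mat (a * b1) (a * b1) \<Longrightarrow> L k (tensor a b1 c e X Y) = tensor a' b' c e (\<Lambda> k X) Y"
    by metis
  show ?case
  proof (intro exI conjI ballI allI)
    show "locc (a' * c) (b' * e) (a * c) (b * e) (\<lambda>X. mat_family_sum ((a' * c) * (b' * e)) m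
      (\<lambda>k. L k (on_bob (a * c) (b * e) (b1 * e) (on_alice b b1 e (E k)) X)))"
      by (rule locc.bob[OF instrument_on_alice[OF bob(1)] L(1)])
    fix X Y :: "complex mat" assume X: "X \<in> carrier_mat (a * b) (a * b)"
    show "mat_family_sum ((a' * c) * (b' * e)) m
      (\<lambda>k. L k (on_bob (a * c) (b * e) (b1 * e) (on_alice b b1 e (E k)) (tensor a b c e X Y))) =
      tensor a' b' c e (mat_family_sum (a' * b') m (\<lambda>k. \<Lambda> k (on_bob a b b1 (E k) X))) Y"
      by (subst family_sum_tensor[symmetric], rule locc_carrier[OF bob(2)], simp_all)
        (auto intro!: mat_family_sum_cong simp: on_bob_tensor[OF instrument_linear[OF bob(1)] X] L(2))
  qed
qed

section \<open>Kraus instruments\<close>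

definition kraus :: "nat \<Rightarrow> nat \<Rightarrow> (nat \<Rightarrow> nat \<Rightarrow> complex) \<Rightarrow> complex mat \<Rightarrow> complex mat" where
  "kraus c a U X = mat c c (\<lambda>(y, y'). \<Sum>z<a. \<Sum>z'<a. U y z * X $$ (z, z') * cnj (U y' z'))"

lemma linear_kraus: "linear_superoperator a c (kraus c a U)"
  unfolding linear_superoperator_def
proof (intro conjI ballI allI)
  fix X Y :: "complex mat" assume XY: "X \<in> carrier_mat a a" "Y \<in> carrier_mat a a"
  show "kraus c a U (X + Y) = kraus c a U X + kraus c a U Y"
    by (rule eq_matI) (use XY in \<open>auto simp: kraus_def sum.distrib ring_distribs\<close>)
next
  fix X :: "complex mat" and z assume X: "X \<in> carrier_mat a a"
  show "kraus c a U (z \<cdot>\<^sub>m X) = z \<cdot>\<^sub>m kraus c a U X"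
    by (rule eq_matI) (use X in \<open>auto simp: kraus_def sum_distrib_left algebra_simps\<close>)
qed (simp add: kraus_def)

lemma on_alice_kraus:
  assumes "i < c" "j < k" "i' < c" "j' < k"
  shows "on_alice a c k (kraus c a U) X $$ (i * k + j, i' * k + j') =
    (\<Sum>z<a. \<Sum>z'<a. U i z * X $$ (z * k + j, z' * k + j') * cnj (U i' z'))"
  using assms by (auto simp: kraus_def intro!: sum.cong)

lemma on_bob_kraus:
  assumes "i < a" "j < c" "i' < a" "j' < c"
  shows "on_bob a b c (kraus c b U) X $$ (i * c + j, i' * c + j') =
    (\<Sum>z<b. \<Sum>z'<b. U j z * X $$ (i * b + z, i' * b + z') * cnj (U j' z'))"
  using assms by (auto simp: kraus_def intro!: sum.cong)

text \<open>Beside a spectator the map is again a conjugation by one matrix \<open>K\<close>, namely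
  \<open>U\<close> tensored with the identity.\<close>

lemma cp_kraus: "completely_positive a c (kraus c a U)"
  unfolding completely_positive_def
proof (intro conjI allI impI linear_kraus)
  fix k X assume X: "psd (a * k) X"
  define K where "K r t = (if t mod k = r mod k then U (r div k) (t div k) else 0)" for r t
  have "on_alice a c k (kraus c a U) X =
    mat (c * k) (c * k) (\<lambda>(r, s). \<Sum>t<a * k. \<Sum>t'<a * k. K r t * X $$ (t, t') * cnj (K s t'))"
  proof (rule bipartite_eqI)
    fix i j i' j' assume *: "i < c" "j < k" "i' < c" "j' < k"
    have "(\<Sum>t<a * k. \<Sum>t'<a * k. K (i * k + j) t * X $$ (t, t') * cnj (K (i' * k + j') t')) =
      (\<Sum>z<a. \<Sum>q<k. \<Sum>z'<a. \<Sum>q'<k. if q' = j' then if q = j then U i z * X $$ (z * k + j, z' * k + j') * cnj (U i' z') else 0 else 0)"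
      unfolding sum_idx using * by (intro sum.cong refl) (auto simp: K_def)
    also have "\<dots> = (\<Sum>z<a. \<Sum>q<k. if q = j then \<Sum>z'<a. U i z * X $$ (z * k + j, z' * k + j') * cnj (U i' z') else 0)"
      using * by (intro sum.cong refl) simp
    also have "\<dots> = (\<Sum>z<a. \<Sum>z'<a. U i z * X $$ (z * k + j, z' * k + j') * cnj (U i' z'))" using * by simp
    finally show "on_alice a c k (kraus c a U) X $$ (i * k + j, i' * k + j') =
      mat (c * k) (c * k) (\<lambda>(r, s). \<Sum>t<a * k. \<Sum>t'<a * k. K r t * X $$ (t, t') * cnj (K s t')) $$ (i * k + j, i' * k + j')"
      unfolding on_alice_kraus[OF *] using * by simp
  qed simp_all
  then show "psd (c * k) (on_alice a c k (kraus c a U) X)" using psd_conj[OF X] by simp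
qed

text \<open>The hypothesis is the completeness relation of Kraus operators, entry by entry.\<close>

lemma instrument_kraus:
  assumes U: "\<And>z z'. z < a \<Longrightarrow> z' < a \<Longrightarrow> (\<Sum>s<m. \<Sum>y<c. U s y z * cnj (U s y z')) = (if z = z' then 1 else 0)"
  shows "instrument a c m (\<lambda>s. kraus c a (U s))"
  unfolding instrument_def
proof (intro conjI allI impI ballI cp_kraus)
  fix X :: "complex mat" assume X: "X \<in> carrier_mat a a"
  have "(\<Sum>s<m. mat_trace (kraus c a (U s) X)) = (\<Sum>s<m. \<Sum>y<c. \<Sum>z<a. \<Sum>z'<a. X $$ (z, z') * (U s y z * cnj (U s y z')))"
    by (auto simp: mat_trace_def kraus_def algebra_simps)
  also have "\<dots> = (\<Sum>z<a. \<Sum>z'<a. \<Sum>s<m. \<Sum>y<c. X $$ (z, z') * (U s y z * cnj (U s y z')))"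
    by (rule trans[OF sum.cong[OF refl sum_rotate] sum_rotate])
  also have "\<dots> = (\<Sum>z<a. \<Sum>z'<a. if z' = z then X $$ (z, z) else 0)"
    using U by (intro sum.cong refl) (auto simp: sum_distrib_left[symmetric])
  also have "\<dots> = mat_trace X" by (simp add: mat_trace_eq[OF X])
  finally show "(\<Sum>s<m. mat_trace (kraus c a (U s) X)) = mat_trace X" .
qed

definition reindex :: "nat \<Rightarrow> (nat \<Rightarrow> nat) \<Rightarrow> complex mat \<Rightarrow> complex mat" where
  "reindex c f X = mat c c (\<lambda>(y, y'). X $$ (f y, f y'))"

lemma reindex_kraus:
  assumes "\<And>y. y < c \<Longrightarrow> f y < a"
  shows "reindex c f = kraus c a (\<lambda>y z. if z = f y then 1 else 0)"
proof (rule ext, rule eq_matI)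
  fix X :: "complex mat" and i j
  assume "i < dim_row (kraus c a (\<lambda>y z. if z = f y then 1 else 0) X)" "j < dim_col (kraus c a (\<lambda>y z. if z = f y then 1 else 0) X)"
  then have ij: "i < c" "j < c" by (auto simp: kraus_def)
  have "(\<Sum>z<a. \<Sum>z'<a. (if z = f i then 1 else 0) * X $$ (z, z') * cnj (if z' = f j then 1 else 0)) =
    (\<Sum>z<a. if z = f i then \<Sum>z'<a. if z' = f j then X $$ (f i, f j) else 0 else 0)"
    using ij assms by (intro sum.cong refl) (auto simp: if_distrib[of "\<lambda>x. _ * x"] if_distrib[of cnj] cong: if_cong)
  then show "reindex c f X $$ (i, j) = kraus c a (\<lambda>y z. if z = f y then 1 else 0) X $$ (i, j)"
    using ij assms by (simp add: reindex_def kraus_def)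
qed (simp_all add: reindex_def kraus_def)

text \<open>A measurement in the computational basis: outcome \<open>s\<close> leaves the basis vectors \<open>f s y\<close>,
  relabelled by \<open>y\<close>.\<close>

lemma instrument_reindex:
  assumes bij: "bij_betw (\<lambda>(s, y). f s y) ({..<m} \<times> {..<c}) {..<a}"
  shows "instrument a c m (\<lambda>s. reindex c (f s))"
proof -
  have fa: "f s y < a" if "s < m" "y < c" for s y
    using bij_betwE[OF bij] that by force
  have "instrument a c m (\<lambda>s. kraus c a (\<lambda>y z. if z = f s y then 1 else 0))"
  proof (rule instrument_kraus)
    fix z z' assume z: "z < a" "z' < a"
    have "(\<Sum>s<m. \<Sum>y<c. (if z = f s y then 1 else 0) * cnj (if z' = f s y then 1 else 0)) =
      (\<Sum>p\<in>{..<m} \<times> {..<c}. if z = (\<lambda>(s, y). f s y) p then (if z = z' then 1 else 0) else (0::complex))"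
      unfolding sum.cartesian_product by (rule sum.cong[OF refl]) auto
    also have "\<dots> = (\<Sum>x<a. if z = x then (if z = z' then 1 else 0) else 0)"
      by (rule sum.reindex_bij_betw[OF bij])
    also have "\<dots> = (if z = z' then 1 else 0)" using z by simp
    finally show "(\<Sum>s<m. \<Sum>y<c. (if z = f s y then 1 else 0) * cnj (if z' = f s y then 1 else 0)) = (if z = z' then 1 else (0::complex))" .
  qed
  moreover have "reindex c (f s) = kraus c a (\<lambda>y z. if z = f s y then 1 else 0)" if "s < m" for s
    using reindex_kraus fa that by blast
  ultimately show ?thesis unfolding instrument_def by simp
qed

lemma on_alice_reindex:
  assumes "i < c" "j < k" "i' < c" "j' < k" "f i < a" "f i' < a"
  shows "on_alice a c k (reindex c f) X $$ (i * k + j, i' * k + j') = X $$ (f i * k + j, f i' * k + j')"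
  using assms by (simp add: reindex_def)

lemma on_bob_reindex:
  assumes "i < a" "j < c" "i' < a" "j' < c" "f j < b" "f j' < b"
  shows "on_bob a b c (reindex c f) X $$ (i * c + j, i' * c + j') = X $$ (i * b + f j, i' * b + f j')"
  using assms by (simp add: reindex_def)

section \<open>LOCC maps up to equality on operators of the right dimension\<close>

definition locc_map :: "nat \<Rightarrow> nat \<Rightarrow> nat \<Rightarrow> nat \<Rightarrow> (complex mat \<Rightarrow> complex mat) \<Rightarrow> bool" where
  "locc_map a' b' a b f \<longleftrightarrow> (\<exists>\<Lambda>. locc a' b' a b \<Lambda> \<and> (\<forall>X\<in>carrier_mat (a * b) (a * b). \<Lambda> X = f X))"

lemma locc_map_locc: "locc a' b' a b \<Lambda> \<Longrightarrow> locc_map a' b' a b \<Lambda>"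
  unfolding locc_map_def by blast

lemma locc_map_cong:
  "locc_map a' b' a b f \<Longrightarrow> (\<And>X. X \<in> carrier_mat (a * b) (a * b) \<Longrightarrow> f X = g X) \<Longrightarrow> locc_map a' b' a b g"
  unfolding locc_map_def by force

lemma locc_map_comp:
  assumes "locc_map c e a b f" "locc_map a' b' c e g"
  shows "locc_map a' b' a b (\<lambda>X. g (f X))"
proof -
  obtain \<Lambda> \<Gamma> where L: "locc c e a b \<Lambda>" "\<And>X. X \<in> carrier_mat (a * b) (a * b) \<Longrightarrow> \<Lambda> X = f X"
    and G: "locc a' b' c e \<Gamma>" "\<And>X. X \<in> carrier_mat (c * e) (c * e) \<Longrightarrow> \<Gamma> X = g X"
    using assms unfolding locc_map_def by blast
  obtain \<Lambda>' where L': "locc a' b' a b \<Lambda>'" "\<And>X. X \<in> carrier_mat (a * b) (a * b) \<Longrightarrow> \<Lambda>' X = \<Gamma> (\<Lambda> X)"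
    using locc_comp[OF L(1) G(1)] by blast
  have "\<Lambda>' X = g (f X)" if "X \<in> carrier_mat (a * b) (a * b)" for X
    using L'(2)[OF that] L(2)[OF that] G(2)[OF locc_carrier[OF L(1) that]] by simp
  then show ?thesis using L'(1) unfolding locc_map_def by blast
qed

lemma locc_map_alice:
  assumes "instrument a c m E" "\<And>k. k < m \<Longrightarrow> locc_map a' b' c b (f k)"
  shows "locc_map a' b' a b (\<lambda>X. mat_family_sum (a' * b') m (\<lambda>k. f k (on_alice a c b (E k) X)))"
proof -
  obtain L where L: "\<And>k. k < m \<Longrightarrow> locc a' b' c b (L k)"
    "\<And>k X. k < m \<Longrightarrow> X \<in> carrier_mat (c * b) (c * b) \<Longrightarrow> L k X = f k X"
    using assms(2) unfolding locc_map_def by metis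
  have "locc_map a' b' a b (\<lambda>X. mat_family_sum (a' * b') m (\<lambda>k. L k (on_alice a c b (E k) X)))"
    by (rule locc_map_locc[OF locc.alice[OF assms(1) L(1)]])
  then show ?thesis by (rule locc_map_cong) (auto intro!: mat_family_sum_cong L(2))
qed

lemma locc_map_bob:
  assumes "instrument b c m E" "\<And>k. k < m \<Longrightarrow> locc_map a' b' a c (f k)"
  shows "locc_map a' b' a b (\<lambda>X. mat_family_sum (a' * b') m (\<lambda>k. f k (on_bob a b c (E k) X)))"
proof -
  obtain L where L: "\<And>k. k < m \<Longrightarrow> locc a' b' a c (L k)"
    "\<And>k X. k < m \<Longrightarrow> X \<in> carrier_mat (a * c) (a * c) \<Longrightarrow> L k X = f k X"
    using assms(2) unfolding locc_map_def by metis
  have "locc_map a' b' a b (\<lambda>X. mat_family_sum (a' * b') m (\<lambda>k. L k (on_bob a b c (E k) X)))"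
    by (rule locc_map_locc[OF locc.bob[OF assms(1) L(1)]])
  then show ?thesis by (rule locc_map_cong) (auto intro!: mat_family_sum_cong L(2))
qed

text \<open>Alice measures, announces \<open>s\<close>, then Bob performs a measurement depending on \<open>s\<close> and announces \<open>t\<close>.\<close>

definition select_block ::
  "nat \<Rightarrow> nat \<Rightarrow> nat \<Rightarrow> (nat \<Rightarrow> nat) \<Rightarrow> (nat \<Rightarrow> nat) \<Rightarrow> complex mat \<Rightarrow> complex mat" where
  "select_block b c e f g X = mat (c * e) (c * e)
    (\<lambda>(r, r'). X $$ (f (r div e) * b + g (r mod e), f (r' div e) * b + g (r' mod e)))"

lemma select_block_carrier [simp]: "select_block b c e f g X \<in> carrier_mat (c * e) (c * e)"
  by (simp add: select_block_def)

lemma select_block_index [simp]: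
  "i < c \<Longrightarrow> j < e \<Longrightarrow> k < c \<Longrightarrow> l < e \<Longrightarrow>
    select_block b c e f g X $$ (i * e + j, k * e + l) = X $$ (f i * b + g j, f k * b + g l)"
  by (simp add: select_block_def)

text \<open>Bijectivity says that the index sets of the outcomes tile the basis. This covers a
  reversible classical computation followed by the readout of a register, as in hashing, and with a
  single outcome any relabelling of a local basis.\<close>

lemma locc_map_measure:
  assumes f: "bij_betw (\<lambda>(s, y). f s y) ({..<m} \<times> {..<c}) {..<a}"
    and g: "\<And>s. s < m \<Longrightarrow> bij_betw (\<lambda>(t, y). g s t y) ({..<n} \<times> {..<e}) {..<b}"
    and h: "\<And>s t. s < m \<Longrightarrow> t < n \<Longrightarrow> locc_map a' b' c e (h s t)"
  shows "locc_map a' b' a b (\<lambda>X. mat_family_sum (a' * b') m (\<lambda>s. mat_family_sum (a' * b') n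
    (\<lambda>t. h s t (select_block b c e (f s) (g s t) X))))"
proof -
  have fa: "f s y < a" if "s < m" "y < c" for s y using bij_betwE[OF f] that by force
  have gb: "g s t y < b" if "s < m" "t < n" "y < e" for s t y using bij_betwE[OF g[OF that(1)]] that by force
  have 1: "locc_map a' b' a b (\<lambda>X. mat_family_sum (a' * b') m (\<lambda>s. mat_family_sum (a' * b') n
    (\<lambda>t. h s t (on_bob c b e (reindex e (g s t)) (on_alice a c b (reindex c (f s)) X)))))"
    by (rule locc_map_alice[OF instrument_reindex[OF f] locc_map_bob[OF instrument_reindex[OF g] h]])
  have 2: "on_bob c b e (reindex e (g s t)) (on_alice a c b (reindex c (f s)) X) = select_block b c e (f s) (g s t) X"
    if "s < m" "t < n" for s t X
    by (rule bipartite_eqI[of _ c e]) (use that fa gb in \<open>simp_all add: on_bob_reindex on_alice_reindex del: on_bob_index on_alice_index\<close>)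
  show ?thesis by (rule locc_map_cong[OF 1], intro mat_family_sum_cong, simp only: 2)
qed

lemma mat_family_sum_one: "A \<in> carrier_mat n n \<Longrightarrow> mat_family_sum n 1 (\<lambda>k. A) = A"
  by (rule eq_matI) auto

lemma locc_map_unitary:
  assumes U: "\<And>z z'. z < a \<Longrightarrow> z' < a \<Longrightarrow> (\<Sum>y<a. U y z * cnj (U y z')) = (if z = z' then 1 else 0)"
    and V: "\<And>z z'. z < b \<Longrightarrow> z' < b \<Longrightarrow> (\<Sum>y<b. V y z * cnj (V y z')) = (if z = z' then 1 else 0)"
  shows "locc_map a b a b (\<lambda>X. on_bob a b b (kraus b b V) (on_alice a a b (kraus a a U) X))"
proof -
  have iU: "instrument a a 1 (\<lambda>s. kraus a a U)" and iV: "instrument b b 1 (\<lambda>s. kraus b b V)"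
    using assms by (auto intro!: instrument_kraus)
  have "locc_map a b a b (\<lambda>X. mat_family_sum (a * b) 1 (\<lambda>k. mat_family_sum (a * b) 1 (\<lambda>l.
    on_bob a b b (kraus b b V) (on_alice a a b (kraus a a U) X))))"
    by (rule locc_map_alice[OF iU locc_map_bob[OF iV locc_map_locc[OF locc.stop]]])
  then show ?thesis by (rule locc_map_cong) (simp only: mat_family_sum_one[OF on_bob_carrier])
qed

text \<open>Both parties discard their systems and prepare basis vector \<open>0\<close>, with Kraus
  operators indexed by the lost basis vector. This keeps the set of channels nonempty.\<close>

lemma locc_exists:
  assumes "a' > 0" "b' > 0"
  shows "\<exists>\<Lambda>. locc a' b' a b \<Lambda>"
proof -
  define U where "U s y z = (if y = 0 \<and> z = s then 1 else 0 :: complex)" for s y z :: nat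
  have I: "instrument a c a (\<lambda>s. kraus c a (U s))" if "c > 0" for a c
  proof (rule instrument_kraus)
    fix z z' assume "z < a" "z' < a"
    have "(\<Sum>s<a. \<Sum>y<c. U s y z * cnj (U s y z')) = (\<Sum>s<a. \<Sum>y<c. if y = 0 then (if s = z then (if z = z' then 1 else 0) else 0) else 0)"
      by (intro sum.cong refl) (auto simp: U_def)
    then show "(\<Sum>s<a. \<Sum>y<c. U s y z * cnj (U s y z')) = (if z = z' then 1 else 0)"
      using \<open>z < a\<close> that by simp
  qed
  show ?thesis using locc.alice[OF I[OF assms(1)] locc.bob[OF I[OF assms(2)] locc.stop]] by blast
qed

section \<open>Bit strings and characters\<close>

lemma xor_less: "x < 2 ^ n \<Longrightarrow> y < 2 ^ n \<Longrightarrow> xor x y < (2::nat) ^ n"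
  by (metis take_bit_nat_eq_self_iff take_bit_xor)

lemma xor_cancel [simp]: "xor x (xor x y) = (y::nat)" "xor (xor x y) y = x" "xor (xor x y) x = y"
  by (metis xor.assoc xor.left_neutral xor_self_eq, metis xor.assoc xor.right_neutral xor_self_eq,
     metis xor.assoc xor.commute xor.right_neutral xor_self_eq)

lemma xor_idx:
  assumes "x2 < 2 ^ n" "y2 < (2::nat) ^ n"
  shows "xor (x1 * 2 ^ n + x2) (y1 * 2 ^ n + y2) = xor x1 y1 * 2 ^ n + xor x2 y2"
proof -
  have "xor (x1 * 2 ^ n + x2) (y1 * 2 ^ n + y2) div 2 ^ n = xor x1 y1"
    using assms drop_bit_xor[of n "x1 * 2 ^ n + x2" "y1 * 2 ^ n + y2"] by (simp add: drop_bit_eq_div)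
  moreover have "xor (x1 * 2 ^ n + x2) (y1 * 2 ^ n + y2) mod 2 ^ n = xor x2 y2"
    using assms take_bit_xor[of n "x1 * 2 ^ n + x2" "y1 * 2 ^ n + y2"] by (simp add: take_bit_eq_mod)
  ultimately show ?thesis by (metis div_mult_mod_eq)
qed

lemma xor_eq_0_iff: "xor x y = 0 \<longleftrightarrow> x = (y::nat)"
  by (metis xor_cancel(2) xor.left_neutral xor_self_eq)

lemma sum_xor:
  assumes "a < (2::nat) ^ n"
  shows "(\<Sum>z<2 ^ n. f (xor z a)) = (\<Sum>z<2 ^ n. f z)"
  by (rule sum.reindex_bij_witness[of _ "\<lambda>z. xor z a" "\<lambda>z. xor z a"]) (auto simp: assms xor_less)

text \<open>The character \<open>(-1) ^ (w . z)\<close> of the group of \<open>n\<close>-bit strings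
  under \<open>xor\<close>; only the lowest \<open>n\<close> bits of both arguments count.\<close>

primrec chi :: "nat \<Rightarrow> nat \<Rightarrow> nat \<Rightarrow> complex" where
  "chi 0 w z = 1"
| "chi (Suc n) w z = (if bit w n \<and> bit z n then -1 else 1) * chi n w z"

lemma chi_xor: "chi n w (xor z z') = chi n w z * chi n w z'"
  by (induction n) (auto simp: bit_xor_iff)

lemma chi_commute: "chi n w z = chi n z w"
  by (induction n) auto

lemma chi_xor_left: "chi n (xor w w') z = chi n w z * chi n w' z"
  using chi_xor chi_commute by metis

lemma chi_0 [simp]: "chi n w 0 = 1" "chi n 0 z = 1"
  by (induction n) auto

lemma chi_square [simp]: "chi n w z * chi n w z = 1"
  by (induction n) auto

lemma chi_cases: "chi n w z = 1 \<or> chi n w z = -1"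
  by (induction n) auto

lemma cnj_chi [simp]: "cnj (chi n w z) = chi n w z"
  using chi_cases[of n w z] by auto

lemma bit_idx:
  assumes "z2 < (2::nat) ^ n"
  shows "bit (z1 * 2 ^ n + z2) i \<longleftrightarrow> (if i < n then bit z2 i else bit z1 (i - n))"
proof -
  have "bit (z1 * 2 ^ n + z2) i \<longleftrightarrow> bit (take_bit n (z1 * 2 ^ n + z2)) i" if "i < n"
    using that by (simp add: bit_take_bit_iff)
  moreover have "bit (z1 * 2 ^ n + z2) i \<longleftrightarrow> bit (drop_bit n (z1 * 2 ^ n + z2)) (i - n)" if "\<not> i < n"
    using that by (simp add: bit_drop_bit_eq)
  ultimately show ?thesis using assms by (simp add: drop_bit_eq_div take_bit_eq_mod)
qed

text \<open>The index \<open>z1 * 2 ^ n + z2\<close> concatenates two bit strings, and the dot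
  product in the exponent splits accordingly.\<close>

lemma chi_idx:
  assumes "w2 < (2::nat) ^ n" "z2 < 2 ^ n"
  shows "chi (k + n) (w1 * 2 ^ n + w2) (z1 * 2 ^ n + z2) = chi k w1 z1 * chi n w2 z2"
proof (induction k)
  case 0
  have "chi m (w1 * 2 ^ n + w2) (z1 * 2 ^ n + z2) = chi m w2 z2" if "m \<le> n" for m
    using that by (induction m) (auto simp: bit_idx[OF assms(1)] bit_idx[OF assms(2)])
  then show ?case by simp
next
  case (Suc k)
  then show ?case by (simp add: bit_idx[OF assms(1)] bit_idx[OF assms(2)])
qed

lemma sum_chi: "z < 2 ^ n \<Longrightarrow> (\<Sum>w<2 ^ n. chi n w z) = (if z = 0 then 2 ^ n else 0)"
proof (induction n arbitrary: z)
  case (Suc n)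
  have "z < 2 * 2 ^ n" using Suc.prems by simp
  then obtain z1 z2 where z: "z1 < 2" "z2 < 2 ^ n" "z = z1 * 2 ^ n + z2" by (rule idx_exhaust)
  have "(\<Sum>w<2 ^ Suc n. chi (Suc n) w z) = (\<Sum>w1<2. \<Sum>w2<2 ^ n. chi (1 + n) (w1 * 2 ^ n + w2) (z1 * 2 ^ n + z2))"
    unfolding z(3) power_Suc sum_idx by simp
  also have "\<dots> = (\<Sum>w1<2. chi 1 w1 z1) * (\<Sum>w2<2 ^ n. chi n w2 z2)"
    unfolding sum_product using z(2) by (intro sum.cong refl) (simp only: chi_idx lessThan_iff)
  also have "(\<Sum>w1<2. chi 1 w1 z1) = (if z1 = 0 then 2 else 0)"
    using z(1) by (cases "z1 = 0") (auto simp: numeral_2_eq_2 bit_0)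
  finally show ?case using Suc.IH[OF z(2)] z by auto
qed simp

lemma sum_chi_xor:
  assumes "z < 2 ^ n" "z' < 2 ^ n"
  shows "(\<Sum>w<2 ^ n. chi n w (xor z z')) = (if z = z' then 2 ^ n else 0)"
  using sum_chi[OF xor_less[OF assms]] by (simp add: xor_eq_0_iff)

section \<open>Bell-diagonal coefficients\<close>

text \<open>
  \<open>bell n \<omega> x w\<close> is the weight of \<open>\<omega>\<close> on the maximally entangled state of \<open>n\<close> qubit pairs with
  bit error \<open>x\<close> and phase error \<open>w\<close> on Bob's side; \<open>bell n \<omega> 0 0\<close> is the fidelity with \<open>n\<close> ebits.
\<close>

definition bell :: "nat \<Rightarrow> complex mat \<Rightarrow> nat \<Rightarrow> nat \<Rightarrow> complex" where
  "bell n \<omega> x w = 1 / 2 ^ n * (\<Sum>z<2 ^ n. \<Sum>z'<2 ^ n.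
    chi n w (xor z z') * \<omega> $$ (z * 2 ^ n + xor z x, z' * 2 ^ n + xor z' x))"

lemma sesq_idx:
  "sesq (a * b) A v v' = (\<Sum>i<a. \<Sum>k<a. \<Sum>j<b. \<Sum>l<b. cnj (v (i * b + j)) * A $$ (i * b + j, k * b + l) * v' (k * b + l))"
  unfolding sesq_def sum_idx by (intro sum.cong refl sum.swap)

text \<open>The vector is an unnormalised Bell vector, with amplitude \<open>chi n w z\<close> at
  the pair \<open>(z, xor z x)\<close>. Being a value of the form of \<open>\<omega>\<close>, the
  weight is nonnegative for positive \<open>\<omega>\<close>.\<close>

lemma bell_sesq:
  assumes "x < 2 ^ n"
  shows "bell n \<omega> x w = 1 / 2 ^ n * sesq (2 ^ n * 2 ^ n) \<omega>
    (\<lambda>r. if r mod 2 ^ n = xor (r div 2 ^ n) x then chi n w (r div 2 ^ n) else 0)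
    (\<lambda>r. if r mod 2 ^ n = xor (r div 2 ^ n) x then chi n w (r div 2 ^ n) else 0)"
proof -
  have "(\<Sum>j<2 ^ n. \<Sum>l<2 ^ n. cnj (if (z * 2 ^ n + j) mod 2 ^ n = xor ((z * 2 ^ n + j) div 2 ^ n) x then chi n w ((z * 2 ^ n + j) div 2 ^ n) else 0) *
      \<omega> $$ (z * 2 ^ n + j, z' * 2 ^ n + l) *
      (if (z' * 2 ^ n + l) mod 2 ^ n = xor ((z' * 2 ^ n + l) div 2 ^ n) x then chi n w ((z' * 2 ^ n + l) div 2 ^ n) else 0)) =
    chi n w (xor z z') * \<omega> $$ (z * 2 ^ n + xor z x, z' * 2 ^ n + xor z' x)" (is "?L = _") if z: "z < 2 ^ n" "z' < 2 ^ n" for z z'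
  proof -
    have "?L = (\<Sum>j<2 ^ n. \<Sum>l<2 ^ n. if l = xor z' x then (if j = xor z x then chi n w z * chi n w z' * \<omega> $$ (z * 2 ^ n + j, z' * 2 ^ n + l) else 0) else 0)"
      by (intro sum.cong refl) simp
    then show ?thesis using xor_less[OF z(1) assms] xor_less[OF z(2) assms] by (simp add: chi_xor)
  qed
  then show ?thesis unfolding bell_def sesq_idx by simp
qed

lemma bell_nonneg:
  assumes "psd (2 ^ n * 2 ^ n) \<omega>" "x < 2 ^ n"
  shows "0 \<le> bell n \<omega> x w"
proof -
  have "(0::complex) \<le> 1 / 2 ^ n * c" if "0 \<le> c" for c
  proof -
    have "1 / 2 ^ n * c = complex_of_real (1 / 2 ^ n) * c" by simp
    then show ?thesis using that by (simp add: complex_nonneg_iff del: of_real_divide)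
  qed
  then show ?thesis unfolding bell_sesq[OF assms(2)] using psd_sesq[OF assms(1)] by blast
qed

text \<open>Summing over \<open>w\<close> kills all terms with \<open>z \<noteq> z'\<close>. What
  remains is the probability that the outcomes of both parties in the computational basis differ by
  \<open>x\<close>, so bit errors can be tested by local measurements.\<close>

lemma bell_sum_phase:
  assumes "x < 2 ^ n"
  shows "(\<Sum>w<2 ^ n. bell n \<omega> x w) = (\<Sum>z<2 ^ n. \<omega> $$ (z * 2 ^ n + xor z x, z * 2 ^ n + xor z x))"
proof -
  have "(\<Sum>w<2 ^ n. bell n \<omega> x w) = 1 / 2 ^ n * (\<Sum>z<2 ^ n. \<Sum>z'<2 ^ n. \<Sum>w<2 ^ n.
    chi n w (xor z z') * \<omega> $$ (z * 2 ^ n + xor z x, z' * 2 ^ n + xor z' x))"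
    unfolding bell_def sum_distrib_left[symmetric] by (subst sum_rotate) (rule refl)
  also have "(\<Sum>z<2 ^ n. \<Sum>z'<2 ^ n. \<Sum>w<2 ^ n. chi n w (xor z z') * \<omega> $$ (z * 2 ^ n + xor z x, z' * 2 ^ n + xor z' x)) =
    (\<Sum>z<2 ^ n. \<Sum>z'<2 ^ n. if z' = z then 2 ^ n * \<omega> $$ (z * 2 ^ n + xor z x, z * 2 ^ n + xor z x) else 0)"
  proof (intro sum.cong refl)
    fix z z' :: nat assume "z \<in> {..<2 ^ n}" "z' \<in> {..<2 ^ n}"
    then have "(\<Sum>w<2 ^ n. chi n w (xor z z')) = (if z = z' then 2 ^ n else 0)" by (intro sum_chi_xor) auto
    then show "(\<Sum>w<2 ^ n. chi n w (xor z z') * \<omega> $$ (z * 2 ^ n + xor z x, z' * 2 ^ n + xor z' x)) =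
      (if z' = z then 2 ^ n * \<omega> $$ (z * 2 ^ n + xor z x, z * 2 ^ n + xor z x) else 0)"
      unfolding sum_distrib_right[symmetric] by simp
  qed
  finally show ?thesis by (simp add: sum_distrib_left)
qed

lemma bell_sum:
  assumes "\<omega> \<in> carrier_mat (2 ^ n * 2 ^ n) (2 ^ n * 2 ^ n)"
  shows "(\<Sum>x<2 ^ n. \<Sum>w<2 ^ n. bell n \<omega> x w) = mat_trace \<omega>"
proof -
  have "(\<Sum>x<2 ^ n. \<Sum>w<2 ^ n. bell n \<omega> x w) = (\<Sum>z<2 ^ n. \<Sum>x<2 ^ n. \<omega> $$ (z * 2 ^ n + xor z x, z * 2 ^ n + xor z x))"
    by (subst sum.swap) (simp add: bell_sum_phase)
  also have "\<dots> = (\<Sum>z<2 ^ n. \<Sum>x<2 ^ n. \<omega> $$ (z * 2 ^ n + x, z * 2 ^ n + x))"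
  proof (rule sum.cong[OF refl])
    fix z :: nat assume "z \<in> {..<2 ^ n}"
    then show "(\<Sum>x<2 ^ n. \<omega> $$ (z * 2 ^ n + xor z x, z * 2 ^ n + xor z x)) = (\<Sum>x<2 ^ n. \<omega> $$ (z * 2 ^ n + x, z * 2 ^ n + x))"
      using sum_xor[of z n "\<lambda>x. \<omega> $$ (z * 2 ^ n + x, z * 2 ^ n + x)"] unfolding xor.commute[of z] by auto
  qed
  also have "\<dots> = mat_trace \<omega>" unfolding mat_trace_eq[OF assms] sum_idx ..
  finally show ?thesis .
qed

lemma bell_tensor:
  assumes "x1 < 2 ^ k" "x2 < 2 ^ n" "w1 < 2 ^ k" "w2 < 2 ^ n"
  shows "bell (k + n) (tensor (2 ^ k) (2 ^ k) (2 ^ n) (2 ^ n) \<tau> \<omega>) (x1 * 2 ^ n + x2) (w1 * 2 ^ n + w2) =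
    bell k \<tau> x1 w1 * bell n \<omega> x2 w2"
proof -
  let ?T = "tensor (2 ^ k) (2 ^ k) (2 ^ n) (2 ^ n) \<tau> \<omega>"
  have "(\<Sum>z<2 ^ (k + n). \<Sum>z'<2 ^ (k + n). chi (k + n) (w1 * 2 ^ n + w2) (xor z z') *
      ?T $$ (z * 2 ^ (k + n) + xor z (x1 * 2 ^ n + x2), z' * 2 ^ (k + n) + xor z' (x1 * 2 ^ n + x2))) =
    (\<Sum>z1<2 ^ k. \<Sum>z2<2 ^ n. \<Sum>z1'<2 ^ k. \<Sum>z2'<2 ^ n.
      (chi k w1 (xor z1 z1') * \<tau> $$ (z1 * 2 ^ k + xor z1 x1, z1' * 2 ^ k + xor z1' x1)) *
      (chi n w2 (xor z2 z2') * \<omega> $$ (z2 * 2 ^ n + xor z2 x2, z2' * 2 ^ n + xor z2' x2)))"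
    unfolding power_add sum_idx
  proof (intro sum.cong refl, goal_cases)
    case (1 z1 z2 z1' z2')
    then have z: "z1 < 2 ^ k" "z2 < 2 ^ n" "z1' < 2 ^ k" "z2' < 2 ^ n" by auto
    have c: "chi (k + n) (w1 * 2 ^ n + w2) (xor (z1 * 2 ^ n + z2) (z1' * 2 ^ n + z2')) = chi k w1 (xor z1 z1') * chi n w2 (xor z2 z2')"
      using z assms by (simp add: xor_idx chi_idx xor_less)
    have t: "?T $$ ((z1 * 2 ^ n + z2) * (2 ^ k * 2 ^ n) + xor (z1 * 2 ^ n + z2) (x1 * 2 ^ n + x2),
      (z1' * 2 ^ n + z2') * (2 ^ k * 2 ^ n) + xor (z1' * 2 ^ n + z2') (x1 * 2 ^ n + x2)) =
      \<tau> $$ (z1 * 2 ^ k + xor z1 x1, z1' * 2 ^ k + xor z1' x1) * \<omega> $$ (z2 * 2 ^ n + xor z2 x2, z2' * 2 ^ n + xor z2' x2)"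
      using z assms by (simp add: xor_idx tensor_index xor_less)
    show ?case unfolding c t by simp
  qed
  also have "\<dots> = (\<Sum>z1<2 ^ k. \<Sum>z1'<2 ^ k. chi k w1 (xor z1 z1') * \<tau> $$ (z1 * 2 ^ k + xor z1 x1, z1' * 2 ^ k + xor z1' x1)) *
      (\<Sum>z2<2 ^ n. \<Sum>z2'<2 ^ n. chi n w2 (xor z2 z2') * \<omega> $$ (z2 * 2 ^ n + xor z2 x2, z2' * 2 ^ n + xor z2' x2))"
    unfolding sum_product by simp
  finally show ?thesis unfolding bell_def by (simp add: power_add)
qed

section \<open>Ebits\<close>

definition ebits_ket :: "nat \<Rightarrow> nat \<Rightarrow> complex" where
  "ebits_ket n r = (if r mod 2 ^ n = r div 2 ^ n then 1 / of_real (sqrt (2 ^ n)) else 0)"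

lemma ebits_ket_sq: "ebits_ket n r * cnj (ebits_ket n s) =
  (if r mod 2 ^ n = r div 2 ^ n \<and> s mod 2 ^ n = s div 2 ^ n then 1 / 2 ^ n else 0)"
  by (auto simp: ebits_ket_def simp flip: of_real_mult)

lemma ebit_index:
  assumes "i < 2" "j < 2" "k < 2" "l < 2"
  shows "ebit $$ (i * 2 + j, k * 2 + l) = (if i = j \<and> k = l then 1 / 2 else 0)"
proof -
  have *: "complex_of_real (sqrt 2) * complex_of_real (sqrt 2) = 2" by (simp flip: of_real_mult)
  have "i = 0 \<or> i = 1" "j = 0 \<or> j = 1" "k = 0 \<or> k = 1" "l = 0 \<or> l = 1" using assms by auto
  then show ?thesis by (elim disjE) (simp_all add: ebit_def ebit_ket_def *)
qed

lemma bipartite_power_carrier: "bipartite_power d \<rho> n \<in> carrier_mat (d ^ n * d ^ n) (d ^ n * d ^ n)"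
  by (cases n) (auto simp: bipartite_tensor_eq)

lemma ebit_power: "bipartite_power 2 ebit n = mat (2 ^ n * 2 ^ n) (2 ^ n * 2 ^ n) (\<lambda>(r, s). ebits_ket n r * cnj (ebits_ket n s))"
proof (induction n)
  case 0
  show ?case by (rule eq_matI) (auto simp: ebits_ket_sq)
next
  case (Suc n)
  show ?case
  proof (rule tensor_eqI[of _ 2 "2 ^ n" 2 "2 ^ n"])
    fix i p j q i' p' j' q' :: nat
    assume *: "i < 2" "p < 2 ^ n" "j < 2" "q < 2 ^ n" "i' < 2" "p' < 2 ^ n" "j' < 2" "q' < 2 ^ n"
    have e: "j * 2 ^ n + q = i * 2 ^ n + p \<longleftrightarrow> j = i \<and> q = p" if "p < 2 ^ n" "q < 2 ^ n" for i j p q :: nat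
      using that by (metis idx_div idx_mod)
    show "bipartite_power 2 ebit (Suc n) $$ ((i * 2 ^ n + p) * (2 * 2 ^ n) + (j * 2 ^ n + q), (i' * 2 ^ n + p') * (2 * 2 ^ n) + (j' * 2 ^ n + q')) =
      mat (2 ^ Suc n * 2 ^ Suc n) (2 ^ Suc n * 2 ^ Suc n) (\<lambda>(r, s). ebits_ket (Suc n) r * cnj (ebits_ket (Suc n) s)) $$
        ((i * 2 ^ n + p) * (2 * 2 ^ n) + (j * 2 ^ n + q), (i' * 2 ^ n + p') * (2 * 2 ^ n) + (j' * 2 ^ n + q'))"
    proof -
      have R: "(i * 2 ^ n + p) * (2 * 2 ^ n) + (j * 2 ^ n + q) < 2 ^ Suc n * 2 ^ Suc n"
        "(i' * 2 ^ n + p') * (2 * 2 ^ n) + (j' * 2 ^ n + q') < 2 ^ Suc n * 2 ^ Suc n"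
        using * unfolding power_Suc by (intro idx_less; simp)+
      have L: "bipartite_power 2 ebit (Suc n) $$ ((i * 2 ^ n + p) * (2 * 2 ^ n) + (j * 2 ^ n + q), (i' * 2 ^ n + p') * (2 * 2 ^ n) + (j' * 2 ^ n + q')) =
        ebit $$ (i * 2 + j, i' * 2 + j') * bipartite_power 2 ebit n $$ (p * 2 ^ n + q, p' * 2 ^ n + q')"
        unfolding bipartite_power.simps bipartite_tensor_eq by (rule tensor_index) (use * in auto)
      show ?thesis
        unfolding L Suc.IH index_mat(1)[OF R] split ebits_ket_sq unfolding power_Suc[of "2::nat"]
        using * e by (simp add: ebit_index ebits_ket_sq)
    qed
  qed (simp_all only: power_Suc mat_carrier bipartite_power_carrier[of 2 ebit "Suc n", unfolded power_Suc])
qed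

lemma ip_ebits_ket: "ip (2 ^ n * 2 ^ n) (ebits_ket n) (ebits_ket n) = 1"
proof -
  have "ip (2 ^ n * 2 ^ n) (ebits_ket n) (ebits_ket n) = (\<Sum>i<2 ^ n::nat. \<Sum>j<2 ^ n::nat. if j = i then 1 / 2 ^ n else (0::complex))"
    unfolding ip_def sum_idx using ebits_ket_sq[of n] by (intro sum.cong refl) (auto simp: mult.commute)
  then show ?thesis by simp
qed

lemma bell_fidelity: "bell n \<omega> 0 0 = sesq (2 ^ n * 2 ^ n) \<omega> (ebits_ket n) (ebits_ket n)"
proof -
  have "cnj (ebits_ket n r) * a * ebits_ket n s = 1 / 2 ^ n * (cnj (if r mod 2 ^ n = xor (r div 2 ^ n) 0 then chi n 0 (r div 2 ^ n) else 0) * a *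
    (if s mod 2 ^ n = xor (s div 2 ^ n) 0 then chi n 0 (s div 2 ^ n) else 0))" for r s a
    using ebits_ket_sq[of n s r] by (auto simp: mult.commute mult.left_commute)
  then show ?thesis
    unfolding bell_sesq[of 0 n, OF zero_less_power[OF zero_less_numeral]] sesq_def sum_distrib_left by simp
qed

lemma trace_norm_ebits:
  assumes w: "psd (2 ^ n * 2 ^ n) \<omega>" and tr: "mat_trace \<omega> = 1"
    and F: "1 - Re (bell n \<omega> 0 0) \<le> t\<^sup>2" and t: "0 < t"
  shows "trace_norm (\<omega> - bipartite_power 2 ebit n) \<le> 2 * t\<^sup>2 + 2 * t"
  using trace_norm_pure_state[OF w tr ip_ebits_ket, of t] F t unfolding bell_fidelity ebit_power by simp

section \<open>Tensor products and powers\<close>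

lemma tensor_dim [simp]: "dim_row (tensor a b c e X Y) = (a * c) * (b * e)" "dim_col (tensor a b c e X Y) = (a * c) * (b * e)"
  by (simp_all add: tensor_def)

lemma tensor_assoc:
  "tensor (a * c) (b * e) f g (tensor a b c e X Y) Z = tensor a b (c * f) (e * g) X (tensor c e f g Y Z)"
proof (rule tensor_eqI[of _ "a * c" f "b * e" g])
  show "tensor a b (c * f) (e * g) X (tensor c e f g Y Z) \<in> carrier_mat ((a * c) * f * ((b * e) * g)) ((a * c) * f * ((b * e) * g))"
    using tensor_carrier[of a b "c * f" "e * g" X "tensor c e f g Y Z"] by (simp only: mult.assoc)
  fix i p j q i' p' j' q'
  assume *: "i < a * c" "p < f" "j < b * e" "q < g" "i' < a * c" "p' < f" "j' < b * e" "q' < g"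
  obtain i1 i2 where i: "i1 < a" "i2 < c" "i = i1 * c + i2" using idx_exhaust[OF *(1)] .
  obtain j1 j2 where j: "j1 < b" "j2 < e" "j = j1 * e + j2" using idx_exhaust[OF *(3)] .
  obtain k1 k2 where k: "k1 < a" "k2 < c" "i' = k1 * c + k2" using idx_exhaust[OF *(5)] .
  obtain l1 l2 where l: "l1 < b" "l2 < e" "j' = l1 * e + l2" using idx_exhaust[OF *(7)] .
  have L: "tensor (a * c) (b * e) f g (tensor a b c e X Y) Z $$
      ((i * f + p) * ((b * e) * g) + (j * g + q), (i' * f + p') * ((b * e) * g) + (j' * g + q')) =
    X $$ (i1 * b + j1, k1 * b + l1) * Y $$ (i2 * e + j2, k2 * e + l2) * Z $$ (p * g + q, p' * g + q')"
    unfolding tensor_index[OF *] unfolding i(3) j(3) k(3) l(3)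
    using i j k l by (simp add: tensor_index)
  have idx: "(x1 * m + x2) * n + y = x1 * (m * n) + (x2 * n + y)" for x1 m x2 n y :: nat
    by (simp add: algebra_simps)
  have R: "tensor a b (c * f) (e * g) X (tensor c e f g Y Z) $$
      ((i1 * (c * f) + (i2 * f + p)) * (b * (e * g)) + (j1 * (e * g) + (j2 * g + q)), (k1 * (c * f) + (k2 * f + p')) * (b * (e * g)) + (l1 * (e * g) + (l2 * g + q'))) =
    X $$ (i1 * b + j1, k1 * b + l1) * (Y $$ (i2 * e + j2, k2 * e + l2) * Z $$ (p * g + q, p' * g + q'))"
    using i j k l * by (simp add: tensor_index)
  have e1: "(i * f + p) * ((b * e) * g) + (j * g + q) = (i1 * (c * f) + (i2 * f + p)) * (b * (e * g)) + (j1 * (e * g) + (j2 * g + q))"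
    and e2: "(i' * f + p') * ((b * e) * g) + (j' * g + q') = (k1 * (c * f) + (k2 * f + p')) * (b * (e * g)) + (l1 * (e * g) + (l2 * g + q'))"
    unfolding i(3) j(3) k(3) l(3) by (simp_all only: idx mult.assoc)
  show "tensor (a * c) (b * e) f g (tensor a b c e X Y) Z $$
      ((i * f + p) * ((b * e) * g) + (j * g + q), (i' * f + p') * ((b * e) * g) + (j' * g + q')) =
    tensor a b (c * f) (e * g) X (tensor c e f g Y Z) $$
      ((i * f + p) * ((b * e) * g) + (j * g + q), (i' * f + p') * ((b * e) * g) + (j' * g + q'))"
    unfolding L unfolding e1 e2 R by simp
qed simp

lemma tensor_one: "Y \<in> carrier_mat (c * e) (c * e) \<Longrightarrow> tensor 1 1 c e (1\<^sub>m 1) Y = Y"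
proof (rule tensor_eqI[of _ 1 c 1 e])
  fix i p j q i' p' j' q' :: nat
  assume "i < 1" "p < c" "j < 1" "q < e" "i' < 1" "p' < c" "j' < 1" "q' < e"
  then show "tensor 1 1 c e (1\<^sub>m 1) Y $$ ((i * c + p) * (1 * e) + (j * e + q), (i' * c + p') * (1 * e) + (j' * e + q')) =
    Y $$ ((i * c + p) * (1 * e) + (j * e + q), (i' * c + p') * (1 * e) + (j' * e + q'))"
    by (subst tensor_index) auto
qed (use tensor_carrier[of 1 1 c e "1\<^sub>m 1" Y] in simp_all)

lemma bipartite_power_add:
  "bipartite_power d \<rho> (m + n) = tensor (d ^ m) (d ^ m) (d ^ n) (d ^ n) (bipartite_power d \<rho> m) (bipartite_power d \<rho> n)"
proof (induction m)
  case 0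
  show ?case using tensor_one[OF bipartite_power_carrier[of d \<rho> n]] by simp
next
  case (Suc m)
  show ?case by (simp add: bipartite_tensor_eq Suc tensor_assoc power_add)
qed

lemma bipartite_power_mult: "bipartite_power d \<rho> (m * n) = bipartite_power (d ^ m) (bipartite_power d \<rho> m) n"
proof (induction n)
  case (Suc n)
  then show ?case by (simp add: bipartite_power_add bipartite_tensor_eq power_mult del: bipartite_power.simps(1))
     (simp add: bipartite_tensor_eq)?
qed simp

text \<open>With \<open>Y = S * S\<close> for the hermitian root \<open>S\<close>, the product is a
  sum over the columns of \<open>S\<close> of conjugates of \<open>X\<close>, and each of these is
  positive.\<close>

lemma psd_tensor:
  assumes X: "psd (a * b) X" and Y: "psd (c * e) Y"
  shows "psd ((a * c) * (b * e)) (tensor a b c e X Y)"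
proof -
  define S where "S = psd_sqrt Y"
  have S: "psd (c * e) S" "S * S = Y" using psd_sqrt[OF Y] by (auto simp: S_def)
  have YS: "Y $$ (r, s) = (\<Sum>k<c * e. S $$ (r, k) * cnj (S $$ (s, k)))" if "r < c * e" "s < c * e" for r s
    unfolding S(2)[symmetric] mult_index[OF psd_carrier[OF S(1)] psd_carrier[OF S(1)] that]
    using psd_hermitian[OF S(1), of _ s] that by (intro sum.cong) auto
  define I where "I r = (r div (b * e) div c) * b + r mod (b * e) div e" for r
  define P where "P r = (r div (b * e) mod c) * e + r mod (b * e) mod e" for r
  have I: "I ((i * c + p) * (b * e) + (j * e + q)) = i * b + j" and P: "P ((i * c + p) * (b * e) + (j * e + q)) = p * e + q"
    if "i < a" "p < c" "j < b" "q < e" for i p j q using that by (auto simp: I_def P_def)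
  define T where "T k = mat ((a * c) * (b * e)) ((a * c) * (b * e)) (\<lambda>(r, s). \<Sum>t<a * b. \<Sum>t'<a * b.
    (if t = I r then S $$ (P r, k) else 0) * X $$ (t, t') * cnj (if t' = I s then S $$ (P s, k) else 0))" for k
  have T: "psd ((a * c) * (b * e)) (T k)" for k unfolding T_def by (rule psd_conj[OF X])
  have Ti: "T k $$ ((i * c + p) * (b * e) + (j * e + q), (i' * c + p') * (b * e) + (j' * e + q')) =
    S $$ (p * e + q, k) * X $$ (i * b + j, i' * b + j') * cnj (S $$ (p' * e + q', k))"
    if *: "i < a" "p < c" "j < b" "q < e" "i' < a" "p' < c" "j' < b" "q' < e" for i p j q i' p' j' q' k
  proof -
    have "(\<Sum>t<a * b. \<Sum>t'<a * b. (if t = i * b + j then S $$ (p * e + q, k) else 0) * X $$ (t, t') *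
        cnj (if t' = i' * b + j' then S $$ (p' * e + q', k) else 0)) =
      (\<Sum>t<a * b. if t = i * b + j then \<Sum>t'<a * b. if t' = i' * b + j' then
        S $$ (p * e + q, k) * X $$ (i * b + j, i' * b + j') * cnj (S $$ (p' * e + q', k)) else 0 else 0)"
      by (intro sum.cong refl) (auto simp: if_distrib[of "\<lambda>x. _ * x"] if_distrib[of cnj] cong: if_cong)
    then show ?thesis unfolding T_def using * by (simp add: I P cong: if_cong)
  qed
  have "tensor a b c e X Y = mat_family_sum ((a * c) * (b * e)) (c * e) T"
  proof (rule tensor_eqI[of _ a c b e])
    fix i p j q i' p' j' q' assume *: "i < a" "p < c" "j < b" "q < e" "i' < a" "p' < c" "j' < b" "q' < e"
    show "tensor a b c e X Y $$ ((i * c + p) * (b * e) + (j * e + q), (i' * c + p') * (b * e) + (j' * e + q')) =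
      mat_family_sum ((a * c) * (b * e)) (c * e) T $$ ((i * c + p) * (b * e) + (j * e + q), (i' * c + p') * (b * e) + (j' * e + q'))"
    proof -
      have "(i * c + p) * (b * e) + (j * e + q) < (a * c) * (b * e)" "(i' * c + p') * (b * e) + (j' * e + q') < (a * c) * (b * e)"
        and "p * e + q < c * e" "p' * e + q' < c * e" using * by simp_all
      then show ?thesis unfolding tensor_index[OF *] by (simp only: mat_family_sum_index Ti[OF *] YS sum_distrib_left)
        (intro sum.cong refl, simp add: mult.assoc mult.commute mult.left_commute)
    qed
  qed simp_all
  then show ?thesis using psd_family_sum[of "c * e" _ T] T by simp
qed

lemma trace_tensor:
  assumes X: "X \<in> carrier_mat (a * b) (a * b)" and Y: "Y \<in> carrier_mat (c * e) (c * e)"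
  shows "mat_trace (tensor a b c e X Y) = mat_trace X * mat_trace Y"
proof -
  have "mat_trace (tensor a b c e X Y) = (\<Sum>i<a. \<Sum>p<c. \<Sum>j<b. \<Sum>q<e. X $$ (i * b + j, i * b + j) * Y $$ (p * e + q, p * e + q))"
    unfolding mat_trace_eq[OF tensor_carrier] sum_idx by (intro sum.cong refl) (simp add: tensor_index)
  also have "\<dots> = (\<Sum>i<a. \<Sum>j<b. \<Sum>p<c. \<Sum>q<e. X $$ (i * b + j, i * b + j) * Y $$ (p * e + q, p * e + q))"
    by (intro sum.cong refl sum.swap)
  also have "\<dots> = mat_trace X * mat_trace Y"
    unfolding mat_trace_eq[OF X] mat_trace_eq[OF Y] sum_idx
    unfolding sum_distrib_right unfolding sum_distrib_left ..
  finally show ?thesis .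
qed

lemma psd_power:
  assumes "psd (a * a) X"
  shows "psd (a ^ N * a ^ N) (bipartite_power a X N)"
proof (induction N)
  case 0
  have "sesq 1 (1\<^sub>m 1) v v = of_real ((cmod (v 0))\<^sup>2)" for v
    by (simp add: sesq_def complex_norm_square mult.commute del: of_real_power)
  then show ?case by (simp add: psd_iff complex_nonneg_iff)
next
  case (Suc N)
  then show ?case using psd_tensor[OF assms, of "a ^ N" "a ^ N"] by (simp add: bipartite_tensor_eq)
qed

lemma bipartite_power_state:
  assumes "\<rho> \<in> density_operators (d * d)"
  shows "psd (d ^ n * d ^ n) (bipartite_power d \<rho> n)" "mat_trace (bipartite_power d \<rho> n) = 1"
proof -
  have r: "psd (d * d) \<rho>" "mat_trace \<rho> = 1" using assms by (auto simp: density_operators_def)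
  show "psd (d ^ n * d ^ n) (bipartite_power d \<rho> n)" by (rule psd_power[OF r(1)])
  show "mat_trace (bipartite_power d \<rho> n) = 1"
  proof (induction n)
    case 0
    show ?case by (simp add: mat_trace_def)
  next
    case (Suc n)
    then show ?case
      using trace_tensor[OF psd_carrier[OF r(1)] bipartite_power_carrier[of d \<rho> n]] by (simp add: bipartite_tensor_eq r(2))
  qed
qed

section \<open>Protocols on one factor, on tensor powers and after a measurement\<close>

lemma locc_map_swap:
  "\<exists>g. locc_map (c * a) (e * b) (a * c) (b * e) g \<and> (\<forall>X Y. g (tensor a b c e X Y) = tensor c e a b Y X)"
proof -
  \<comment> \<open>A measurement with one outcome is a mere relabelling; here the two digits of
    each local index are exchanged.\<close>
  have bij: "bij_betw (\<lambda>(s::nat, y). (y mod a) * c + y div a) ({..<1} \<times> {..<c * a}) {..<a * c}" for a c :: nat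
    by (rule bij_betwI[where g = "\<lambda>z. (0::nat, (z mod c) * a + z div c)"]) (auto elim!: idx_exhaust)
  let ?g = "\<lambda>Z. select_block (b * e) (c * a) (e * b) (\<lambda>y. (y mod a) * c + y div a) (\<lambda>y. (y mod b) * e + y div b) Z"
  have "locc_map (c * a) (e * b) (a * c) (b * e) (\<lambda>Z. mat_family_sum ((c * a) * (e * b)) 1 (\<lambda>s. mat_family_sum ((c * a) * (e * b)) 1 (\<lambda>t. ?g Z)))"
    using locc_map_measure[OF bij bij locc_map_locc[OF locc.stop]] .
  then have "locc_map (c * a) (e * b) (a * c) (b * e) ?g"
    by (rule locc_map_cong) (simp only: mat_family_sum_one[OF select_block_carrier])
  moreover have "?g (tensor a b c e X Y) = tensor c e a b Y X" for X Y
    by (rule tensor_eqI[of _ c a e b]) (simp_all add: tensor_index)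
  ultimately show ?thesis by blast
qed

lemma locc_tensor_left:
  assumes "locc a' b' a b \<Lambda>"
  shows "\<exists>\<Lambda>'. locc (c * a') (e * b') (c * a) (e * b) \<Lambda>' \<and>
    (\<forall>X\<in>carrier_mat (a * b) (a * b). \<forall>Y. \<Lambda>' (tensor c e a b Y X) = tensor c e a' b' Y (\<Lambda> X))"
proof -
  obtain L where L: "locc (a' * c) (b' * e) (a * c) (b * e) L"
    "\<And>X Y. X \<in> carrier_mat (a * b) (a * b) \<Longrightarrow> L (tensor a b c e X Y) = tensor a' b' c e (\<Lambda> X) Y"
    using locc_tensor_right[OF assms] by blast
  obtain g where g: "locc_map (a * c) (b * e) (c * a) (e * b) g" "\<And>X Y. g (tensor c e a b X Y) = tensor a b c e Y X"
    using locc_map_swap by blast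
  obtain h where h: "locc_map (c * a') (e * b') (a' * c) (b' * e) h" "\<And>X Y. h (tensor a' b' c e X Y) = tensor c e a' b' Y X"
    using locc_map_swap by blast
  have "locc_map (c * a') (e * b') (c * a) (e * b) (\<lambda>Z. h (L (g Z)))"
    by (rule locc_map_comp[OF locc_map_comp[OF g(1) locc_map_locc[OF L(1)]] h(1)])
  then obtain L' where L': "locc (c * a') (e * b') (c * a) (e * b) L'"
    "\<And>Z. Z \<in> carrier_mat ((c * a) * (e * b)) ((c * a) * (e * b)) \<Longrightarrow> L' Z = h (L (g Z))"
    unfolding locc_map_def by blast
  have "L' (tensor c e a b Y X) = tensor c e a' b' Y (\<Lambda> X)" if "X \<in> carrier_mat (a * b) (a * b)" for X Y
    using L'(2)[OF tensor_carrier] g(2) L(2)[OF that] h(2) by simp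
  then show ?thesis using L'(1) by blast
qed

text \<open>The first copy is treated by extending \<open>\<Lambda>\<close> on the right, the others
  by extending the protocol for \<open>N\<close> copies on the left.\<close>

lemma locc_power:
  assumes "locc K K a a \<Lambda>"
  shows "\<exists>\<Lambda>'. locc (K ^ N) (K ^ N) (a ^ N) (a ^ N) \<Lambda>' \<and>
    (\<forall>X\<in>carrier_mat (a * a) (a * a). \<Lambda>' (bipartite_power a X N) = bipartite_power K (\<Lambda> X) N)"
proof (induction N)
  case 0
  show ?case using locc.stop[of 1 1] by (intro exI[of _ "\<lambda>X. X"]) simp
next
  case (Suc N)
  then obtain L where L: "locc (K ^ N) (K ^ N) (a ^ N) (a ^ N) L"
    "\<And>X. X \<in> carrier_mat (a * a) (a * a) \<Longrightarrow> L (bipartite_power a X N) = bipartite_power K (\<Lambda> X) N" by blast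
  obtain L1 where L1: "locc (K * a ^ N) (K * a ^ N) (a * a ^ N) (a * a ^ N) L1"
    "\<And>X Y. X \<in> carrier_mat (a * a) (a * a) \<Longrightarrow> L1 (tensor a a (a ^ N) (a ^ N) X Y) = tensor K K (a ^ N) (a ^ N) (\<Lambda> X) Y"
    using locc_tensor_right[OF assms] by blast
  obtain L2 where L2: "locc (K * K ^ N) (K * K ^ N) (K * a ^ N) (K * a ^ N) L2"
    "\<And>X Y. X \<in> carrier_mat (a ^ N * a ^ N) (a ^ N * a ^ N) \<Longrightarrow> L2 (tensor K K (a ^ N) (a ^ N) Y X) = tensor K K (K ^ N) (K ^ N) Y (L X)"
    using locc_tensor_left[OF L(1)] by blast
  obtain L3 where L3: "locc (K * K ^ N) (K * K ^ N) (a * a ^ N) (a * a ^ N) L3"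
    "\<And>X. X \<in> carrier_mat ((a * a ^ N) * (a * a ^ N)) ((a * a ^ N) * (a * a ^ N)) \<Longrightarrow> L3 X = L2 (L1 X)"
    using locc_comp[OF L1(1) L2(1)] by blast
  have "L3 (bipartite_power a X (Suc N)) = bipartite_power K (\<Lambda> X) (Suc N)" if "X \<in> carrier_mat (a * a) (a * a)" for X
    using L3(2)[OF tensor_carrier] L1(2)[OF that] L2(2)[OF bipartite_power_carrier] L(2)[OF that]
    by (simp add: bipartite_tensor_eq)
  then show ?case using L3(1) by (intro exI[of _ L3]) simp
qed

text \<open>On a product input only the diagonal of \<open>X\<close> survives, as the joint law of
  the outcomes. With a decision in \<open>h\<close> this is a test; with constant \<open>h\<close>
  it discards the first factor.\<close>

lemma locc_measure_first:
  assumes h: "\<And>s t. s < A \<Longrightarrow> t < B \<Longrightarrow> locc a' b' c e (h s t)"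
  shows "\<exists>\<Lambda>. locc a' b' (A * c) (B * e) \<Lambda> \<and> (\<forall>X\<in>carrier_mat (A * B) (A * B). \<forall>Y\<in>carrier_mat (c * e) (c * e).
    \<Lambda> (tensor A B c e X Y) = mat_family_sum (a' * b') A (\<lambda>s. mat_family_sum (a' * b') B (\<lambda>t. X $$ (s * B + t, s * B + t) \<cdot>\<^sub>m h s t Y)))"
proof -
  have bij: "bij_betw (\<lambda>(s, y). s * c + y) ({..<A} \<times> {..<c}) {..<A * c}" for A c :: nat
    by (rule bij_betwI[where g = "\<lambda>z. (z div c, z mod c)"]) (auto elim!: idx_exhaust)
  have "locc_map a' b' (A * c) (B * e) (\<lambda>Z. mat_family_sum (a' * b') A (\<lambda>s. mat_family_sum (a' * b') B
    (\<lambda>t. h s t (select_block (B * e) c e (\<lambda>y. s * c + y) (\<lambda>y. t * e + y) Z))))"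
    by (rule locc_map_measure[OF bij bij locc_map_locc[OF h]])
  then obtain L where L: "locc a' b' (A * c) (B * e) L"
    "\<And>Z. Z \<in> carrier_mat ((A * c) * (B * e)) ((A * c) * (B * e)) \<Longrightarrow> L Z = mat_family_sum (a' * b') A (\<lambda>s. mat_family_sum (a' * b') B
    (\<lambda>t. h s t (select_block (B * e) c e (\<lambda>y. s * c + y) (\<lambda>y. t * e + y) Z)))"
    unfolding locc_map_def by blast
  have "L (tensor A B c e X Y) = mat_family_sum (a' * b') A (\<lambda>s. mat_family_sum (a' * b') B (\<lambda>t. X $$ (s * B + t, s * B + t) \<cdot>\<^sub>m h s t Y))"
    if Y: "Y \<in> carrier_mat (c * e) (c * e)" for X Y
    unfolding L(2)[OF tensor_carrier]
  proof (intro mat_family_sum_cong)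
    fix s t assume st: "s < A" "t < B"
    have "select_block (B * e) c e (\<lambda>y. s * c + y) (\<lambda>y. t * e + y) (tensor A B c e X Y) = X $$ (s * B + t, s * B + t) \<cdot>\<^sub>m Y"
      by (rule bipartite_eqI[of _ c e]) (use st Y in \<open>simp_all add: tensor_index\<close>)
    then show "h s t (select_block (B * e) c e (\<lambda>y. s * c + y) (\<lambda>y. t * e + y) (tensor A B c e X Y)) = X $$ (s * B + t, s * B + t) \<cdot>\<^sub>m h s t Y"
      using superoperator_smult[OF locc_linear[OF h[OF st]] Y] by simp
  qed
  then show ?thesis using L(1) by blast
qed

lemma bell_family_sum:
  "bell n (mat_family_sum (2 ^ n * 2 ^ n) m A) x w = (\<Sum>k<m. bell n (A k) x w)" if "x < 2 ^ n"
proof -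
  have "(\<Sum>z<2 ^ n. \<Sum>z'<2 ^ n. chi n w (xor z z') * mat_family_sum (2 ^ n * 2 ^ n) m A $$ (z * 2 ^ n + xor z x, z' * 2 ^ n + xor z' x)) =
    (\<Sum>z<2 ^ n. \<Sum>z'<2 ^ n. \<Sum>k<m. chi n w (xor z z') * A k $$ (z * 2 ^ n + xor z x, z' * 2 ^ n + xor z' x))"
    using that by (intro sum.cong refl) (simp add: xor_less sum_distrib_left)
  also have "\<dots> = (\<Sum>k<m. \<Sum>z<2 ^ n. \<Sum>z'<2 ^ n. chi n w (xor z z') * A k $$ (z * 2 ^ n + xor z x, z' * 2 ^ n + xor z' x))"
    by (rule sum_rotate[symmetric])
  finally show ?thesis unfolding bell_def by (simp add: sum_distrib_left)
qed

lemma bell_smult: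
  assumes "A \<in> carrier_mat (2 ^ n * 2 ^ n) (2 ^ n * 2 ^ n)" "x < 2 ^ n"
  shows "bell n (c \<cdot>\<^sub>m A) x w = c * bell n A x w"
proof -
  have "(c \<cdot>\<^sub>m A) $$ (z * 2 ^ n + xor z x, z' * 2 ^ n + xor z' x) = c * A $$ (z * 2 ^ n + xor z x, z' * 2 ^ n + xor z' x)"
    if "z < 2 ^ n" "z' < 2 ^ n" for z z'
    using assms that xor_less[OF that(1) assms(2)] xor_less[OF that(2) assms(2)] by simp
  then show ?thesis unfolding bell_def by (simp add: sum_distrib_left algebra_simps)
qed

section \<open>Hashing of bit errors\<close>

text \<open>Over the field with two elements, \<open>h\<close> is linear and \<open>ht\<close> is its transpose.\<close>

definition linear_hash :: "nat \<Rightarrow> nat \<Rightarrow> (nat \<Rightarrow> nat) \<Rightarrow> (nat \<Rightarrow> nat) \<Rightarrow> bool" where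
  "linear_hash r q h ht \<longleftrightarrow> (\<forall>z<2 ^ q. h z < 2 ^ r) \<and> (\<forall>w<2 ^ r. ht w < 2 ^ q) \<and>
    (\<forall>z<2 ^ q. \<forall>z'<2 ^ q. h (xor z z') = xor (h z) (h z')) \<and>
    (\<forall>w<2 ^ r. \<forall>z<2 ^ q. chi r w (h z) = chi q (ht w) z)"

lemma linear_hashD:
  assumes "linear_hash r q h ht"
  shows "z < 2 ^ q \<Longrightarrow> h z < 2 ^ r" "w < 2 ^ r \<Longrightarrow> ht w < 2 ^ q"
    "z < 2 ^ q \<Longrightarrow> z' < 2 ^ q \<Longrightarrow> h (xor z z') = xor (h z) (h z')"
    "w < 2 ^ r \<Longrightarrow> z < 2 ^ q \<Longrightarrow> chi r w (h z) = chi q (ht w) z"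
  using assms by (auto simp: linear_hash_def)

text \<open>The parity \<open>a . z\<close> becomes a new top output bit, a row \<open>a\<close>
  added to the matrix; accordingly the transpose adds \<open>a\<close> when the top bit of
  \<open>w\<close> is set.\<close>

lemma linear_hash_extend:
  assumes H: "linear_hash r q h ht" and a: "a < 2 ^ q"
  shows "linear_hash (Suc r) q (\<lambda>z. of_bool (chi q a z = -1) * 2 ^ r + h z)
    (\<lambda>w. xor (ht (w mod 2 ^ r)) (if bit w r then a else 0))"
  unfolding linear_hash_def
proof (intro conjI allI impI)
  note D = linear_hashD[OF H]
  fix z :: nat assume z: "z < 2 ^ q"
  have "of_bool (chi q a z = -1) * 2 ^ r + h z < 2 * (2 ^ r :: nat)"
    by (intro idx_less D(1)[OF z]) simp
  then show "of_bool (chi q a z = -1) * 2 ^ r + h z < (2 ^ Suc r :: nat)" by simp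
  fix z' :: nat assume z': "z' < 2 ^ q"
  have "(of_bool (chi q a (xor z z') = -1) :: nat) = xor (of_bool (chi q a z = -1)) (of_bool (chi q a z' = -1))"
    using chi_cases[of q a z] chi_cases[of q a z'] by (auto simp: chi_xor)
  then show "of_bool (chi q a (xor z z') = -1) * 2 ^ r + h (xor z z') =
    xor (of_bool (chi q a z = -1) * 2 ^ r + h z) (of_bool (chi q a z' = -1) * 2 ^ r + h z')"
    using D(3)[OF z z'] D(1)[OF z] D(1)[OF z'] by (simp add: xor_idx)
next
  note D = linear_hashD[OF H]
  fix w :: nat assume w: "w < 2 ^ Suc r"
  show "xor (ht (w mod 2 ^ r)) (if bit w r then a else 0) < 2 ^ q"
    by (intro xor_less D(2)) (auto simp: a)
  fix z :: nat assume z: "z < 2 ^ q"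
  have "w < 2 * 2 ^ r" using w by simp
  then obtain w1 w2 where w12: "w1 < 2" "w2 < 2 ^ r" "w = w1 * 2 ^ r + w2" by (rule idx_exhaust)
  have b: "bit w r \<longleftrightarrow> w1 = 1" using w12 by (auto simp: bit_idx bit_0 less_2_cases_iff)
  have "chi (Suc r) w (of_bool (chi q a z = -1) * 2 ^ r + h z) = chi (1 + r) (w1 * 2 ^ r + w2) (of_bool (chi q a z = -1) * 2 ^ r + h z)"
    by (simp add: w12(3))
  also have "\<dots> = chi 1 w1 (of_bool (chi q a z = -1)) * chi r w2 (h z)"
    by (rule chi_idx[OF w12(2) D(1)[OF z]])
  also have "chi 1 w1 (of_bool (chi q a z = -1)) = (if bit w r then chi q a z else 1)"
    using w12(1) chi_cases[of q a z] unfolding b by (auto simp: bit_0 less_2_cases_iff)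
  also have "chi r w2 (h z) = chi q (ht w2) z" by (rule D(4)[OF w12(2) z])
  also have "w2 = w mod 2 ^ r" using w12 by simp
  finally show "chi (Suc r) w (of_bool (chi q a z = -1) * 2 ^ r + h z) =
    chi q (xor (ht (w mod 2 ^ r)) (if bit w r then a else 0)) z"
    by (simp add: chi_xor_left)
qed

text \<open>For \<open>z \<noteq> 0\<close> the sum of the characters over \<open>a\<close>
  vanishes, so both parities are equally frequent.\<close>

lemma count_parity:
  assumes "0 < z" "z < 2 ^ q"
  shows "2 * card {a \<in> {..<2 ^ q}. b = (chi q a z = -1)} = 2 ^ q"
proof -
  have "complex_of_nat (2 * card {a \<in> {..<2 ^ q}. b = (chi q a z = -1)}) = 2 * (\<Sum>a<2 ^ q. if b = (chi q a z = -1) then 1 else 0)"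
    by (simp add: sum.If_cases Int_def)
  also have "\<dots> = (\<Sum>a<2 ^ q. 1 + (if b then -1 else 1) * chi q a z)"
    unfolding sum_distrib_left
  proof (intro sum.cong refl)
    fix a show "2 * (if b = (chi q a z = -1) then 1 else 0) = 1 + (if b then -1 else 1) * chi q a z"
      using chi_cases[of q a z] by auto
  qed
  also have "\<dots> = 2 ^ q" using sum_chi[OF assms(2)] assms(1) by (simp add: sum.distrib sum_distrib_left[symmetric])
  also have "\<dots> = complex_of_nat (2 ^ q)" by simp
  finally show ?thesis by (simp only: of_nat_eq_iff)
qed

text \<open>A derandomised random matrix: its rows are chosen one at a time. A pair of
  \<open>P\<close> consists of a prescribed value and a nonzero argument; it is bad while the lowest
  \<open>r\<close> bits of the value agree with the hash of the argument, and each new row can be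
  chosen to halve the bad pairs.\<close>

lemma linear_hash_exists:
  assumes "finite P" "\<And>p. p \<in> P \<Longrightarrow> 0 < snd p \<and> snd p < 2 ^ q"
  shows "\<exists>h ht. linear_hash r q h ht \<and> card {p \<in> P. fst p mod 2 ^ r = h (snd p)} * 2 ^ r \<le> card P"
proof (induction r)
  case 0
  have "linear_hash 0 q (\<lambda>_. 0) (\<lambda>_. 0)" by (simp add: linear_hash_def)
  moreover have "card {p \<in> P. fst p mod 2 ^ 0 = (0::nat)} * 2 ^ 0 \<le> card P"
    using assms(1) by simp
  ultimately show ?case by blast
next
  case (Suc r)
  then obtain h ht where H: "linear_hash r q h ht" and c: "card {p \<in> P. fst p mod 2 ^ r = h (snd p)} * 2 ^ r \<le> card P" by blast
  define Q where "Q = {p \<in> P. fst p mod 2 ^ r = h (snd p)}"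
  have fQ: "finite Q" using assms(1) by (simp add: Q_def)
  define B where "B a = {p \<in> Q. bit (fst p) r = (chi q a (snd p) = -1)}" for a
  have fB: "finite (B a)" for a using fQ by (simp add: B_def)
  \<comment> \<open>Double counting: by \<open>count_parity\<close> each pair of \<open>Q\<close>
    survives for exactly half of the rows \<open>a\<close>, so some row keeps at most half of the
    pairs.\<close>
  have "\<exists>a<2 ^ q. 2 * card (B a) \<le> card Q"
  proof (rule ccontr)
    assume "\<not> ?thesis"
    then have gt: "card Q < 2 * card (B a)" if "a < 2 ^ q" for a using that by force
    have "(\<Sum>a<2 ^ q :: nat. card Q) < (\<Sum>a<2 ^ q. 2 * card (B a))"
      by (rule sum_strict_mono) (auto simp: gt lessThan_empty_iff)
    also have "\<dots> = (\<Sum>a<2 ^ q. 2 * (\<Sum>p\<in>Q. if bit (fst p) r = (chi q a (snd p) = -1) then 1 else 0))"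
      unfolding B_def using fQ by (simp add: sum.If_cases Int_def)
    also have "\<dots> = (\<Sum>p\<in>Q. 2 * (\<Sum>a<2 ^ q. if bit (fst p) r = (chi q a (snd p) = -1) then 1 else 0))"
      unfolding sum_distrib_left by (rule sum.swap)
    also have "\<dots> = (\<Sum>p\<in>Q. 2 * card {a \<in> {..<2 ^ q}. bit (fst p) r = (chi q a (snd p) = -1)})"
      by (simp add: sum.If_cases Int_def)
    also have "\<dots> = (\<Sum>p\<in>Q. 2 ^ q)"
      by (intro sum.cong refl count_parity) (use assms(2) in \<open>auto simp: Q_def\<close>)
    finally show False by simp
  qed
  then obtain a where a: "a < 2 ^ q" "2 * card (B a) \<le> card Q" by blast
  let ?h = "\<lambda>z. of_bool (chi q a z = -1) * 2 ^ r + h z"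
  have m: "x mod 2 ^ Suc r = of_bool (bit x r) * 2 ^ r + x mod 2 ^ r" for x :: nat
    using take_bit_Suc_from_most[of r x] by (simp add: take_bit_eq_mod mult.commute)
  have "{p \<in> P. fst p mod 2 ^ Suc r = ?h (snd p)} = B a"
  proof -
    have "fst p mod 2 ^ Suc r = ?h (snd p) \<longleftrightarrow> fst p mod 2 ^ r = h (snd p) \<and> bit (fst p) r = (chi q a (snd p) = -1)" if "p \<in> P" for p
    proof -
      have hb: "h (snd p) < 2 ^ r" using linear_hashD(1)[OF H] assms(2)[OF that] by blast
      have e: "x1 * 2 ^ r + x2 = y1 * 2 ^ r + y2 \<longleftrightarrow> x1 = y1 \<and> x2 = y2" if "x2 < 2 ^ r" "y2 < 2 ^ r" for x1 x2 y1 y2 :: nat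
        using that by (metis idx_div idx_mod)
      have "fst p mod 2 ^ Suc r = ?h (snd p) \<longleftrightarrow> of_bool (bit (fst p) r) = (of_bool (chi q a (snd p) = -1) :: nat) \<and> fst p mod 2 ^ r = h (snd p)"
        unfolding m by (rule e) (simp_all add: hb)
      then show ?thesis by auto
    qed
    then show ?thesis unfolding B_def Q_def by blast
  qed
  moreover have "card (B a) * 2 ^ Suc r \<le> card P"
  proof -
    have "card (B a) * 2 ^ Suc r = (2 * card (B a)) * 2 ^ r" by simp
    also have "\<dots> \<le> card Q * 2 ^ r" using a(2) by (intro mult_le_mono1)
    also have "\<dots> \<le> card P" using c by (simp add: Q_def)
    finally show ?thesis .
  qed
  ultimately have "card {p \<in> P. fst p mod 2 ^ Suc r = ?h (snd p)} * 2 ^ Suc r \<le> card P" by (simp only:)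
  then show ?case by (intro exI conjI) (rule linear_hash_extend[OF H a(1)])
qed

text \<open>The high part of a pattern is measured, the low part is kept, and the syndrome is the
  high part plus the hash of the low part. Two patterns with equal syndromes and different low parts
  would yield a bad pair; fewer than \<open>2 ^ r\<close> differences leave none.\<close>

lemma decoder_exists:
  assumes S: "S \<subseteq> {..<2 ^ (r + q)}" "(card S)\<^sup>2 < 2 ^ r"
  shows "\<exists>h ht g. linear_hash r q h ht \<and> (\<forall>e. g e < 2 ^ q) \<and>
    (\<forall>x\<in>S. g (xor (x div 2 ^ q) (h (x mod 2 ^ q))) = x mod 2 ^ q)"
proof -
  have fS: "finite S" using S(1) finite_subset by blast
  define D where "D = (\<lambda>(x :: nat, x' :: nat). (xor (x div 2 ^ q) (x' div 2 ^ q), xor (x mod 2 ^ q) (x' mod 2 ^ q)))"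
  \<comment> \<open>Patterns with equal low parts may share a syndrome, because only the low part is
    decoded. Leaving them out makes every second component nonzero.\<close>
  define P where "P = D ` {(x, x') \<in> S \<times> S. x mod 2 ^ q \<noteq> x' mod 2 ^ q}"
  have fin: "finite {(x, x') \<in> S \<times> S. x mod 2 ^ q \<noteq> x' mod 2 ^ q}"
    by (rule finite_subset[of _ "S \<times> S"]) (auto simp: fS)
  then have fP: "finite P" by (simp add: P_def)
  have "card P \<le> card {(x, x') \<in> S \<times> S. x mod 2 ^ q \<noteq> x' mod 2 ^ q}"
    unfolding P_def by (rule card_image_le[OF fin])
  also have "\<dots> \<le> card (S \<times> S)" by (rule card_mono) (auto simp: fS)
  also have "\<dots> = (card S)\<^sup>2" by (simp add: card_cartesian_product power2_eq_square)
  finally have cP: "card P < 2 ^ r" using S(2) by simp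
  have P0: "0 < snd p \<and> snd p < 2 ^ q" if "p \<in> P" for p
    using that by (auto simp: P_def D_def xor_less xor_eq_0_iff intro!: gr0I)
  obtain h ht where H: "linear_hash r q h ht" and c: "card {p \<in> P. fst p mod 2 ^ r = h (snd p)} * 2 ^ r \<le> card P"
    using linear_hash_exists[OF fP P0] by blast
  have "card {p \<in> P. fst p mod 2 ^ r = h (snd p)} = 0"
  proof (rule ccontr)
    assume "card {p \<in> P. fst p mod 2 ^ r = h (snd p)} \<noteq> 0"
    then have "1 * 2 ^ r \<le> card {p \<in> P. fst p mod 2 ^ r = h (snd p)} * 2 ^ r" by (intro mult_le_mono1) simp
    then show False using c cP by linarith
  qed
  then have empty: "fst p mod 2 ^ r \<noteq> h (snd p)" if "p \<in> P" for p
    using fP that by auto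
  define syn where "syn x = xor (x div 2 ^ q) (h (x mod 2 ^ q))" for x
  have inj: "x mod 2 ^ q = x' mod 2 ^ q" if "x \<in> S" "x' \<in> S" "syn x = syn x'" for x x'
  proof (rule ccontr)
    assume ne: "x mod 2 ^ q \<noteq> x' mod 2 ^ q"
    then have "D (x, x') \<in> P" using that by (auto simp: P_def)
    from empty[OF this] have 1: "xor (x div 2 ^ q) (x' div 2 ^ q) mod 2 ^ r \<noteq> h (xor (x mod 2 ^ q) (x' mod 2 ^ q))"
      by (simp add: D_def)
    have lt: "y div 2 ^ q < 2 ^ r" if "y \<in> S" for y
      using S(1) that by (auto simp: power_add less_mult_imp_div_less)
    have "xor (x div 2 ^ q) (x' div 2 ^ q) mod 2 ^ r = xor (x div 2 ^ q) (x' div 2 ^ q)"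
      using xor_less[OF lt lt] that by simp
    also have "\<dots> = xor (h (x mod 2 ^ q)) (h (x' mod 2 ^ q))"
    proof -
      have "xor (x div 2 ^ q) (xor (x' div 2 ^ q) (xor (h (x mod 2 ^ q)) (h (x' mod 2 ^ q)))) = xor (syn x) (syn x')"
        unfolding syn_def by (simp only: ac_simps)
      also have "\<dots> = 0" using that(3) by simp
      finally have "xor (xor (x div 2 ^ q) (x' div 2 ^ q)) (xor (h (x mod 2 ^ q)) (h (x' mod 2 ^ q))) = 0"
        by (simp only: xor.assoc)
      then show ?thesis by (simp only: xor_eq_0_iff)
    qed
    also have "\<dots> = h (xor (x mod 2 ^ q) (x' mod 2 ^ q))" using linear_hashD(3)[OF H] by simp
    finally show False using 1 by simp
  qed
  \<comment> \<open>The default \<open>0\<close> at syndromes of no pattern in \<open>S\<close>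
    keeps the range below \<open>2 ^ q\<close> for all arguments: Bob's relabelling must be a
    bijection for every outcome.\<close>
  define g where "g e = (if \<exists>x\<in>S. syn x = e then (SOME x. x \<in> S \<and> syn x = e) mod 2 ^ q else 0)" for e
  have "g (syn x) = x mod 2 ^ q" if "x \<in> S" for x
  proof -
    have "(SOME y. y \<in> S \<and> syn y = syn x) \<in> S \<and> syn (SOME y. y \<in> S \<and> syn y = syn x) = syn x"
      by (rule someI[of _ x]) (simp add: that)
    then have "(SOME y. y \<in> S \<and> syn y = syn x) mod 2 ^ q = x mod 2 ^ q" by (intro inj[OF _ that]) simp_all
    moreover have "\<exists>y\<in>S. syn y = syn x" using that by blast
    ultimately show ?thesis unfolding g_def by (simp only: if_True)
  qed
  moreover have "g e < 2 ^ q" for e by (simp add: g_def)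
  ultimately have "\<forall>e. g e < 2 ^ q" "\<forall>x\<in>S. g (xor (x div 2 ^ q) (h (x mod 2 ^ q))) = x mod 2 ^ q"
    by (simp_all add: syn_def)
  with H show ?thesis by (intro exI[of _ h] exI[of _ ht] exI[of _ g] conjI)
qed

text \<open>
  Both parties replace \<open>(z\<^sub>1, z\<^sub>2)\<close> by \<open>(z\<^sub>1 + h z\<^sub>2, z\<^sub>2)\<close> and measure the first register. The
  difference \<open>e\<close> of their outcomes is the syndrome of the bit error, from which Bob corrects the
  remaining register; phase errors are transported by the transpose of \<open>h\<close>.
\<close>

lemma hash_step:
  assumes H: "linear_hash r q h ht" and g: "\<And>e. g e < 2 ^ q"
  shows "\<exists>\<Lambda>. locc (2 ^ q) (2 ^ q) (2 ^ (r + q)) (2 ^ (r + q)) \<Lambda> \<and>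
    (\<forall>\<omega>\<in>carrier_mat (2 ^ (r + q) * 2 ^ (r + q)) (2 ^ (r + q) * 2 ^ (r + q)). \<forall>x<2 ^ q. \<forall>w<2 ^ q.
      bell q (\<Lambda> \<omega>) x w = (\<Sum>e<2 ^ r. \<Sum>u<2 ^ r.
        bell (r + q) \<omega> (xor e (h (xor x (g e))) * 2 ^ q + xor x (g e)) (u * 2 ^ q + xor w (ht u))))"
proof -
  note D = linear_hashD[OF H]
  \<comment> \<open>Preimages under hashing: \<open>f s y\<close> is Alice's original index with
    outcome \<open>s\<close> and remainder \<open>y\<close>; \<open>k s t y\<close> is Bob's
    original index with outcome \<open>t\<close> whose remainder becomes \<open>y\<close> after the
    correction by \<open>g (xor s t)\<close>.\<close>
  define f where "f s y = xor s (h y) * 2 ^ q + y" for s y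
  define k where "k s t y = xor t (h (xor y (g (xor s t)))) * 2 ^ q + xor y (g (xor s t))" for s t y
  have N: "(2::nat) ^ (r + q) = 2 ^ r * 2 ^ q" by (simp add: power_add)
  have fbij: "bij_betw (\<lambda>(s, y). f s y) ({..<2 ^ r} \<times> {..<2 ^ q}) {..<2 ^ (r + q)}"
    unfolding N by (rule bij_betwI[where g = "\<lambda>z. (xor (z div 2 ^ q) (h (z mod 2 ^ q)), z mod 2 ^ q)"])
      (auto simp: f_def xor_less D elim!: idx_exhaust)
  have kbij: "bij_betw (\<lambda>(t, y). k s t y) ({..<2 ^ r} \<times> {..<2 ^ q}) {..<2 ^ (r + q)}" for s
    unfolding N by (rule bij_betwI[where g = "\<lambda>z. (xor (z div 2 ^ q) (h (z mod 2 ^ q)), xor (z mod 2 ^ q) (g (xor s (xor (z div 2 ^ q) (h (z mod 2 ^ q))))))"])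
      (auto simp: k_def xor_less D g elim!: idx_exhaust)
  define sel where "sel s t \<omega> = select_block (2 ^ (r + q)) (2 ^ q) (2 ^ q) (f s) (k s t) \<omega>" for s t \<omega>
  have "locc_map (2 ^ q) (2 ^ q) (2 ^ (r + q)) (2 ^ (r + q)) (\<lambda>\<omega>. mat_family_sum (2 ^ q * 2 ^ q) (2 ^ r)
    (\<lambda>s. mat_family_sum (2 ^ q * 2 ^ q) (2 ^ r) (\<lambda>t. sel s t \<omega>)))"
    unfolding sel_def by (rule locc_map_measure[OF fbij kbij locc_map_locc[OF locc.stop]])
  then obtain L where L: "locc (2 ^ q) (2 ^ q) (2 ^ (r + q)) (2 ^ (r + q)) L"
    "\<And>\<omega>. \<omega> \<in> carrier_mat (2 ^ (r + q) * 2 ^ (r + q)) (2 ^ (r + q) * 2 ^ (r + q)) \<Longrightarrow>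
      L \<omega> = mat_family_sum (2 ^ q * 2 ^ q) (2 ^ r) (\<lambda>s. mat_family_sum (2 ^ q * 2 ^ q) (2 ^ r) (\<lambda>t. sel s t \<omega>))"
    unfolding locc_map_def by blast
  have "bell q (L \<omega>) x w = (\<Sum>e<2 ^ r. \<Sum>u<2 ^ r.
        bell (r + q) \<omega> (xor e (h (xor x (g e))) * 2 ^ q + xor x (g e)) (u * 2 ^ q + xor w (ht u)))"
    if \<omega>: "\<omega> \<in> carrier_mat (2 ^ (r + q) * 2 ^ (r + q)) (2 ^ (r + q) * 2 ^ (r + q))" and xw: "x < 2 ^ q" "w < 2 ^ q" for \<omega> x w
  proof -
    define W where "W s z s' z' e = \<omega> $$ (f s z * 2 ^ (r + q) + k s (xor s e) (xor z x), f s' z' * 2 ^ (r + q) + k s' (xor s' e) (xor z' x))" for s z s' z' e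
    have left: "bell q (L \<omega>) x w = (\<Sum>e<2 ^ r. 1 / 2 ^ q * (\<Sum>s<2 ^ r. \<Sum>z<2 ^ q. \<Sum>z'<2 ^ q. chi q w (xor z z') * W s z s z' e))"
    proof -
      have "bell q (L \<omega>) x w = (\<Sum>s<2 ^ r. \<Sum>t<2 ^ r. bell q (sel s t \<omega>) x w)"
        unfolding L(2)[OF \<omega>] using xw by (simp add: bell_family_sum)
      also have "\<dots> = (\<Sum>s<2 ^ r. \<Sum>e<2 ^ r. bell q (sel s (xor s e) \<omega>) x w)"
      proof (rule sum.cong[OF refl])
        fix s :: nat assume "s \<in> {..<2 ^ r}"
        then show "(\<Sum>t<2 ^ r. bell q (sel s t \<omega>) x w) = (\<Sum>e<2 ^ r. bell q (sel s (xor s e) \<omega>) x w)"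
          using sum_xor[of s r "\<lambda>t. bell q (sel s t \<omega>) x w"] by (simp add: xor.commute)
      qed
      also have "\<dots> = (\<Sum>s<2 ^ r. \<Sum>e<2 ^ r. 1 / 2 ^ q * (\<Sum>z<2 ^ q. \<Sum>z'<2 ^ q. chi q w (xor z z') * W s z s z' e))"
        unfolding bell_def sel_def W_def using xw by (simp add: xor_less)
      also have "\<dots> = (\<Sum>e<2 ^ r. \<Sum>s<2 ^ r. 1 / 2 ^ q * (\<Sum>z<2 ^ q. \<Sum>z'<2 ^ q. chi q w (xor z z') * W s z s z' e))"
        by (rule sum.swap)
      finally show ?thesis by (simp only: sum_distrib_left)
    qed
    \<comment> \<open>For a fixed syndrome \<open>e\<close>, the phase label \<open>u\<close> of the
      measured register is summed out, which forces both indices of that register to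
      coincide.\<close>
    have right: "(\<Sum>u<2 ^ r. bell (r + q) \<omega> (xor e (h (xor x (g e))) * 2 ^ q + xor x (g e)) (u * 2 ^ q + xor w (ht u))) =
      1 / 2 ^ q * (\<Sum>s<2 ^ r. \<Sum>z<2 ^ q. \<Sum>z'<2 ^ q. chi q w (xor z z') * W s z s z' e)" if e: "e < 2 ^ r" for e
    proof -
      define x2 where "x2 = xor x (g e)"
      have x2: "x2 < 2 ^ q" using xw g by (simp add: x2_def xor_less)
      let ?X = "xor e (h x2) * 2 ^ q + x2"
      have fsum: "(\<Sum>Z<2 ^ (r + q). F Z) = (\<Sum>s<2 ^ r. \<Sum>z<2 ^ q. F (f s z))" for F :: "nat \<Rightarrow> complex"
        using sum.reindex_bij_betw[OF fbij, of F] by (simp add: sum.cartesian_product case_prod_unfold)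
      have fx: "xor (f s z) ?X = k s (xor s e) (xor z x)" if "s < 2 ^ r" "z < 2 ^ q" for s z
      proof -
        have "xor (f s z) ?X = xor (xor s (h z)) (xor e (h x2)) * 2 ^ q + xor z x2"
          unfolding f_def by (rule xor_idx[OF that(2) x2])
        also have "xor (xor s (h z)) (xor e (h x2)) = xor (xor s e) (h (xor z x2))"
          using D(3)[OF that(2) x2] by (simp add: xor.assoc xor.left_commute)
        finally show ?thesis by (simp add: k_def x2_def xor.assoc)
      qed
      \<comment> \<open>The character of \<open>ht u\<close> arises twice, from the hash in the
        first register and from the phase label of the second, and cancels.\<close>
      have fchi: "chi (r + q) (u * 2 ^ q + xor w (ht u)) (xor (f s z) (f s' z')) = chi r u (xor s s') * chi q w (xor z z')"
        if "u < 2 ^ r" "s < 2 ^ r" "z < 2 ^ q" "s' < 2 ^ r" "z' < 2 ^ q" for u s z s' z'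
      proof -
        have "xor (f s z) (f s' z') = xor (xor s s') (h (xor z z')) * 2 ^ q + xor z z'"
          unfolding f_def xor_idx[OF that(3) that(5)] D(3)[OF that(3) that(5)] by (simp add: xor.assoc xor.left_commute)
        then have "chi (r + q) (u * 2 ^ q + xor w (ht u)) (xor (f s z) (f s' z')) =
          chi r u (xor (xor s s') (h (xor z z'))) * chi q (xor w (ht u)) (xor z z')"
          using chi_idx[OF xor_less[OF xw(2) D(2)[OF that(1)]] xor_less[OF that(3) that(5)]] by simp
        also have "\<dots> = chi r u (xor s s') * chi q w (xor z z') * (chi q (ht u) (xor z z') * chi q (ht u) (xor z z'))"
          using D(4)[OF that(1) xor_less[OF that(3) that(5)]] by (simp only: chi_xor[of r] chi_xor_left) (simp only: ac_simps)
        finally show ?thesis by simp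
      qed
      have "(\<Sum>u<2 ^ r. bell (r + q) \<omega> ?X (u * 2 ^ q + xor w (ht u))) =
        (\<Sum>u<2 ^ r. 1 / 2 ^ (r + q) * (\<Sum>s<2 ^ r. \<Sum>z<2 ^ q. \<Sum>s'<2 ^ r. \<Sum>z'<2 ^ q. chi r u (xor s s') * chi q w (xor z z') * W s z s' z' e))"
        unfolding bell_def fsum by (intro sum.cong arg_cong[of _ _ "\<lambda>c. _ * c"] refl) (simp add: fchi fx W_def)
      also have "\<dots> = 1 / 2 ^ (r + q) * (\<Sum>s<2 ^ r. \<Sum>z<2 ^ q. \<Sum>s'<2 ^ r. \<Sum>z'<2 ^ q. \<Sum>u<2 ^ r. chi r u (xor s s') * chi q w (xor z z') * W s z s' z' e)"
        unfolding sum_distrib_left[symmetric]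
        by (intro arg_cong[of _ _ "\<lambda>c. 1 / 2 ^ (r + q) * c"]) (rule trans[OF sum_rotate sum.cong[OF refl sum.cong[OF refl sum_rotate]]])
      also have "(\<Sum>s<2 ^ r. \<Sum>z<2 ^ q. \<Sum>s'<2 ^ r. \<Sum>z'<2 ^ q. \<Sum>u<2 ^ r. chi r u (xor s s') * chi q w (xor z z') * W s z s' z' e) =
        (\<Sum>s<2 ^ r. \<Sum>z<2 ^ q. \<Sum>s'<2 ^ r. if s' = s then \<Sum>z'<2 ^ q. 2 ^ r * (chi q w (xor z z') * W s z s z' e) else 0)"
      proof (intro sum.cong refl, goal_cases)
        case (1 s z s')
        then have c: "(\<Sum>u<2 ^ r. chi r u (xor s s')) = (if s = s' then 2 ^ r else 0)" by (intro sum_chi_xor) auto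
        have "(\<Sum>u<2 ^ r. chi r u (xor s s') * chi q w (xor z z') * W s z s' z' e) =
          (\<Sum>u<2 ^ r. chi r u (xor s s')) * (chi q w (xor z z') * W s z s' z' e)" for z'
          by (simp add: sum_distrib_right mult.assoc)
        then show ?case unfolding c by simp
      qed
      also have "\<dots> = 2 ^ r * (\<Sum>s<2 ^ r. \<Sum>z<2 ^ q. \<Sum>z'<2 ^ q. chi q w (xor z z') * W s z s z' e)"
        by (simp add: sum_distrib_left)
      finally show ?thesis unfolding x2_def by (simp add: power_add)
    qed
    show ?thesis unfolding left using right by simp
  qed
  then show ?thesis using L(1) by blast
qed

section \<open>The Hadamard transform\<close>

definition hadamard :: "nat \<Rightarrow> nat \<Rightarrow> nat \<Rightarrow> complex" where
  "hadamard n y z = chi n y z / of_real (sqrt (2 ^ n))"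

lemma hadamard_unitary:
  assumes "z < 2 ^ n" "z' < 2 ^ n"
  shows "(\<Sum>y<2 ^ n. hadamard n y z * cnj (hadamard n y z')) = (if z = z' then 1 else 0)"
proof -
  have "(\<Sum>y<2 ^ n. hadamard n y z * cnj (hadamard n y z')) = (\<Sum>y<2 ^ n. chi n y (xor z z')) / 2 ^ n"
    unfolding sum_divide_distrib by (intro sum.cong refl) (simp add: hadamard_def chi_xor flip: of_real_mult)
  then show ?thesis using sum_chi_xor[OF assms] by simp
qed

definition hadamard_map :: "nat \<Rightarrow> complex mat \<Rightarrow> complex mat" where
  "hadamard_map n \<omega> = on_bob (2 ^ n) (2 ^ n) (2 ^ n) (kraus (2 ^ n) (2 ^ n) (hadamard n))
    (on_alice (2 ^ n) (2 ^ n) (2 ^ n) (kraus (2 ^ n) (2 ^ n) (hadamard n)) \<omega>)"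

lemma hadamard_map_carrier [simp]: "hadamard_map n \<omega> \<in> carrier_mat (2 ^ n * 2 ^ n) (2 ^ n * 2 ^ n)"
  by (simp add: hadamard_map_def)

lemma locc_map_hadamard: "locc_map (2 ^ n) (2 ^ n) (2 ^ n) (2 ^ n) (hadamard_map n)"
  unfolding hadamard_map_def[abs_def] by (intro locc_map_unitary hadamard_unitary)

lemma hadamard_map_conj:
  "hadamard_map n \<omega> = mat (2 ^ n * 2 ^ n) (2 ^ n * 2 ^ n) (\<lambda>(r, s). \<Sum>t<2 ^ n * 2 ^ n. \<Sum>t'<2 ^ n * 2 ^ n.
    (hadamard n (r div 2 ^ n) (t div 2 ^ n) * hadamard n (r mod 2 ^ n) (t mod 2 ^ n)) * \<omega> $$ (t, t') *
    cnj (hadamard n (s div 2 ^ n) (t' div 2 ^ n) * hadamard n (s mod 2 ^ n) (t' mod 2 ^ n)))"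
proof (rule bipartite_eqI)
  fix y b y' b' :: nat assume *: "y < 2 ^ n" "b < 2 ^ n" "y' < 2 ^ n" "b' < 2 ^ n"
  let ?f = "\<lambda>z a z' a'. hadamard n y z * hadamard n b a * \<omega> $$ (z * 2 ^ n + a, z' * 2 ^ n + a') * cnj (hadamard n y' z' * hadamard n b' a')"
  have "hadamard_map n \<omega> $$ (y * 2 ^ n + b, y' * 2 ^ n + b') = (\<Sum>a<2 ^ n. \<Sum>a'<2 ^ n. \<Sum>z<2 ^ n. \<Sum>z'<2 ^ n. ?f z a z' a')"
    unfolding hadamard_map_def on_bob_kraus[OF *] sum_distrib_left sum_distrib_right using *
    by (intro sum.cong refl) (simp add: on_alice_kraus sum_distrib_left sum_distrib_right mult.assoc mult.commute mult.left_commute del: on_alice_index)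
  also have "\<dots> = (\<Sum>a<2 ^ n. \<Sum>z<2 ^ n. \<Sum>z'<2 ^ n. \<Sum>a'<2 ^ n. ?f z a z' a')"
    by (intro sum.cong refl sum_rotate)
  also have "\<dots> = (\<Sum>z<2 ^ n. \<Sum>z'<2 ^ n. \<Sum>a<2 ^ n. \<Sum>a'<2 ^ n. ?f z a z' a')"
    by (rule sum_rotate)
  also have "\<dots> = (\<Sum>z<2 ^ n. \<Sum>a<2 ^ n. \<Sum>z'<2 ^ n. \<Sum>a'<2 ^ n. ?f z a z' a')"
    by (intro sum.cong refl sum.swap)
  finally show "hadamard_map n \<omega> $$ (y * 2 ^ n + b, y' * 2 ^ n + b') = mat (2 ^ n * 2 ^ n) (2 ^ n * 2 ^ n) (\<lambda>(r, s). \<Sum>t<2 ^ n * 2 ^ n. \<Sum>t'<2 ^ n * 2 ^ n.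
    (hadamard n (r div 2 ^ n) (t div 2 ^ n) * hadamard n (r mod 2 ^ n) (t mod 2 ^ n)) * \<omega> $$ (t, t') *
    cnj (hadamard n (s div 2 ^ n) (t' div 2 ^ n) * hadamard n (s mod 2 ^ n) (t' mod 2 ^ n))) $$ (y * 2 ^ n + b, y' * 2 ^ n + b')"
    using * by (simp add: sum_idx)
qed simp_all

lemma sesq_cong:
  "(\<And>i. i < n \<Longrightarrow> x i = x' i) \<Longrightarrow> (\<And>i. i < n \<Longrightarrow> y i = y' i) \<Longrightarrow> sesq n A x y = sesq n A x' y'"
  unfolding sesq_def by (intro sum.cong) auto

text \<open>The Bell vector with labels \<open>x\<close>, \<open>w\<close> is mapped to the one with
  labels \<open>w\<close>, \<open>x\<close> up to the sign \<open>chi n x w\<close>, which cancels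
  because the weight is quadratic.\<close>

lemma bell_hadamard:
  assumes "x < 2 ^ n" "w < 2 ^ n"
  shows "bell n (hadamard_map n \<omega>) x w = bell n \<omega> w x"
proof -
  let ?v = "\<lambda>x w r. if r mod 2 ^ n = xor (r div 2 ^ n) x then chi n w (r div 2 ^ n) else 0"
  have w: "(\<Sum>i<2 ^ n * 2 ^ n. cnj (hadamard n (i div 2 ^ n) (t div 2 ^ n) * hadamard n (i mod 2 ^ n) (t mod 2 ^ n)) * ?v x w i) =
    chi n x w * ?v w x t" if t: "t < 2 ^ n * 2 ^ n" for t
  proof -
    obtain z a where za: "z < 2 ^ n" "a < 2 ^ n" "t = z * 2 ^ n + a" using idx_exhaust[OF t] .
    have "(\<Sum>i<2 ^ n * 2 ^ n. cnj (hadamard n (i div 2 ^ n) (t div 2 ^ n) * hadamard n (i mod 2 ^ n) (t mod 2 ^ n)) * ?v x w i) =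
      (\<Sum>y<2 ^ n. \<Sum>b<2 ^ n. if b = xor y x then hadamard n y z * hadamard n b a * chi n w y else 0)"
      unfolding sum_idx using za by (intro sum.cong refl) (simp add: hadamard_def)
    also have "\<dots> = (\<Sum>y<2 ^ n. hadamard n y z * hadamard n (xor y x) a * chi n w y)"
      using assms by (intro sum.cong refl) (simp add: xor_less)
    also have "\<dots> = (\<Sum>y<2 ^ n. chi n x a * chi n y (xor (xor w z) a) / 2 ^ n)"
    proof (rule sum.cong[OF refl])
      fix y
      have "complex_of_real (sqrt (2 ^ n)) * complex_of_real (sqrt (2 ^ n)) = 2 ^ n" by (simp flip: of_real_mult)
      then show "hadamard n y z * hadamard n (xor y x) a * chi n w y = chi n x a * chi n y (xor (xor w z) a) / 2 ^ n"
        unfolding hadamard_def chi_xor chi_xor_left chi_commute[of n w y] by simp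
    qed
    also have "\<dots> = chi n x a * (\<Sum>y<2 ^ n. chi n y (xor (xor w z) a)) / 2 ^ n"
      by (simp add: sum_distrib_left sum_divide_distrib)
    also have "(\<Sum>y<2 ^ n. chi n y (xor (xor w z) a)) = (if xor w z = a then 2 ^ n else 0)"
      by (rule sum_chi_xor) (use za assms in \<open>auto simp: xor_less\<close>)
    finally show ?thesis using za by (auto simp: xor.commute[of w] chi_xor)
  qed
  have "bell n (hadamard_map n \<omega>) x w = 1 / 2 ^ n * sesq (2 ^ n * 2 ^ n) \<omega> (\<lambda>t. chi n x w * ?v w x t) (\<lambda>t. chi n x w * ?v w x t)"
    unfolding bell_sesq[OF assms(1)] hadamard_map_conj sesq_conj
    by (intro arg_cong[of _ _ "\<lambda>c. 1 / 2 ^ n * c"] sesq_cong w)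
  also have "\<dots> = 1 / 2 ^ n * sesq (2 ^ n * 2 ^ n) \<omega> (?v w x) (?v w x)"
    using sesq_linear[of "2 ^ n * 2 ^ n" \<omega> "chi n x w" "?v w x" 0 "\<lambda>_. 0" "chi n x w" "?v w x" 0 "\<lambda>_. 0"] by simp
  also have "\<dots> = bell n \<omega> w x" unfolding bell_sesq[OF assms(2)] ..
  finally show ?thesis .
qed

section \<open>Distillation of states with few errors\<close>

lemma sum_subset_image_le:
  fixes f :: "nat \<Rightarrow> nat \<Rightarrow> real"
  assumes "finite A" "finite B" "S \<subseteq> A" "T \<subseteq> B" "\<And>x y. x \<in> A \<Longrightarrow> y \<in> B \<Longrightarrow> 0 \<le> f x y"
  shows "(\<Sum>x\<in>S. \<Sum>y\<in>T. f x y) \<le> (\<Sum>x\<in>A. \<Sum>y\<in>B. f x y)"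
proof -
  have "(\<Sum>x\<in>S. \<Sum>y\<in>T. f x y) \<le> (\<Sum>x\<in>S. \<Sum>y\<in>B. f x y)"
    using assms by (intro sum_mono sum_mono2) auto
  also have "\<dots> \<le> (\<Sum>x\<in>A. \<Sum>y\<in>B. f x y)"
    using assms by (intro sum_mono2 sum_nonneg) auto
  finally show ?thesis .
qed

text \<open>
  One hashing step removes the bit errors and the Hadamard transform exchanges bit and phase
  errors, so a second hashing step removes the transported phase errors.
\<close>

lemma distill:
  assumes S: "S \<subseteq> {..<2 ^ (r1 + (r2 + m))}" and c1: "(card S)\<^sup>2 < 2 ^ r1" and c2: "(card S)\<^sup>2 < 2 ^ r2"
  shows "\<exists>\<Lambda>. locc (2 ^ m) (2 ^ m) (2 ^ (r1 + (r2 + m))) (2 ^ (r1 + (r2 + m))) \<Lambda> \<and>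
    (\<forall>\<omega>. psd (2 ^ (r1 + (r2 + m)) * 2 ^ (r1 + (r2 + m))) \<omega> \<longrightarrow>
      (\<Sum>x\<in>S. \<Sum>w\<in>S. Re (bell (r1 + (r2 + m)) \<omega> x w)) \<le> Re (bell m (\<Lambda> \<omega>) 0 0))"
proof -
  let ?q = "r2 + m" and ?n = "r1 + (r2 + m)"
  obtain h1 ht1 g1 where "linear_hash r1 ?q h1 ht1 \<and> (\<forall>e. g1 e < 2 ^ ?q) \<and>
      (\<forall>x\<in>S. g1 (xor (x div 2 ^ ?q) (h1 (x mod 2 ^ ?q))) = x mod 2 ^ ?q)"
    using decoder_exists[OF S c1] by (elim exE) (rule that)
  then have H1: "linear_hash r1 ?q h1 ht1" and g1: "\<And>e. g1 e < 2 ^ ?q"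
    and d1: "\<And>x. x \<in> S \<Longrightarrow> g1 (xor (x div 2 ^ ?q) (h1 (x mod 2 ^ ?q))) = x mod 2 ^ ?q"
    by simp_all
  note D1 = linear_hashD[OF H1]
  have div1: "x div 2 ^ ?q < 2 ^ r1" if "x \<in> S" for x
    using S that by (auto simp: power_add[of 2 r1] less_mult_imp_div_less)
  \<comment> \<open>A phase pattern \<open>w\<close> of the input becomes \<open>push w\<close>
    after the first step. The image of \<open>S\<close> is no larger than \<open>S\<close>, so the
    second step can be built for it with the same cardinality bound.\<close>
  define push where "push w = xor (w mod 2 ^ ?q) (ht1 (w div 2 ^ ?q))" for w
  define S2 where "S2 = push ` S"
  have fS: "finite S" using S finite_subset by blast
  have S2: "S2 \<subseteq> {..<2 ^ (r2 + m)}" using div1 by (auto simp: S2_def push_def intro!: xor_less D1)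
  have "(card S2)\<^sup>2 \<le> (card S)\<^sup>2" unfolding S2_def by (intro power_mono card_image_le fS) simp
  with c2 have c2': "(card S2)\<^sup>2 < 2 ^ r2" by (rule le_less_trans[rotated])
  obtain h2 ht2 g2 where "linear_hash r2 m h2 ht2 \<and> (\<forall>e. g2 e < 2 ^ m) \<and>
      (\<forall>x\<in>S2. g2 (xor (x div 2 ^ m) (h2 (x mod 2 ^ m))) = x mod 2 ^ m)"
    using decoder_exists[OF S2 c2'] by (elim exE) (rule that)
  then have H2: "linear_hash r2 m h2 ht2" and g2: "\<And>e. g2 e < 2 ^ m"
    and d2: "\<And>x. x \<in> S2 \<Longrightarrow> g2 (xor (x div 2 ^ m) (h2 (x mod 2 ^ m))) = x mod 2 ^ m"
    by simp_all
  note D2 = linear_hashD[OF H2]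
  obtain L1 where L1': "locc (2 ^ ?q) (2 ^ ?q) (2 ^ ?n) (2 ^ ?n) L1 \<and>
    (\<forall>\<omega>\<in>carrier_mat (2 ^ ?n * 2 ^ ?n) (2 ^ ?n * 2 ^ ?n). \<forall>x<2 ^ ?q. \<forall>w<2 ^ ?q.
      bell ?q (L1 \<omega>) x w = (\<Sum>e<2 ^ r1. \<Sum>u<2 ^ r1. bell ?n \<omega> (xor e (h1 (xor x (g1 e))) * 2 ^ ?q + xor x (g1 e)) (u * 2 ^ ?q + xor w (ht1 u))))"
    using hash_step[where g = g1, OF H1 g1] by (elim exE) (rule that)
  note L1 = L1'[THEN conjunct1] and B1 = L1'[THEN conjunct2, rule_format]
  obtain L2 where L2': "locc (2 ^ m) (2 ^ m) (2 ^ ?q) (2 ^ ?q) L2 \<and>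
    (\<forall>\<omega>\<in>carrier_mat (2 ^ ?q * 2 ^ ?q) (2 ^ ?q * 2 ^ ?q). \<forall>x<2 ^ m. \<forall>w<2 ^ m.
      bell m (L2 \<omega>) x w = (\<Sum>e<2 ^ r2. \<Sum>u<2 ^ r2. bell ?q \<omega> (xor e (h2 (xor x (g2 e))) * 2 ^ m + xor x (g2 e)) (u * 2 ^ m + xor w (ht2 u))))"
    using hash_step[where g = g2, OF H2 g2] by (elim exE) (rule that)
  note L2 = L2'[THEN conjunct1] and B2 = L2'[THEN conjunct2, rule_format]
  have "locc_map (2 ^ m) (2 ^ m) (2 ^ ?n) (2 ^ ?n) (\<lambda>\<omega>. L2 (hadamard_map ?q (L1 \<omega>)))"
    by (rule locc_map_comp[OF locc_map_comp[OF locc_map_locc[OF L1] locc_map_hadamard] locc_map_locc[OF L2]])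
  then obtain L where L: "locc (2 ^ m) (2 ^ m) (2 ^ ?n) (2 ^ ?n) L"
    "\<And>\<omega>. \<omega> \<in> carrier_mat (2 ^ ?n * 2 ^ ?n) (2 ^ ?n * 2 ^ ?n) \<Longrightarrow> L \<omega> = L2 (hadamard_map ?q (L1 \<omega>))"
    unfolding locc_map_def by blast
  have "(\<Sum>x\<in>S. \<Sum>w\<in>S. Re (bell ?n \<omega> x w)) \<le> Re (bell m (L \<omega>) 0 0)" if w: "psd (2 ^ ?n * 2 ^ ?n) \<omega>" for \<omega>
  proof -
    note wc = psd_carrier[OF w]
    define X1 where "X1 e = xor e (h1 (g1 e)) * 2 ^ ?q + g1 e" for e
    define X2 where "X2 e = xor e (h2 (g2 e)) * 2 ^ m + g2 e" for e
    define W2 where "W2 e u = u * 2 ^ ?q + xor (X2 e) (ht1 u)" for e u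
    have X1l: "X1 e < 2 ^ ?n" if "e < 2 ^ r1" for e
      unfolding X1_def power_add[of 2 r1] using that D1(1)[OF g1] g1 by (intro idx_less xor_less) auto
    have X2l: "X2 e < 2 ^ ?q" if "e < 2 ^ r2" for e
      unfolding X2_def power_add[of 2 r2] using that D2(1)[OF g2] g2 by (intro idx_less xor_less) auto
    have W2l: "xor (X2 e) (ht1 u) < 2 ^ ?q" "W2 e u < 2 ^ ?n" if "e < 2 ^ r2" "u < 2 ^ r1" for e u
      unfolding W2_def power_add[of 2 r1] using that X2l D1(2) by (auto intro!: idx_less xor_less)
    have X1inj: "e = xor (X1 e div 2 ^ ?q) (h1 (X1 e mod 2 ^ ?q))" for e
      using g1[of e] by (simp add: X1_def xor.assoc)
    have X2inj: "e = xor (X2 e div 2 ^ m) (h2 (X2 e mod 2 ^ m))" for e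
      using g2[of e] by (simp add: X2_def xor.assoc)
    \<comment> \<open>The term \<open>u = 0\<close> then stands for bit error zero after the first
      step; it is the only one kept in the lower bound.\<close>
    have ht20: "ht2 0 = 0"
    proof -
      have "chi m (ht2 0) z = 1" if "z < 2 ^ m" for z using D2(4)[of 0 z] that by simp
      then have "(\<Sum>z<2 ^ m. chi m z (ht2 0)) = 2 ^ m" by (simp add: chi_commute[of m _ "ht2 0"])
      then show ?thesis using sum_chi[OF D2(2)[of 0]] by (auto split: if_splits)
    qed
    have b0: "0 \<le> Re (bell ?n \<omega> x w')" if "x < 2 ^ ?n" for x w'
      using bell_nonneg[OF w that] by (simp add: complex_nonneg_iff)
    have L1psd: "psd (2 ^ ?q * 2 ^ ?q) (L1 \<omega>)" by (rule locc_psd[OF L1 w])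
    have out: "bell m (L \<omega>) 0 0 = (\<Sum>e<2 ^ r2. \<Sum>u<2 ^ r2. bell ?q (L1 \<omega>) (u * 2 ^ m + ht2 u) (X2 e))"
    proof -
      have "bell m (L \<omega>) 0 0 = (\<Sum>e<2 ^ r2. \<Sum>u<2 ^ r2. bell ?q (hadamard_map ?q (L1 \<omega>)) (X2 e) (u * 2 ^ m + ht2 u))"
        unfolding L(2)[OF wc] using B2[OF hadamard_map_carrier, of 0 0] by (simp add: X2_def)
      also have "\<dots> = (\<Sum>e<2 ^ r2. \<Sum>u<2 ^ r2. bell ?q (L1 \<omega>) (u * 2 ^ m + ht2 u) (X2 e))"
        using X2l D2(2) by (intro sum.cong refl bell_hadamard) (auto simp: power_add[of 2 r2] intro!: idx_less)
      finally show ?thesis .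
    qed
    have "(\<Sum>e<2 ^ r2. Re (bell ?q (L1 \<omega>) 0 (X2 e))) \<le> Re (bell m (L \<omega>) 0 0)"
      unfolding out Re_sum
    proof (rule sum_mono)
      fix e :: nat
      have "Re (bell ?q (L1 \<omega>) (0 * 2 ^ m + ht2 0) (X2 e)) \<le> (\<Sum>u<2 ^ r2. Re (bell ?q (L1 \<omega>) (u * 2 ^ m + ht2 u) (X2 e)))"
      proof (rule member_le_sum[of "0::nat" "{..<2 ^ r2}" "\<lambda>u. Re (bell ?q (L1 \<omega>) (u * 2 ^ m + ht2 u) (X2 e))"])
        fix u :: nat assume "u \<in> {..<2 ^ r2} - {0}"
        then have "u * 2 ^ m + ht2 u < 2 ^ ?q" unfolding power_add[of 2 r2] using D2(2) by (intro idx_less) auto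
        then show "0 \<le> Re (bell ?q (L1 \<omega>) (u * 2 ^ m + ht2 u) (X2 e))"
          using bell_nonneg[OF L1psd] by (simp add: complex_nonneg_iff)
      qed auto
      then show "Re (bell ?q (L1 \<omega>) 0 (X2 e)) \<le> (\<Sum>u<2 ^ r2. Re (bell ?q (L1 \<omega>) (u * 2 ^ m + ht2 u) (X2 e)))"
        by (simp add: ht20)
    qed
    \<comment> \<open>Injectivity of \<open>X1\<close> and of \<open>W2\<close> turns the nested
      sums over syndromes and phase labels into sums over two sets of input patterns; both sets
      contain \<open>S\<close>.\<close>
    moreover have "(\<Sum>e<2 ^ r2. Re (bell ?q (L1 \<omega>) 0 (X2 e))) = (\<Sum>x\<in>X1 ` {..<2 ^ r1}. \<Sum>w\<in>(\<lambda>(e, u). W2 e u) ` ({..<2 ^ r2} \<times> {..<2 ^ r1}). Re (bell ?n \<omega> x w))"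
    proof -
      have i1: "inj_on X1 {..<2 ^ r1}" using X1inj by (metis inj_onI)
      have i2: "inj_on (\<lambda>(e, u). W2 e u) ({..<2 ^ r2} \<times> {..<2 ^ r1})"
      proof (rule inj_onI, clarify)
        fix e u e' u' :: nat assume a: "e < 2 ^ r2" "u < 2 ^ r1" "e' < 2 ^ r2" "u' < 2 ^ r1" "W2 e u = W2 e' u'"
        then have "u = u'" "xor (X2 e) (ht1 u) = xor (X2 e') (ht1 u')"
          using W2l(1)[OF a(1,2)] W2l(1)[OF a(3,4)] unfolding W2_def by (metis idx_div, metis idx_mod)
        then have "X2 e = X2 e'" by (metis xor_cancel(2))
        then show "e = e' \<and> u = u'" using \<open>u = u'\<close> X2inj by metis
      qed
      have "(\<Sum>e<2 ^ r2. Re (bell ?q (L1 \<omega>) 0 (X2 e))) = (\<Sum>e<2 ^ r2. \<Sum>e1<2 ^ r1. \<Sum>u<2 ^ r1. Re (bell ?n \<omega> (X1 e1) (W2 e u)))"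
        using B1[OF wc, of 0] X2l by (simp add: X1_def W2_def)
      also have "\<dots> = (\<Sum>e1<2 ^ r1. \<Sum>e<2 ^ r2. \<Sum>u<2 ^ r1. Re (bell ?n \<omega> (X1 e1) (W2 e u)))"
        by (rule sum.swap)
      also have "\<dots> = (\<Sum>e1<2 ^ r1. \<Sum>w\<in>(\<lambda>(e, u). W2 e u) ` ({..<2 ^ r2} \<times> {..<2 ^ r1}). Re (bell ?n \<omega> (X1 e1) w))"
        unfolding sum.reindex[OF i2] by (simp add: sum.cartesian_product case_prod_unfold)
      also have "\<dots> = (\<Sum>x\<in>X1 ` {..<2 ^ r1}. \<Sum>w\<in>(\<lambda>(e, u). W2 e u) ` ({..<2 ^ r2} \<times> {..<2 ^ r1}). Re (bell ?n \<omega> x w))"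
        unfolding sum.reindex[OF i1] by simp
      finally show ?thesis .
    qed
    moreover have "(\<Sum>x\<in>S. \<Sum>w\<in>S. Re (bell ?n \<omega> x w)) \<le> (\<Sum>x\<in>X1 ` {..<2 ^ r1}. \<Sum>w\<in>(\<lambda>(e, u). W2 e u) ` ({..<2 ^ r2} \<times> {..<2 ^ r1}). Re (bell ?n \<omega> x w))"
    proof (rule sum_subset_image_le)
      show "S \<subseteq> X1 ` {..<2 ^ r1}"
      proof
        fix x assume x: "x \<in> S"
        let ?e = "xor (x div 2 ^ ?q) (h1 (x mod 2 ^ ?q))"
        have "X1 ?e = x" unfolding X1_def d1[OF x] by (simp only: xor_cancel div_mult_mod_eq)
        moreover have "?e < 2 ^ r1" using div1[OF x] D1(1) by (intro xor_less) auto
        ultimately show "x \<in> X1 ` {..<2 ^ r1}" by force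
      qed
      show "S \<subseteq> (\<lambda>(e, u). W2 e u) ` ({..<2 ^ r2} \<times> {..<2 ^ r1})"
      proof
        fix x assume x: "x \<in> S"
        let ?y = "push x"
        let ?e = "xor (?y div 2 ^ m) (h2 (?y mod 2 ^ m))"
        have y: "?y \<in> S2" using x by (simp add: S2_def)
        then have "?y < 2 ^ r2 * 2 ^ m" using S2 by (auto simp: power_add)
        then have "?y div 2 ^ m < 2 ^ r2" by (rule less_mult_imp_div_less)
        then have "?e < 2 ^ r2" using D2(1) by (intro xor_less) auto
        moreover have "X2 ?e = ?y" unfolding X2_def d2[OF y] by (simp only: xor_cancel div_mult_mod_eq)
        then have "W2 ?e (x div 2 ^ ?q) = x" unfolding W2_def push_def using div_mult_mod_eq[of x "2 ^ ?q"] by simp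
        ultimately show "x \<in> (\<lambda>(e, u). W2 e u) ` ({..<2 ^ r2} \<times> {..<2 ^ r1})" using div1[OF x] by force
      qed
    qed (use X1l b0 in auto)
    ultimately show ?thesis by linarith
  qed
  then show ?thesis using L(1) by blast
qed

section \<open>Independent blocks\<close>

abbreviation rbell :: "nat \<Rightarrow> complex mat \<Rightarrow> nat \<Rightarrow> nat \<Rightarrow> real" where
  "rbell n \<omega> x w \<equiv> Re (bell n \<omega> x w)"

lemma rbell_nonneg: "psd (2 ^ n * 2 ^ n) \<omega> \<Longrightarrow> x < 2 ^ n \<Longrightarrow> 0 \<le> rbell n \<omega> x w"
  using bell_nonneg by (simp add: complex_nonneg_iff)

lemma rbell_sum:
  "psd (2 ^ n * 2 ^ n) \<omega> \<Longrightarrow> mat_trace \<omega> = 1 \<Longrightarrow> (\<Sum>x<2 ^ n. \<Sum>w<2 ^ n. rbell n \<omega> x w) = 1"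
  using arg_cong[OF bell_sum[OF psd_carrier], of n \<omega> Re] by simp

lemma rbell_tensor:
  assumes "psd (2 ^ k * 2 ^ k) \<tau>" "psd (2 ^ n * 2 ^ n) \<omega>" "x1 < 2 ^ k" "x2 < 2 ^ n" "w1 < 2 ^ k" "w2 < 2 ^ n"
  shows "rbell (k + n) (tensor (2 ^ k) (2 ^ k) (2 ^ n) (2 ^ n) \<tau> \<omega>) (x1 * 2 ^ n + x2) (w1 * 2 ^ n + w2) =
    rbell k \<tau> x1 w1 * rbell n \<omega> x2 w2"
  unfolding bell_tensor[OF assms(3-6)]
  using bell_nonneg[OF assms(1,3), of w1] bell_nonneg[OF assms(2,4), of w2] by (simp add: complex_nonneg_iff)

text \<open>The law of \<open>N\<close> independent digits of \<open>x\<close> in base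
  \<open>2 ^ k\<close>, one digit for each block of \<open>k\<close> qubit pairs.\<close>

primrec blockprod :: "nat \<Rightarrow> (nat \<Rightarrow> real) \<Rightarrow> nat \<Rightarrow> nat \<Rightarrow> real" where
  "blockprod k p 0 x = 1"
| "blockprod k p (Suc N) x = p (x div 2 ^ (k * N)) * blockprod k p N (x mod 2 ^ (k * N))"

lemma sum_blockprod: "(\<Sum>x<2 ^ (k * N). blockprod k p N x) = (\<Sum>y<2 ^ k. p y) ^ N"
proof (induction N)
  case (Suc N)
  have "(\<Sum>x<2 ^ (k * Suc N). blockprod k p (Suc N) x) = (\<Sum>x1<2 ^ k. \<Sum>x2<2 ^ (k * N). p x1 * blockprod k p N x2)"
    unfolding mult_Suc_right power_add sum_idx by (intro sum.cong refl) simp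
  then show ?case using Suc by (simp add: sum_product[symmetric])
qed simp

lemma blockprod_mult: "blockprod k (\<lambda>y. p y * q y) N x = blockprod k p N x * blockprod k q N x"
  by (induction N arbitrary: x) auto

lemma blockprod_nonneg:
  "(\<And>y. y < 2 ^ k \<Longrightarrow> 0 \<le> p y) \<Longrightarrow> x < 2 ^ (k * N) \<Longrightarrow> 0 \<le> blockprod k p N x"
proof (induction N arbitrary: x)
  case (Suc N)
  then have "x div 2 ^ (k * N) < 2 ^ k" by (simp add: power_add less_mult_imp_div_less)
  then show ?case using Suc by simp
qed simp

primrec bad_blocks :: "nat \<Rightarrow> nat \<Rightarrow> nat \<Rightarrow> nat" where
  "bad_blocks k 0 x = 0"
| "bad_blocks k (Suc N) x = (if x div 2 ^ (k * N) = 0 then 0 else 1) + bad_blocks k N (x mod 2 ^ (k * N))"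

lemma power_bad_blocks: "c ^ bad_blocks k N x = blockprod k (\<lambda>y. if y = 0 then 1 else c) N x"
  by (induction N arbitrary: x) auto

text \<open>Here \<open>c ^ bad_blocks\<close> is itself a product over blocks. The tail and
  counting bounds below are Markov estimates from this identity with \<open>c = 1 / e\<close>,
  \<open>c = 1 / 2\<close> and \<open>c = 1 / 2 ^ k\<close>.\<close>

lemma generating_function:
  "(\<Sum>x<2 ^ (k * N). blockprod k p N x * c ^ bad_blocks k N x) = (p 0 + c * (\<Sum>y\<in>{0<..<2 ^ k}. p y)) ^ N"
proof -
  have "{..<2 ^ k} = insert 0 {0<..<2 ^ k :: nat}" by auto
  then have "(\<Sum>y<2 ^ k. p y * (if y = 0 then 1 else c)) = p 0 + c * (\<Sum>y\<in>{0<..<2 ^ k}. p y)"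
    by (simp add: sum_distrib_left mult.commute)
  then show ?thesis unfolding power_bad_blocks blockprod_mult[symmetric] sum_blockprod by simp
qed

context
  fixes k :: nat and p :: "nat \<Rightarrow> real"
  assumes p0: "\<And>y. y < 2 ^ k \<Longrightarrow> 0 \<le> p y" and p1: "(\<Sum>y<2 ^ k. p y) = 1"
begin

lemma sum_nonzero_blocks: "(\<Sum>y\<in>{0<..<2 ^ k}. p y) = 1 - p 0"
proof -
  have "{..<2 ^ k} = insert 0 {0<..<2 ^ k :: nat}" by auto
  then show ?thesis using p1 by simp
qed

text \<open>On the patterns summed, \<open>(1 / e) ^ bad_blocks\<close> times \<open>e ^ s\<close>
  is at least \<open>1\<close>, and the factor per block, \<open>p 0 + (1 - p 0) / e\<close>, is at
  most \<open>2\<close>. The crude \<open>2 ^ N\<close> is affordable because \<open>e\<close> can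
  be prescribed as small as desired.\<close>

lemma many_bad_blocks:
  assumes e: "1 - p 0 \<le> e" and "0 < e" "e \<le> 1"
  shows "(\<Sum>x\<in>{x. x < 2 ^ (k * N) \<and> s \<le> bad_blocks k N x}. blockprod k p N x) \<le> e ^ s * 2 ^ N"
proof -
  have "(\<Sum>x\<in>{x. x < 2 ^ (k * N) \<and> s \<le> bad_blocks k N x}. blockprod k p N x) \<le>
    (\<Sum>x\<in>{x. x < 2 ^ (k * N) \<and> s \<le> bad_blocks k N x}. blockprod k p N x * (1 / e) ^ bad_blocks k N x * e ^ s)"
  proof (rule sum_mono)
    fix x assume x: "x \<in> {x. x < 2 ^ (k * N) \<and> s \<le> bad_blocks k N x}"
    have "1 = (1 / e) ^ s * e ^ s" using assms by (simp add: power_divide)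
    also have "\<dots> \<le> (1 / e) ^ bad_blocks k N x * e ^ s"
      using x assms by (intro mult_right_mono power_increasing) auto
    finally have "blockprod k p N x * 1 \<le> blockprod k p N x * ((1 / e) ^ bad_blocks k N x * e ^ s)"
      using x blockprod_nonneg[OF p0] by (intro mult_left_mono) auto
    then show "blockprod k p N x \<le> blockprod k p N x * (1 / e) ^ bad_blocks k N x * e ^ s" by (simp add: mult.assoc)
  qed
  also have "\<dots> \<le> (\<Sum>x<2 ^ (k * N). blockprod k p N x * (1 / e) ^ bad_blocks k N x * e ^ s)"
    using assms by (intro sum_mono2) (auto intro!: mult_nonneg_nonneg blockprod_nonneg[OF p0])
  also have "\<dots> = e ^ s * (p 0 + 1 / e * (1 - p 0)) ^ N"
    unfolding sum_distrib_right[symmetric] generating_function sum_nonzero_blocks by simp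
  also have "\<dots> \<le> e ^ s * 2 ^ N"
  proof (intro mult_left_mono power_mono)
    have "p 0 \<le> 1" using sum_nonneg[of "{0<..<2 ^ k}" p] p0 sum_nonzero_blocks by force
    moreover have "1 / e * (1 - p 0) \<le> 1" using e assms by (simp add: field_simps)
    ultimately show "p 0 + 1 / e * (1 - p 0) \<le> 2" by simp
    show "0 \<le> p 0 + 1 / e * (1 - p 0)" using \<open>p 0 \<le> 1\<close> p0[of 0] assms by simp
  qed (use assms in simp)
  finally show ?thesis .
qed

text \<open>The opposite tail, for the probability of wrongly accepting a noisy state. The factor
  per block is \<open>p 0 + (1 - p 0) / 2\<close>, at most \<open>1 - e / 2\<close>.\<close>

lemma few_bad_blocks:
  assumes e: "e \<le> 1 - p 0" and "0 \<le> e"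
  shows "(\<Sum>x\<in>{x. x < 2 ^ (k * N) \<and> bad_blocks k N x \<le> s}. blockprod k p N x) \<le> 2 ^ s * (1 - e / 2) ^ N"
proof -
  have "(\<Sum>x\<in>{x. x < 2 ^ (k * N) \<and> bad_blocks k N x \<le> s}. blockprod k p N x) \<le>
    (\<Sum>x\<in>{x. x < 2 ^ (k * N) \<and> bad_blocks k N x \<le> s}. blockprod k p N x * (1 / 2) ^ bad_blocks k N x * 2 ^ s)"
  proof (rule sum_mono)
    fix x assume x: "x \<in> {x. x < 2 ^ (k * N) \<and> bad_blocks k N x \<le> s}"
    have "1 = (1 / 2 :: real) ^ s * 2 ^ s" by (simp add: power_divide)
    also have "\<dots> \<le> (1 / 2 :: real) ^ bad_blocks k N x * 2 ^ s"
      using x by (intro mult_right_mono power_decreasing) auto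
    finally have "blockprod k p N x * 1 \<le> blockprod k p N x * ((1 / 2) ^ bad_blocks k N x * 2 ^ s)"
      using x blockprod_nonneg[OF p0] by (intro mult_left_mono) auto
    then show "blockprod k p N x \<le> blockprod k p N x * (1 / 2) ^ bad_blocks k N x * 2 ^ s" by (simp add: mult.assoc)
  qed
  also have "\<dots> \<le> (\<Sum>x<2 ^ (k * N). blockprod k p N x * (1 / 2) ^ bad_blocks k N x * 2 ^ s)"
    by (intro sum_mono2) (auto intro!: mult_nonneg_nonneg blockprod_nonneg[OF p0])
  also have "\<dots> = 2 ^ s * (p 0 + 1 / 2 * (1 - p 0)) ^ N"
    unfolding sum_distrib_right[symmetric] generating_function sum_nonzero_blocks by simp
  also have "\<dots> \<le> 2 ^ s * (1 - e / 2) ^ N"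
    using e p0[of 0] sum_nonzero_blocks sum_nonneg[of "{0<..<2 ^ k}" p] p0
    by (intro mult_left_mono power_mono) (auto simp: field_simps)
  finally show ?thesis .
qed

end

text \<open>Counting is the case of constant weight \<open>1\<close>: a block has one good and fewer
  than \<open>2 ^ k\<close> bad values, so the factor per block is at most \<open>2\<close>.\<close>

lemma card_few_bad_blocks: "real (card {x. x < 2 ^ (k * N) \<and> bad_blocks k N x \<le> t}) \<le> 2 ^ N * 2 ^ (k * t)"
proof -
  let ?c = "1 / 2 ^ k :: real"
  have one: "blockprod k (\<lambda>y. 1) N x = 1" for x by (induction N arbitrary: x) auto
  have "real (card {x. x < 2 ^ (k * N) \<and> bad_blocks k N x \<le> t}) = (\<Sum>x\<in>{x. x < 2 ^ (k * N) \<and> bad_blocks k N x \<le> t}. 1)"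
    by simp
  also have "\<dots> \<le> (\<Sum>x\<in>{x. x < 2 ^ (k * N) \<and> bad_blocks k N x \<le> t}. blockprod k (\<lambda>y. 1) N x * ?c ^ bad_blocks k N x * 2 ^ (k * t))"
  proof (rule sum_mono)
    fix x assume x: "x \<in> {x. x < 2 ^ (k * N) \<and> bad_blocks k N x \<le> t}"
    have "1 = ?c ^ t * 2 ^ (k * t)" by (simp add: power_divide power_mult)
    also have "\<dots> \<le> ?c ^ bad_blocks k N x * 2 ^ (k * t)"
      using x by (intro mult_right_mono power_decreasing) auto
    finally show "1 \<le> blockprod k (\<lambda>y. 1) N x * ?c ^ bad_blocks k N x * 2 ^ (k * t)" by (simp add: one)
  qed
  also have "\<dots> \<le> (\<Sum>x<2 ^ (k * N). blockprod k (\<lambda>y. 1) N x * ?c ^ bad_blocks k N x * 2 ^ (k * t))"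
    by (intro sum_mono2) (auto simp: one)
  also have "\<dots> = (1 + ?c * real (card {0<..<2 ^ k :: nat})) ^ N * 2 ^ (k * t)"
    unfolding sum_distrib_right[symmetric] generating_function by simp
  also have "\<dots> \<le> 2 ^ N * 2 ^ (k * t)"
  proof (intro mult_right_mono power_mono)
    have "1 \<le> (2::real) ^ k" by simp
    then show "1 + 1 / 2 ^ k * real (card {0<..<2 ^ k :: nat}) \<le> 2" by (simp add: field_simps of_nat_diff)
  qed auto
  finally show ?thesis .
qed

section \<open>Marginal laws of bit and phase errors\<close>

definition bit_marginal :: "nat \<Rightarrow> complex mat \<Rightarrow> nat \<Rightarrow> real" where
  "bit_marginal n \<omega> x = (\<Sum>w<2 ^ n. rbell n \<omega> x w)"

definition phase_marginal :: "nat \<Rightarrow> complex mat \<Rightarrow> nat \<Rightarrow> real" where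
  "phase_marginal n \<omega> w = (\<Sum>x<2 ^ n. rbell n \<omega> x w)"

lemma marginal_nonneg:
  "psd (2 ^ n * 2 ^ n) \<omega> \<Longrightarrow> x < 2 ^ n \<Longrightarrow> 0 \<le> bit_marginal n \<omega> x"
  "psd (2 ^ n * 2 ^ n) \<omega> \<Longrightarrow> x < 2 ^ n \<Longrightarrow> 0 \<le> phase_marginal n \<omega> x"
  by (auto simp: bit_marginal_def phase_marginal_def intro!: sum_nonneg rbell_nonneg)

lemma marginal_sum:
  assumes "psd (2 ^ n * 2 ^ n) \<omega>" "mat_trace \<omega> = 1"
  shows "(\<Sum>x<2 ^ n. bit_marginal n \<omega> x) = 1" "(\<Sum>x<2 ^ n. phase_marginal n \<omega> x) = 1"
proof -
  show "(\<Sum>x<2 ^ n. bit_marginal n \<omega> x) = 1" unfolding bit_marginal_def by (rule rbell_sum[OF assms])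
  show "(\<Sum>x<2 ^ n. phase_marginal n \<omega> x) = 1"
    unfolding phase_marginal_def by (subst sum.swap) (rule rbell_sum[OF assms])
qed

text \<open>Bell weights of a tensor product multiply, so summing out one of the two labels leaves a
  product law.\<close>

lemma marginal_power:
  assumes t: "psd (2 ^ k * 2 ^ k) \<tau>" and x: "x < 2 ^ (k * N)"
  shows "bit_marginal (k * N) (bipartite_power (2 ^ k) \<tau> N) x = blockprod k (bit_marginal k \<tau>) N x"
    "phase_marginal (k * N) (bipartite_power (2 ^ k) \<tau> N) x = blockprod k (phase_marginal k \<tau>) N x"
proof -
  have b0: "bell 0 (1\<^sub>m 1) 0 0 = 1" by (simp add: bell_def)
  have "x < 2 ^ (k * N) \<longrightarrow> bit_marginal (k * N) (bipartite_power (2 ^ k) \<tau> N) x = blockprod k (bit_marginal k \<tau>) N x \<and>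
    phase_marginal (k * N) (bipartite_power (2 ^ k) \<tau> N) x = blockprod k (phase_marginal k \<tau>) N x" for x
  proof (induction N arbitrary: x)
    case 0
    then show ?case using b0 by (simp add: bit_marginal_def phase_marginal_def)
  next
    case (Suc N)
    show ?case
    proof
      assume "x < 2 ^ (k * Suc N)"
      then have "x < 2 ^ k * 2 ^ (k * N)" by (simp add: power_add)
      then obtain x1 x2 where xs: "x1 < 2 ^ k" "x2 < 2 ^ (k * N)" "x = x1 * 2 ^ (k * N) + x2" by (rule idx_exhaust)
      let ?w = "bipartite_power (2 ^ k) \<tau> N"
      have P: "bipartite_power (2 ^ k) \<tau> (Suc N) = tensor (2 ^ k) (2 ^ k) (2 ^ (k * N)) (2 ^ (k * N)) \<tau> ?w"
        by (simp add: bipartite_tensor_eq power_mult)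
      have w: "psd (2 ^ (k * N) * 2 ^ (k * N)) ?w" using psd_power[OF t, of N] by (simp add: power_mult)
      note T = rbell_tensor[OF t w]
      have "bit_marginal (k * Suc N) (bipartite_power (2 ^ k) \<tau> (Suc N)) x = bit_marginal k \<tau> x1 * bit_marginal (k * N) ?w x2"
        unfolding bit_marginal_def sum_product P mult_Suc_right power_add sum_idx xs(3)
        using xs by (intro sum.cong refl T) auto
      moreover have "phase_marginal (k * Suc N) (bipartite_power (2 ^ k) \<tau> (Suc N)) x = phase_marginal k \<tau> x1 * phase_marginal (k * N) ?w x2"
        unfolding phase_marginal_def sum_product P mult_Suc_right power_add sum_idx xs(3)
        using xs by (intro sum.cong refl T) auto
      ultimately show "bit_marginal (k * Suc N) (bipartite_power (2 ^ k) \<tau> (Suc N)) x = blockprod k (bit_marginal k \<tau>) (Suc N) x \<and>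
        phase_marginal (k * Suc N) (bipartite_power (2 ^ k) \<tau> (Suc N)) x = blockprod k (phase_marginal k \<tau>) (Suc N) x"
        using Suc xs by simp
    qed
  qed
  then show "bit_marginal (k * N) (bipartite_power (2 ^ k) \<tau> N) x = blockprod k (bit_marginal k \<tau>) N x"
    "phase_marginal (k * N) (bipartite_power (2 ^ k) \<tau> N) x = blockprod k (phase_marginal k \<tau>) N x" using x by blast+
qed

lemma bit_marginal_diagonal:
  "x < 2 ^ n \<Longrightarrow> bit_marginal n \<omega> x = (\<Sum>z<2 ^ n. Re (\<omega> $$ (z * 2 ^ n + xor z x, z * 2 ^ n + xor z x)))"
  unfolding bit_marginal_def using arg_cong[OF bell_sum_phase[of x n \<omega>], of Re] by simp

lemma fidelity_le_marginals:
  assumes "psd (2 ^ n * 2 ^ n) \<omega>"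
  shows "rbell n \<omega> 0 0 \<le> bit_marginal n \<omega> 0" "rbell n \<omega> 0 0 \<le> phase_marginal n \<omega> 0"
  unfolding bit_marginal_def phase_marginal_def
  using rbell_nonneg[OF assms]
  by (auto intro!: member_le_sum[of 0 _ "\<lambda>w. rbell n \<omega> 0 w"] member_le_sum[of 0 _ "\<lambda>x. rbell n \<omega> x 0"])

lemma rbell_le_1:
  assumes "psd (2 ^ n * 2 ^ n) \<omega>" "mat_trace \<omega> = 1"
  shows "rbell n \<omega> 0 0 \<le> 1"
proof -
  have "bit_marginal n \<omega> 0 \<le> (\<Sum>x<2 ^ n. bit_marginal n \<omega> x)"
    using marginal_nonneg(1)[OF assms(1)] by (intro member_le_sum) auto
  then show ?thesis using fidelity_le_marginals(1)[OF assms(1)] marginal_sum(1)[OF assms] by simp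
qed

lemma bit_marginal_hadamard:
  "bit_marginal n (hadamard_map n \<omega>) 0 = phase_marginal n \<omega> 0"
  unfolding bit_marginal_def phase_marginal_def by (intro sum.cong refl) (simp add: bell_hadamard)

text \<open>The hypothesis says \<open>M + 2 * r \<le> k * N\<close>, where \<open>r\<close> qubit
  pairs suffice to hash one kind of error with up to \<open>N div p\<close> bad blocks. The protocol
  depends on this set of patterns only and hence serves all \<open>\<tau>\<close> at once.\<close>

lemma distill_power:
  assumes p: "p > 0" and M: "M + 2 * (2 * N + 2 * (k * (N div p)) + 1) \<le> k * N"
  shows "\<exists>\<Lambda>. locc (2 ^ M) (2 ^ M) ((2 ^ k) ^ N) ((2 ^ k) ^ N) \<Lambda> \<and>
    (\<forall>\<tau>. psd (2 ^ k * 2 ^ k) \<tau> \<longrightarrow> mat_trace \<tau> = 1 \<longrightarrow>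
      1 - bit_marginal k \<tau> 0 \<le> (1 / 4) ^ p \<longrightarrow> 1 - phase_marginal k \<tau> 0 \<le> (1 / 4) ^ p \<longrightarrow>
      1 - 2 * (1 / 2) ^ N \<le> rbell M (\<Lambda> (bipartite_power (2 ^ k) \<tau> N)) 0 0)"
proof -
  define t where "t = N div p"
  \<comment> \<open>Chosen so that the square of \<open>2 ^ N * 2 ^ (k * t)\<close> is below
    \<open>2 ^ r\<close>; the second hash takes all remaining pairs that are not kept.\<close>
  define r where "r = 2 * N + 2 * (k * t) + 1"
  define r2 where "r2 = k * N - M - r"
  define S where "S = {x. x < 2 ^ (k * N) \<and> bad_blocks k N x \<le> t}"
  have fS: "finite S" by (simp add: S_def)
  have n: "r + (r2 + M) = k * N" and rr: "r \<le> r2" using M by (auto simp: r2_def r_def t_def)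
  have "real ((card S)\<^sup>2) \<le> (2 ^ N * 2 ^ (k * t))\<^sup>2"
    unfolding of_nat_power S_def by (intro power_mono card_few_bad_blocks) simp
  also have "\<dots> = 2 ^ (2 * N + 2 * (k * t))" by (simp add: power_add power_mult_distrib power_mult[symmetric] mult.commute)
  also have "\<dots> < 2 ^ r" by (simp add: r_def)
  finally have "real ((card S)\<^sup>2) < real (2 ^ r)" by simp
  then have c1: "(card S)\<^sup>2 < 2 ^ r" by (simp only: of_nat_less_iff)
  have c2: "(card S)\<^sup>2 < 2 ^ r2" using less_le_trans[OF c1 power_increasing[OF rr, of "2::nat"]] by simp
  have S: "S \<subseteq> {..<2 ^ (r + (r2 + M))}" unfolding n by (auto simp: S_def)
  obtain L where L: "locc (2 ^ M) (2 ^ M) (2 ^ (k * N)) (2 ^ (k * N)) L"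
    and B: "\<And>\<omega>. psd (2 ^ (k * N) * 2 ^ (k * N)) \<omega> \<Longrightarrow> (\<Sum>x\<in>S. \<Sum>w\<in>S. rbell (k * N) \<omega> x w) \<le> rbell M (L \<omega>) 0 0"
    using distill[OF S c1 c2] unfolding n by blast
  have "1 - 2 * (1 / 2) ^ N \<le> rbell M (L (bipartite_power (2 ^ k) \<tau> N)) 0 0"
    if t: "psd (2 ^ k * 2 ^ k) \<tau>" "mat_trace \<tau> = 1"
      and e: "1 - bit_marginal k \<tau> 0 \<le> (1 / 4) ^ p" "1 - phase_marginal k \<tau> 0 \<le> (1 / 4) ^ p" for \<tau>
  proof -
    let ?w = "bipartite_power (2 ^ k) \<tau> N"
    have w: "psd (2 ^ (k * N) * 2 ^ (k * N)) ?w" using psd_power[OF t(1), of N] by (simp add: power_mult)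
    \<comment> \<open>A pattern outside \<open>S\<close> has at least \<open>N div p + 1\<close> bad
      blocks, and \<open>p\<close> times this number is at least \<open>N\<close>; the resulting
      \<open>(1 / 4) ^ N\<close> outweighs \<open>2 ^ N\<close>.\<close>
    have bound: "((1 / 4 :: real) ^ p) ^ Suc (N div p) * 2 ^ N \<le> (1 / 2) ^ N"
    proof -
      have "N = p * (N div p) + N mod p" by simp
      then have "N \<le> p * (N div p) + p" using mod_less_divisor[OF p, of N] by linarith
      then have "N \<le> p * Suc (N div p)" by simp
      then have "((1 / 4 :: real) ^ p) ^ Suc (N div p) \<le> (1 / 4) ^ N"
        unfolding power_mult[symmetric] by (intro power_decreasing) auto
      then have "((1 / 4 :: real) ^ p) ^ Suc (N div p) * 2 ^ N \<le> (1 / 4) ^ N * 2 ^ N" by (intro mult_right_mono) auto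
      also have "\<dots> = (1 / 2) ^ N" by (simp add: power_mult_distrib[symmetric])
      finally show ?thesis .
    qed
    have E: "0 < (1 / 4 :: real) ^ p" "(1 / 4 :: real) ^ p \<le> 1" by (auto simp: power_le_one)
    define C where "C = {x. x < 2 ^ (k * N) \<and> Suc t \<le> bad_blocks k N x}"
    have SC: "{..<2 ^ (k * N)} = S \<union> C" "S \<inter> C = {}" and fC: "finite C" by (auto simp: S_def C_def)
    have bit: "(\<Sum>x\<in>C. bit_marginal (k * N) ?w x) \<le> (1 / 2) ^ N"
    proof -
      have "(\<Sum>x\<in>C. bit_marginal (k * N) ?w x) = (\<Sum>x\<in>C. blockprod k (bit_marginal k \<tau>) N x)"
        by (intro sum.cong refl marginal_power(1)[OF t(1)]) (auto simp: C_def)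
      also have "\<dots> \<le> ((1 / 4) ^ p) ^ Suc t * 2 ^ N"
        unfolding C_def using many_bad_blocks[of k "bit_marginal k \<tau>", OF marginal_nonneg(1)[OF t(1)] marginal_sum(1)[OF t] e(1) E] .
      finally show ?thesis using bound by (simp add: t_def)
    qed
    have phase: "(\<Sum>x\<in>C. phase_marginal (k * N) ?w x) \<le> (1 / 2) ^ N"
    proof -
      have "(\<Sum>x\<in>C. phase_marginal (k * N) ?w x) = (\<Sum>x\<in>C. blockprod k (phase_marginal k \<tau>) N x)"
        by (intro sum.cong refl marginal_power(2)[OF t(1)]) (auto simp: C_def)
      also have "\<dots> \<le> ((1 / 4) ^ p) ^ Suc t * 2 ^ N"
        unfolding C_def using many_bad_blocks[of k "phase_marginal k \<tau>", OF marginal_nonneg(2)[OF t(1)] marginal_sum(2)[OF t] e(2) E] .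
      finally show ?thesis using bound by (simp add: t_def)
    qed
    let ?b = "rbell (k * N) ?w"
    have b0: "0 \<le> ?b x w" if "x < 2 ^ (k * N)" for x w using rbell_nonneg[OF _ that] psd_power[OF t(1), of N] by (simp add: power_mult)
    have "(\<Sum>x<2 ^ (k * N). \<Sum>w<2 ^ (k * N). ?b x w) = 1"
    proof -
      have "(\<Sum>x<2 ^ (k * N). bit_marginal (k * N) ?w x) = (\<Sum>x<2 ^ (k * N). blockprod k (bit_marginal k \<tau>) N x)"
        by (intro sum.cong refl marginal_power(1)[OF t(1)]) auto
      then show ?thesis unfolding sum_blockprod marginal_sum(1)[OF t] by (simp add: bit_marginal_def)
    qed
    \<comment> \<open>Union bound: weight outside \<open>S \<times> S\<close> has its bit pattern or
      its phase pattern in \<open>C\<close>.\<close>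
    moreover have "(\<Sum>x<2 ^ (k * N). \<Sum>w<2 ^ (k * N). ?b x w) = (\<Sum>x\<in>S. \<Sum>w<2 ^ (k * N). ?b x w) + (\<Sum>x\<in>C. bit_marginal (k * N) ?w x)"
      unfolding bit_marginal_def by (subst (1) SC(1)) (rule sum.union_disjoint[OF fS fC SC(2)])
    moreover have "(\<Sum>x\<in>S. \<Sum>w<2 ^ (k * N). ?b x w) = (\<Sum>x\<in>S. \<Sum>w\<in>S. ?b x w) + (\<Sum>x\<in>S. \<Sum>w\<in>C. ?b x w)"
      unfolding SC(1) sum.union_disjoint[OF fS fC SC(2)] by (rule sum.distrib)
    moreover have "(\<Sum>x\<in>S. \<Sum>w\<in>C. ?b x w) \<le> (\<Sum>w\<in>C. phase_marginal (k * N) ?w w)"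
    proof -
      have "(\<Sum>x\<in>S. \<Sum>w\<in>C. ?b x w) \<le> (\<Sum>x<2 ^ (k * N). \<Sum>w\<in>C. ?b x w)"
        using b0 by (intro sum_mono2 sum_nonneg) (auto simp: S_def)
      also have "\<dots> = (\<Sum>w\<in>C. phase_marginal (k * N) ?w w)" unfolding phase_marginal_def by (rule sum.swap)
      finally show ?thesis .
    qed
    ultimately show ?thesis using bit phase B[OF w] by linarith
  qed
  then show ?thesis using L by (intro exI[of _ L]) (simp add: power_mult)
qed

text \<open>
  The parties measure \<open>T\<close> copies of \<open>\<Gamma> \<rho>\<^sup>m\<close> in the computational basis and continue with \<open>A\<close> if at
  most \<open>s\<close> of the outcomes disagree, and with \<open>W\<close> otherwise.
\<close>

lemma test_and_branch:
  assumes G: "locc (2 ^ k) (2 ^ k) (d ^ m) (d ^ m) \<Gamma>"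
    and A: "locc (2 ^ M) (2 ^ M) (d ^ n) (d ^ n) A" and W: "locc (2 ^ M) (2 ^ M) (d ^ n) (d ^ n) W"
  shows "\<exists>\<Lambda>. locc (2 ^ M) (2 ^ M) (d ^ (m * T + n)) (d ^ (m * T + n)) \<Lambda> \<and>
    (\<forall>\<rho>\<in>density_operators (d * d). \<exists>acc.
      acc = (\<Sum>x\<in>{x. x < 2 ^ (k * T) \<and> bad_blocks k T x \<le> s}. blockprod k (bit_marginal k (\<Gamma> (bipartite_power d \<rho> m))) T x) \<and>
      rbell M (\<Lambda> (bipartite_power d \<rho> (m * T + n))) 0 0 =
        acc * rbell M (A (bipartite_power d \<rho> n)) 0 0 + (1 - acc) * rbell M (W (bipartite_power d \<rho> n)) 0 0)"
proof -
  let ?K = "2 ^ (k * T) :: nat"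
  have K: "(2 ^ k) ^ T = ?K" by (simp add: power_mult)
  obtain GT where GT: "locc ?K ?K ((d ^ m) ^ T) ((d ^ m) ^ T) GT"
    "\<And>X. X \<in> carrier_mat (d ^ m * d ^ m) (d ^ m * d ^ m) \<Longrightarrow> GT (bipartite_power (d ^ m) X T) = bipartite_power (2 ^ k) (\<Gamma> X) T"
    using locc_power[OF G, of T] unfolding K by blast
  obtain L1 where L1: "locc (?K * d ^ n) (?K * d ^ n) ((d ^ m) ^ T * d ^ n) ((d ^ m) ^ T * d ^ n) L1"
    "\<And>X Y. X \<in> carrier_mat ((d ^ m) ^ T * (d ^ m) ^ T) ((d ^ m) ^ T * (d ^ m) ^ T) \<Longrightarrow>
      L1 (tensor ((d ^ m) ^ T) ((d ^ m) ^ T) (d ^ n) (d ^ n) X Y) = tensor ?K ?K (d ^ n) (d ^ n) (GT X) Y"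
    using locc_tensor_right[OF GT(1)] by blast
  \<comment> \<open>The decision uses only the difference of the two outcomes, so the acceptance
    probability is a function of the bit marginal.\<close>
  define h where "h s' t' = (if bad_blocks k T (xor s' t') \<le> s then A else W)" for s' t'
  have h: "locc (2 ^ M) (2 ^ M) (d ^ n) (d ^ n) (h s' t')" for s' t' using A W by (simp add: h_def)
  obtain L2 where L2: "locc (2 ^ M) (2 ^ M) (?K * d ^ n) (?K * d ^ n) L2"
    "\<And>X Y. X \<in> carrier_mat (?K * ?K) (?K * ?K) \<Longrightarrow> Y \<in> carrier_mat (d ^ n * d ^ n) (d ^ n * d ^ n) \<Longrightarrow>
      L2 (tensor ?K ?K (d ^ n) (d ^ n) X Y) = mat_family_sum (2 ^ M * 2 ^ M) ?K (\<lambda>s. mat_family_sum (2 ^ M * 2 ^ M) ?K (\<lambda>t. X $$ (s * ?K + t, s * ?K + t) \<cdot>\<^sub>m h s t Y))"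
    using locc_measure_first[of ?K ?K "2 ^ M" "2 ^ M" "d ^ n" "d ^ n" h, OF h] by blast
  obtain L where L: "locc (2 ^ M) (2 ^ M) ((d ^ m) ^ T * d ^ n) ((d ^ m) ^ T * d ^ n) L"
    "\<And>Z. Z \<in> carrier_mat (((d ^ m) ^ T * d ^ n) * ((d ^ m) ^ T * d ^ n)) (((d ^ m) ^ T * d ^ n) * ((d ^ m) ^ T * d ^ n)) \<Longrightarrow> L Z = L2 (L1 Z)"
    using locc_comp[OF L1(1) L2(1)] by blast
  have dim: "d ^ (m * T + n) = (d ^ m) ^ T * d ^ n" by (simp add: power_add power_mult)
  have "rbell M (L (bipartite_power d \<rho> (m * T + n))) 0 0 =
        acc * rbell M (A (bipartite_power d \<rho> n)) 0 0 + (1 - acc) * rbell M (W (bipartite_power d \<rho> n)) 0 0"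
    if r: "\<rho> \<in> density_operators (d * d)"
      and acc: "acc = (\<Sum>x\<in>{x. x < 2 ^ (k * T) \<and> bad_blocks k T x \<le> s}. blockprod k (bit_marginal k (\<Gamma> (bipartite_power d \<rho> m))) T x)"
    for \<rho> acc
  proof -
    let ?\<tau> = "\<Gamma> (bipartite_power d \<rho> m)" and ?Y = "bipartite_power d \<rho> n"
    let ?w = "bipartite_power (2 ^ k) ?\<tau> T"
    note st = bipartite_power_state[OF r]
    have t: "psd (2 ^ k * 2 ^ k) ?\<tau>" "mat_trace ?\<tau> = 1"
      using locc_psd[OF G st(1)] locc_trace[OF G psd_carrier[OF st(1)]] st(2) by auto
    have w: "psd (?K * ?K) ?w" using psd_power[OF t(1), of T] by (simp add: power_mult)
    have "L (bipartite_power d \<rho> (m * T + n)) = L2 (tensor ?K ?K (d ^ n) (d ^ n) ?w ?Y)"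
    proof -
      have "bipartite_power d \<rho> (m * T + n) = tensor ((d ^ m) ^ T) ((d ^ m) ^ T) (d ^ n) (d ^ n) (bipartite_power (d ^ m) (bipartite_power d \<rho> m) T) ?Y"
        unfolding bipartite_power_add bipartite_power_mult power_mult ..
      then show ?thesis
        using L(2)[OF tensor_carrier] L1(2)[OF bipartite_power_carrier] GT(2)[OF bipartite_power_carrier] by simp
    qed
    also have "\<dots> = mat_family_sum (2 ^ M * 2 ^ M) ?K (\<lambda>s. mat_family_sum (2 ^ M * 2 ^ M) ?K (\<lambda>t. ?w $$ (s * ?K + t, s * ?K + t) \<cdot>\<^sub>m h s t ?Y))"
      by (rule L2(2)[OF psd_carrier[OF w] bipartite_power_carrier])
    finally have "bell M (L (bipartite_power d \<rho> (m * T + n))) 0 0 = (\<Sum>s<?K. \<Sum>t<?K. ?w $$ (s * ?K + t, s * ?K + t) * bell M (h s t ?Y) 0 0)"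
      using bell_smult[OF locc_carrier[OF h bipartite_power_carrier], of 0] by (simp add: bell_family_sum)
    \<comment> \<open>Diagonal entries of a positive matrix are real, so real parts may be taken
      factor by factor.\<close>
    moreover have "Im (?w $$ (r, r)) = 0" if "r < ?K * ?K" for r
      using psd_diag[OF w that] by (simp add: complex_nonneg_iff)
    ultimately have "rbell M (L (bipartite_power d \<rho> (m * T + n))) 0 0 = (\<Sum>s<?K. \<Sum>t<?K. Re (?w $$ (s * ?K + t, s * ?K + t)) * rbell M (h s t ?Y) 0 0)"
      by simp
    also have "\<dots> = (\<Sum>s<?K. \<Sum>x<?K. Re (?w $$ (s * ?K + xor s x, s * ?K + xor s x)) * rbell M (h s (xor s x) ?Y) 0 0)"
    proof (rule sum.cong[OF refl])
      fix s :: nat assume "s \<in> {..<?K}"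
      then show "(\<Sum>t<?K. Re (?w $$ (s * ?K + t, s * ?K + t)) * rbell M (h s t ?Y) 0 0) =
        (\<Sum>x<?K. Re (?w $$ (s * ?K + xor s x, s * ?K + xor s x)) * rbell M (h s (xor s x) ?Y) 0 0)"
        using sum_xor[of s "k * T" "\<lambda>t. Re (?w $$ (s * ?K + t, s * ?K + t)) * rbell M (h s t ?Y) 0 0"] by (simp add: xor.commute)
    qed
    also have "\<dots> = (\<Sum>x<?K. \<Sum>s<?K. Re (?w $$ (s * ?K + xor s x, s * ?K + xor s x)) * rbell M (h 0 x ?Y) 0 0)"
      by (subst sum.swap) (simp add: h_def)
    also have "\<dots> = (\<Sum>x<?K. blockprod k (bit_marginal k ?\<tau>) T x * rbell M (h 0 x ?Y) 0 0)"
      unfolding sum_distrib_right[symmetric]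
      by (intro sum.cong refl) (simp add: bit_marginal_diagonal[symmetric] marginal_power(1)[OF t(1)])
    also have "\<dots> = acc * rbell M (A ?Y) 0 0 + (1 - acc) * rbell M (W ?Y) 0 0"
    proof -
      let ?S = "{x. x < ?K \<and> bad_blocks k T x \<le> s}" and ?C = "{x. x < ?K \<and> \<not> bad_blocks k T x \<le> s}"
      have U: "{..<?K} = ?S \<union> ?C" by auto
      have "(\<Sum>x<?K. blockprod k (bit_marginal k ?\<tau>) T x) = 1"
        unfolding sum_blockprod marginal_sum(1)[OF t] by simp
      then have C: "(\<Sum>x\<in>?C. blockprod k (bit_marginal k ?\<tau>) T x) = 1 - acc"
        unfolding U acc by (subst (asm) sum.union_disjoint) auto
      have "(\<Sum>x<?K. blockprod k (bit_marginal k ?\<tau>) T x * rbell M (h 0 x ?Y) 0 0) =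
        (\<Sum>x\<in>?S. blockprod k (bit_marginal k ?\<tau>) T x * rbell M (A ?Y) 0 0) + (\<Sum>x\<in>?C. blockprod k (bit_marginal k ?\<tau>) T x * rbell M (W ?Y) 0 0)"
        unfolding U by (subst sum.union_disjoint) (auto simp: h_def)
      then show ?thesis unfolding sum_distrib_right[symmetric] C acc[symmetric] .
    qed
    finally show ?thesis .
  qed
  then show ?thesis using L(1) unfolding dim by blast
qed

section \<open>Fidelity and error\<close>

text \<open>In an eigenbasis the form is a combination of the eigenvalues with coefficients of
  modulus at most \<open>1\<close>, by the Cauchy-Schwarz inequality.\<close>

lemma sesq_le_trace_norm:
  assumes Y: "Y \<in> carrier_mat n n" and h: "\<And>i j. i < n \<Longrightarrow> j < n \<Longrightarrow> Y $$ (i, j) = cnj (Y $$ (j, i))"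
    and phi: "ip n \<phi> \<phi> = 1"
  shows "cmod (sesq n Y \<phi> \<phi>) \<le> trace_norm Y"
proof -
  obtain u d where ud: "eigenbasis n u d Y" and tn: "trace_norm Y = (\<Sum>k<n. \<bar>d k\<bar>)"
    using hermitian_eigenbasis[OF Y h] by blast
  have u: "orthobasis n u" using ud by (simp add: eigenbasis_def)
  have one: "sesq n (1\<^sub>m n) x y = ip n x y" for x y
  proof -
    have "sesq n (1\<^sub>m n) x y = (\<Sum>i<n. \<Sum>j<n. if j = i then cnj (x i) * y i else 0)"
      unfolding sesq_def by (intro sum.cong refl) auto
    then show ?thesis by (simp add: ip_def)
  qed
  have "psd n (1\<^sub>m n)"
    unfolding psd_iff one by (auto simp: ip_def complex_nonneg_iff sum_nonneg mult.commute)
  from psd_cauchy_schwarz[OF this, of \<phi>] have "(cmod (ip n \<phi> (u k)))\<^sup>2 \<le> 1" if "k < n" for k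
  proof -
    have "ip n (u k) (u k) = 1" using u that by (simp add: orthobasis_def)
    then show ?thesis using \<open>\<And>y. (cmod (sesq n (1\<^sub>m n) \<phi> y))\<^sup>2 \<le> _\<close>[of "u k"] phi by (simp add: one)
  qed
  then have le: "cmod (ip n \<phi> (u k)) * cmod (ip n \<phi> (u k)) \<le> 1" if "k < n" for k
    using that by (simp add: power2_eq_square)
  have "cmod (sesq n Y \<phi> \<phi>) \<le> (\<Sum>k<n. cmod (of_real (d k) * ip n \<phi> (u k) * ip n (u k) \<phi>))"
    unfolding eigenbasis_sesq[OF ud] by (rule norm_sum)
  also have "\<dots> \<le> (\<Sum>k<n. \<bar>d k\<bar>)"
  proof (rule sum_mono)
    fix k assume "k \<in> {..<n}"
    then show "cmod (of_real (d k) * ip n \<phi> (u k) * ip n (u k) \<phi>) \<le> \<bar>d k\<bar>"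
      using mult_left_mono[OF le[of k], of "\<bar>d k\<bar>"] ip_conj[of n "u k" \<phi>] by (simp add: norm_mult mult.assoc)
  qed
  finally show ?thesis by (simp add: tn)
qed

text \<open>The counterpart of \<open>trace_norm_ebits\<close>: together they make vanishing error
  equivalent to fidelity tending to \<open>1\<close>.\<close>

lemma fidelity_ge_trace_norm:
  assumes w: "psd (2 ^ n * 2 ^ n) \<omega>"
  shows "1 - rbell n \<omega> 0 0 \<le> trace_norm (\<omega> - bipartite_power 2 ebit n)"
proof -
  let ?P = "bipartite_power 2 ebit n" and ?n = "2 ^ n * 2 ^ n :: nat"
  let ?Y = "\<omega> - ?P"
  have P: "?P \<in> carrier_mat ?n ?n" by (rule bipartite_power_carrier)
  have wc: "\<omega> \<in> carrier_mat ?n ?n" by (rule psd_carrier[OF w])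
  have Y: "?Y \<in> carrier_mat ?n ?n" by (rule minus_carrier_mat[OF P])
  have h: "?Y $$ (i, j) = cnj (?Y $$ (j, i))" if "i < ?n" "j < ?n" for i j
    using psd_hermitian[OF w that] that wc by (simp add: ebit_power)
  have sY: "sesq ?n ?Y x x = sesq ?n \<omega> x x - sesq ?n ?P x x" for x
    unfolding sesq_def sum_subtractf[symmetric] using wc by (intro sum.cong) (auto simp: algebra_simps carrier_matD[OF P])
  have "sesq ?n ?P (ebits_ket n) (ebits_ket n) = ip ?n (ebits_ket n) (ebits_ket n) * ip ?n (ebits_ket n) (ebits_ket n)"
    unfolding sesq_def ip_def sum_product by (intro sum.cong) (auto simp: ebit_power)
  then have "sesq ?n ?P (ebits_ket n) (ebits_ket n) = 1" by (simp add: ip_ebits_ket)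
  then have "1 - rbell n \<omega> 0 0 = Re (- sesq ?n ?Y (ebits_ket n) (ebits_ket n))"
    by (simp add: sY bell_fidelity)
  also have "\<dots> \<le> cmod (sesq ?n ?Y (ebits_ket n) (ebits_ket n))"
    using complex_Re_le_cmod[of "- sesq ?n ?Y (ebits_ket n) (ebits_ket n)"] by simp
  also have "\<dots> \<le> trace_norm ?Y" by (rule sesq_le_trace_norm[OF Y h ip_ebits_ket])
  finally show ?thesis .
qed

text \<open>Linear in the output and polynomial in the entries of \<open>\<rho>\<close>, hence
  continuous in \<open>\<rho>\<close> and exactly averaged by a random choice of protocol.\<close>

definition fidelity :: "nat \<Rightarrow> nat \<Rightarrow> nat \<Rightarrow> (complex mat \<Rightarrow> complex mat) \<Rightarrow> complex mat \<Rightarrow> real" where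
  "fidelity d n M \<Lambda> \<rho> = rbell M (\<Lambda> (bipartite_power d \<rho> n)) 0 0"

lemma output_state:
  assumes "locc K K (d ^ n) (d ^ n) \<Lambda>" "\<rho> \<in> density_operators (d * d)"
  shows "psd (K * K) (\<Lambda> (bipartite_power d \<rho> n))" "mat_trace (\<Lambda> (bipartite_power d \<rho> n)) = 1"
  using locc_psd[OF assms(1)] locc_trace[OF assms(1) bipartite_power_carrier] bipartite_power_state[OF assms(2)] by auto

lemma fidelity_bounds:
  assumes "locc (2 ^ M) (2 ^ M) (d ^ n) (d ^ n) \<Lambda>" "\<rho> \<in> density_operators (d * d)"
  shows "0 \<le> fidelity d n M \<Lambda> \<rho>" "fidelity d n M \<Lambda> \<rho> \<le> 1"
  unfolding fidelity_def using rbell_nonneg[OF output_state(1)[OF assms]] rbell_le_1[OF output_state[OF assms]] by auto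

text \<open>In dimension one the only Bell weight is the trace.\<close>

lemma fidelity_zero:
  assumes "locc (2 ^ 0) (2 ^ 0) (d ^ n) (d ^ n) \<Lambda>" "\<rho> \<in> density_operators (d * d)"
  shows "fidelity d n 0 \<Lambda> \<rho> = 1"
  unfolding fidelity_def using rbell_sum[OF output_state[OF assms]] by simp

lemma error_le_fidelity:
  assumes "\<Lambda> \<in> distillation_channels d R n" "\<rho> \<in> density_operators (d * d)"
    and "1 - fidelity d n (qubit_pairs R n) \<Lambda> \<rho> \<le> t\<^sup>2" "0 < t"
  shows "distillation_error d R n \<Lambda> \<rho> \<le> t\<^sup>2 + t"
proof -
  have L: "locc (2 ^ qubit_pairs R n) (2 ^ qubit_pairs R n) (d ^ n) (d ^ n) \<Lambda>" using assms(1) by (simp add: distillation_channels_def)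
  show ?thesis
    using trace_norm_ebits[OF output_state[OF L assms(2)], of t] assms(3,4) by (simp add: distillation_error_def fidelity_def)
qed

lemma fidelity_le_error:
  assumes "\<Lambda> \<in> distillation_channels d R n" "\<rho> \<in> density_operators (d * d)"
  shows "1 - fidelity d n (qubit_pairs R n) \<Lambda> \<rho> \<le> 2 * distillation_error d R n \<Lambda> \<rho>"
proof -
  have L: "locc (2 ^ qubit_pairs R n) (2 ^ qubit_pairs R n) (d ^ n) (d ^ n) \<Lambda>" using assms(1) by (simp add: distillation_channels_def)
  show ?thesis
    using fidelity_ge_trace_norm[OF output_state(1)[OF L assms(2)]] by (simp add: distillation_error_def fidelity_def)
qed

lemma error_nonneg: "0 \<le> distillation_error d R n \<Lambda> \<rho>"
  unfolding distillation_error_def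
  using trace_norm_nonneg[OF minus_carrier_mat[OF bipartite_power_carrier]] by simp

section \<open>Uniformly achievable rates\<close>

text \<open>The target is any number \<open>M\<close> of pairs up to \<open>R * real n\<close>, with
  a threshold \<open>n0\<close> common to all of them. This avoids ceilings and lets a rate be kept
  when some copies are spent elsewhere.\<close>

definition reaches :: "nat \<Rightarrow> complex mat set \<Rightarrow> real \<Rightarrow> bool" where
  "reaches d X R \<longleftrightarrow> (\<forall>\<eta>>0. \<exists>n0. \<forall>n\<ge>n0. \<forall>M. real M \<le> R * real n \<longrightarrow>
    (\<exists>\<Lambda>. locc (2 ^ M) (2 ^ M) (d ^ n) (d ^ n) \<Lambda> \<and> (\<forall>\<rho>\<in>X. 1 - \<eta> \<le> fidelity d n M \<Lambda> \<rho>)))"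

lemma reaches_mono: "reaches d X R \<Longrightarrow> Y \<subseteq> X \<Longrightarrow> reaches d Y R"
  unfolding reaches_def by (meson subsetD)

lemma reaches_empty: "reaches d {} R"
  unfolding reaches_def using locc_exists[of "2 ^ _" "2 ^ _"] by simp

text \<open>With \<open>T = s * l\<close> tested blocks and threshold \<open>s\<close>, rejection at
  error at most \<open>e\<close> has probability at most \<open>(2 ^ l * e) ^ s\<close>, acceptance
  at error at least \<open>e'\<close> at most \<open>(2 / 4) ^ s\<close>; both equal
  \<open>(1 / 2) ^ s\<close> for the given constants. Between the thresholds the outcome is
  uncontrolled, so membership in both \<open>A\<close> and \<open>W\<close> is required.\<close>

lemma reaches_branch:
  assumes A: "reaches d A R1" and W: "reaches d W R1" and R: "R < R1" "0 \<le> R"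
    and G: "locc (2 ^ k) (2 ^ k) (d ^ m) (d ^ m) \<Gamma>"
    and e': "0 < e'" "e' \<le> 1" and l: "(1 - e' / 2) ^ l \<le> 1 / 4" and e: "e = (1 / 2) ^ Suc l"
  defines "err \<rho> \<equiv> 1 - bit_marginal k (\<Gamma> (bipartite_power d \<rho> m)) 0"
  shows "reaches d {\<rho> \<in> density_operators (d * d). (err \<rho> \<le> e \<and> \<rho> \<in> A) \<or> (e' \<le> err \<rho> \<and> \<rho> \<in> W) \<or> (\<rho> \<in> A \<and> \<rho> \<in> W)} R"
  unfolding reaches_def
proof (intro allI impI)
  fix \<eta> :: real assume \<eta>: "0 < \<eta>"
  obtain s where s: "(1 / 2 :: real) ^ s < \<eta> / 2" using real_arch_pow_inv[of "\<eta> / 2" "1 / 2"] \<eta> by auto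
  define T where "T = s * l"
  obtain n1 where n1: "\<And>n M. n \<ge> n1 \<Longrightarrow> real M \<le> R1 * real n \<Longrightarrow>
    \<exists>\<Lambda>. locc (2 ^ M) (2 ^ M) (d ^ n) (d ^ n) \<Lambda> \<and> (\<forall>\<rho>\<in>A. 1 - \<eta> / 2 \<le> fidelity d n M \<Lambda> \<rho>)"
    using A \<eta> unfolding reaches_def by (meson half_gt_zero)
  obtain n2 where n2: "\<And>n M. n \<ge> n2 \<Longrightarrow> real M \<le> R1 * real n \<Longrightarrow>
    \<exists>\<Lambda>. locc (2 ^ M) (2 ^ M) (d ^ n) (d ^ n) \<Lambda> \<and> (\<forall>\<rho>\<in>W. 1 - \<eta> / 2 \<le> fidelity d n M \<Lambda> \<rho>)"
    using W \<eta> unfolding reaches_def by (meson half_gt_zero)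
  \<comment> \<open>From \<open>n3\<close> on, \<open>R * n \<le> R1 * (n - m * T)\<close>: the gap
    between the rates pays for the tested copies.\<close>
  obtain n3 where n3: "R1 * real (m * T) / (R1 - R) \<le> real n3" using real_arch_simple by blast
  show "\<exists>n0. \<forall>n\<ge>n0. \<forall>M. real M \<le> R * real n \<longrightarrow>
    (\<exists>\<Lambda>. locc (2 ^ M) (2 ^ M) (d ^ n) (d ^ n) \<Lambda> \<and>
      (\<forall>\<rho>\<in>{\<rho> \<in> density_operators (d * d). (err \<rho> \<le> e \<and> \<rho> \<in> A) \<or> (e' \<le> err \<rho> \<and> \<rho> \<in> W) \<or> (\<rho> \<in> A \<and> \<rho> \<in> W)}. 1 - \<eta> \<le> fidelity d n M \<Lambda> \<rho>))"
  proof (intro exI[of _ "m * T + max n1 n2 + n3"] allI impI)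
    fix n M assume n: "m * T + max n1 n2 + n3 \<le> n" and M: "real M \<le> R * real n"
    define n' where "n' = n - m * T"
    have nn: "n = m * T + n'" "n1 \<le> n'" "n2 \<le> n'" using n by (auto simp: n'_def)
    have "R1 * real (m * T) \<le> (R1 - R) * real n3" using n3 R by (simp add: field_simps)
    also have "\<dots> \<le> (R1 - R) * real n" using n R by (intro mult_left_mono) auto
    finally have "R * real n \<le> R1 * (real n - real (m * T))" by (simp add: algebra_simps)
    then have M': "real M \<le> R1 * real n'" using M nn(1) by simp
    obtain LA where LA: "locc (2 ^ M) (2 ^ M) (d ^ n') (d ^ n') LA" "\<And>\<rho>. \<rho> \<in> A \<Longrightarrow> 1 - \<eta> / 2 \<le> fidelity d n' M LA \<rho>"
      using n1[OF nn(2) M'] by blast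
    obtain LW where LW: "locc (2 ^ M) (2 ^ M) (d ^ n') (d ^ n') LW" "\<And>\<rho>. \<rho> \<in> W \<Longrightarrow> 1 - \<eta> / 2 \<le> fidelity d n' M LW \<rho>"
      using n2[OF nn(3) M'] by blast
    let ?acc = "\<lambda>\<rho>. \<Sum>x\<in>{x. x < 2 ^ (k * T) \<and> bad_blocks k T x \<le> s}. blockprod k (bit_marginal k (\<Gamma> (bipartite_power d \<rho> m))) T x"
    obtain L where L: "locc (2 ^ M) (2 ^ M) (d ^ n) (d ^ n) L"
      and F: "\<And>\<rho>. \<rho> \<in> density_operators (d * d) \<Longrightarrow>
        fidelity d n M L \<rho> = ?acc \<rho> * fidelity d n' M LA \<rho> + (1 - ?acc \<rho>) * fidelity d n' M LW \<rho>"
      using test_and_branch[OF G LA(1) LW(1), of T s] unfolding fidelity_def nn(1)[symmetric] by blast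
    have "1 - \<eta> \<le> fidelity d n M L \<rho>"
      if r: "\<rho> \<in> density_operators (d * d)" and c: "(err \<rho> \<le> e \<and> \<rho> \<in> A) \<or> (e' \<le> err \<rho> \<and> \<rho> \<in> W) \<or> (\<rho> \<in> A \<and> \<rho> \<in> W)" for \<rho>
    proof -
      let ?\<tau> = "\<Gamma> (bipartite_power d \<rho> m)"
      note t = output_state[OF G r]
      note p = marginal_nonneg(1)[OF t(1)] marginal_sum(1)[OF t]
      let ?B = "blockprod k (bit_marginal k ?\<tau>) T"
      have total: "(\<Sum>x<2 ^ (k * T). ?B x) = 1" unfolding sum_blockprod p(2) by simp
      have U: "{..<2 ^ (k * T)} = {x. x < 2 ^ (k * T) \<and> bad_blocks k T x \<le> s} \<union> {x. x < 2 ^ (k * T) \<and> Suc s \<le> bad_blocks k T x}" by auto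
      have split: "?acc \<rho> + (\<Sum>x\<in>{x. x < 2 ^ (k * T) \<and> Suc s \<le> bad_blocks k T x}. ?B x) = 1"
        using total unfolding U by (subst (asm) sum.union_disjoint) auto
      have B0: "0 \<le> ?B x" if "x < 2 ^ (k * T)" for x using blockprod_nonneg[of k "bit_marginal k ?\<tau>" x T] p(1) that by blast
      have acc0: "0 \<le> ?acc \<rho>" using B0 by (intro sum_nonneg) auto
      have acc1: "?acc \<rho> \<le> 1" using split sum_nonneg[of "{x. x < 2 ^ (k * T) \<and> Suc s \<le> bad_blocks k T x}" ?B] B0 by auto
      have good: "1 - ?acc \<rho> \<le> \<eta> / 2" if "err \<rho> \<le> e"
      proof -
        have e1: "0 < e" "e \<le> 1" unfolding e by (simp, intro power_le_one) auto
        have "1 - ?acc \<rho> = (\<Sum>x\<in>{x. x < 2 ^ (k * T) \<and> Suc s \<le> bad_blocks k T x}. ?B x)" using split by simp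
        also have "\<dots> \<le> e ^ Suc s * 2 ^ T"
          using many_bad_blocks[of k "bit_marginal k ?\<tau>" e T "Suc s", OF p] that e1 by (simp add: err_def)
        also have "\<dots> \<le> e ^ s * 2 ^ T" using e1 by (intro mult_right_mono power_decreasing) auto
        also have "\<dots> = (1 / 2) ^ s"
          unfolding e T_def mult.commute[of s l] power_mult power_mult_distrib[symmetric] by (simp add: power_one_over)
        finally show ?thesis using s by simp
      qed
      have bad: "?acc \<rho> \<le> \<eta> / 2" if "e' \<le> err \<rho>"
      proof -
        have "?acc \<rho> \<le> 2 ^ s * (1 - e' / 2) ^ T"
          using few_bad_blocks[of k "bit_marginal k ?\<tau>" e' T s, OF p] that e' by (simp add: err_def)
        also have "(1 - e' / 2) ^ T = ((1 - e' / 2) ^ l) ^ s" unfolding T_def mult.commute[of s l] by (rule power_mult)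
        also have "2 ^ s * ((1 - e' / 2) ^ l) ^ s \<le> 2 ^ s * (1 / 4) ^ s"
          using l e' by (intro mult_left_mono power_mono) auto
        also have "\<dots> = (1 / 2) ^ s" by (simp add: power_mult_distrib[symmetric])
        finally show ?thesis using s by simp
      qed
      note bA = fidelity_bounds[OF LA(1) r] and bW = fidelity_bounds[OF LW(1) r]
      let ?a = "?acc \<rho>" and ?FA = "fidelity d n' M LA \<rho>" and ?FW = "fidelity d n' M LW \<rho>"
      have 1: "?a + ?FA - 1 \<le> ?a * ?FA"
        using mult_nonneg_nonneg[of "1 - ?a" "1 - ?FA"] acc1 bA by (simp add: algebra_simps)
      have 2: "?FW - ?a \<le> (1 - ?a) * ?FW"
        using mult_nonneg_nonneg[of ?a "1 - ?FW"] acc0 bW by (simp add: algebra_simps)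
      have 3: "0 \<le> ?a * ?FA" "0 \<le> (1 - ?a) * ?FW" using acc0 acc1 bA bW by simp_all
      consider "err \<rho> \<le> e" "\<rho> \<in> A" | "e' \<le> err \<rho>" "\<rho> \<in> W" | "\<rho> \<in> A" "\<rho> \<in> W" using c by blast
      then show ?thesis
      proof cases
        case 1
        then show ?thesis using good LA(2)[of \<rho>] \<open>?a + ?FA - 1 \<le> ?a * ?FA\<close> 3 unfolding F[OF r] by linarith
      next
        case 2
        then show ?thesis using bad LW(2)[of \<rho>] \<open>?FW - ?a \<le> (1 - ?a) * ?FW\<close> 3 unfolding F[OF r] by linarith
      next
        case 3
        have "?a * (1 - \<eta> / 2) + (1 - ?a) * (1 - \<eta> / 2) \<le> ?a * ?FA + (1 - ?a) * ?FW"
          using 3 LA(2) LW(2) acc0 acc1 by (intro add_mono mult_left_mono) auto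
        then show ?thesis using \<eta> unfolding F[OF r] by (simp add: algebra_simps)
      qed
    qed
    then show "\<exists>\<Lambda>. locc (2 ^ M) (2 ^ M) (d ^ n) (d ^ n) \<Lambda> \<and>
      (\<forall>\<rho>\<in>{\<rho> \<in> density_operators (d * d). (err \<rho> \<le> e \<and> \<rho> \<in> A) \<or> (e' \<le> err \<rho> \<and> \<rho> \<in> W) \<or> (\<rho> \<in> A \<and> \<rho> \<in> W)}. 1 - \<eta> \<le> fidelity d n M \<Lambda> \<rho>)"
      using L by blast
  qed
qed

text \<open>\<open>distill_power\<close> on \<open>n div m\<close> blocks loses
  \<open>4 * N + 4 * k * (N div p) + 2\<close> pairs. This accounts for \<open>4 / p\<close> and for
  four of the five units in \<open>rate\<close>; the fifth, times \<open>N\<close>, absorbs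
  \<open>R * real m + 2\<close>, where \<open>R * real m\<close> covers the incomplete
  block.\<close>

lemma reaches_hashing:
  assumes G: "locc (2 ^ k) (2 ^ k) (d ^ m) (d ^ m) \<Gamma>" and m: "m > 0" and p: "p > 0" and R: "0 \<le> R"
    and rate: "R * real m + 5 \<le> real k * (1 - 4 / real p)"
  shows "reaches d {\<rho> \<in> density_operators (d * d).
    1 - bit_marginal k (\<Gamma> (bipartite_power d \<rho> m)) 0 \<le> (1 / 4) ^ p \<and>
    1 - phase_marginal k (\<Gamma> (bipartite_power d \<rho> m)) 0 \<le> (1 / 4) ^ p} R"
  unfolding reaches_def
proof (intro allI impI)
  fix \<eta> :: real assume \<eta>: "0 < \<eta>"
  obtain N0 where N0: "(1 / 2 :: real) ^ N0 < \<eta> / 2" using real_arch_pow_inv[of "\<eta> / 2" "1 / 2"] \<eta> by auto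
  obtain N1 where N1: "R * real m + 2 \<le> real N1" using real_arch_simple by blast
  let ?X = "{\<rho> \<in> density_operators (d * d).
    1 - bit_marginal k (\<Gamma> (bipartite_power d \<rho> m)) 0 \<le> (1 / 4) ^ p \<and>
    1 - phase_marginal k (\<Gamma> (bipartite_power d \<rho> m)) 0 \<le> (1 / 4) ^ p}"
  show "\<exists>n0. \<forall>n\<ge>n0. \<forall>M. real M \<le> R * real n \<longrightarrow>
    (\<exists>\<Lambda>. locc (2 ^ M) (2 ^ M) (d ^ n) (d ^ n) \<Lambda> \<and> (\<forall>\<rho>\<in>?X. 1 - \<eta> \<le> fidelity d n M \<Lambda> \<rho>))"
  proof (intro exI[of _ "m * max N0 N1"] allI impI)
    fix n M assume n: "m * max N0 N1 \<le> n" and M: "real M \<le> R * real n"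
    define N where "N = n div m"
    \<comment> \<open>The \<open>q\<close> copies that fill no block form the first tensor factor
      and are discarded by a measurement whose outcome is ignored.\<close>
    define q where "q = n mod m"
    have nq: "n = q + m * N" by (simp add: N_def q_def)
    have "max N0 N1 \<le> N" unfolding N_def using div_le_mono[OF n, of m] m by simp
    then have NN: "N0 \<le> N" "N1 \<le> N" by auto
    have "M + 2 * (2 * N + 2 * (k * (N div p)) + 1) \<le> k * N"
    proof -
      have "real n \<le> real m * (real N + 1)"
      proof -
        have "n \<le> m * N + m" using mod_less_divisor[OF m, of n] unfolding nq q_def[symmetric] by (simp add: q_def)
        then have "real n \<le> real (m * N + m)" by (simp only: of_nat_le_iff)
        then show ?thesis by (simp add: algebra_simps)
      qed
      then have "real M \<le> R * (real m * (real N + 1))" using M mult_left_mono[OF _ R] order_trans by blast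
      then have M1: "real M \<le> R * real m * real N + R * real m" by (simp add: algebra_simps)
      have "real (N div p) * real p \<le> real N" by (metis of_nat_le_iff of_nat_mult div_times_less_eq_dividend)
      then have "real (N div p) \<le> real N / real p" using p by (simp add: field_simps)
      then have t: "real k * real (N div p) \<le> real k * (real N / real p)" by (intro mult_left_mono) auto
      have "(R * real m + 5) * real N \<le> real k * (1 - 4 / real p) * real N" by (rule mult_right_mono[OF rate]) simp
      then have c1: "(R * real m + 5) * real N \<le> real k * real N - 4 * (real k * (real N / real p))" by (simp add: algebra_simps)
      have c2: "R * real m + 2 \<le> real N" using N1 NN by simp
      have c3: "(R * real m + 5) * real N = R * real m * real N + 5 * real N" by (simp add: algebra_simps)
      have "real M + 2 * (2 * real N + 2 * (real k * real (N div p)) + 1) \<le> real k * real N"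
      proof -
        have "x + 2 * (2 * n + 2 * z + 1) \<le> kn" if "b \<le> kn - 4 * y" "rm + 2 \<le> n" "b = a + 5 * n" "x \<le> a + rm" "z \<le> y"
          for x n z kn b y rm a :: real using that by (simp add: algebra_simps)
        from this[OF c1 c2 c3 M1 t] show ?thesis .
      qed
      then have "real (M + 2 * (2 * N + 2 * (k * (N div p)) + 1)) \<le> real (k * N)" by simp
      then show ?thesis by (simp only: of_nat_le_iff)
    qed
    from distill_power[OF p this] obtain D where D: "locc (2 ^ M) (2 ^ M) ((2 ^ k) ^ N) ((2 ^ k) ^ N) D"
      "\<And>\<tau>. psd (2 ^ k * 2 ^ k) \<tau> \<Longrightarrow> mat_trace \<tau> = 1 \<Longrightarrow> 1 - bit_marginal k \<tau> 0 \<le> (1 / 4) ^ p \<Longrightarrow>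
        1 - phase_marginal k \<tau> 0 \<le> (1 / 4) ^ p \<Longrightarrow> 1 - 2 * (1 / 2) ^ N \<le> rbell M (D (bipartite_power (2 ^ k) \<tau> N)) 0 0"
      by blast
    obtain GN where GN: "locc ((2 ^ k) ^ N) ((2 ^ k) ^ N) ((d ^ m) ^ N) ((d ^ m) ^ N) GN"
      "\<And>X. X \<in> carrier_mat (d ^ m * d ^ m) (d ^ m * d ^ m) \<Longrightarrow> GN (bipartite_power (d ^ m) X N) = bipartite_power (2 ^ k) (\<Gamma> X) N"
      using locc_power[OF G] by blast
    obtain H where H: "locc (2 ^ M) (2 ^ M) ((d ^ m) ^ N) ((d ^ m) ^ N) H"
      "\<And>X. X \<in> carrier_mat ((d ^ m) ^ N * (d ^ m) ^ N) ((d ^ m) ^ N * (d ^ m) ^ N) \<Longrightarrow> H X = D (GN X)"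
      using locc_comp[OF GN(1) D(1)] by blast
    obtain L where L: "locc (2 ^ M) (2 ^ M) (d ^ q * (d ^ m) ^ N) (d ^ q * (d ^ m) ^ N) L"
      "\<And>X Y. X \<in> carrier_mat (d ^ q * d ^ q) (d ^ q * d ^ q) \<Longrightarrow> Y \<in> carrier_mat ((d ^ m) ^ N * (d ^ m) ^ N) ((d ^ m) ^ N * (d ^ m) ^ N) \<Longrightarrow>
        L (tensor (d ^ q) (d ^ q) ((d ^ m) ^ N) ((d ^ m) ^ N) X Y) = mat_family_sum (2 ^ M * 2 ^ M) (d ^ q)
          (\<lambda>s. mat_family_sum (2 ^ M * 2 ^ M) (d ^ q) (\<lambda>t. X $$ (s * d ^ q + t, s * d ^ q + t) \<cdot>\<^sub>m H Y))"
      using locc_measure_first[of "d ^ q" "d ^ q" "2 ^ M" "2 ^ M" "(d ^ m) ^ N" "(d ^ m) ^ N" "\<lambda>s t. H", OF H(1)] by blast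
    have dim: "d ^ n = d ^ q * (d ^ m) ^ N" unfolding nq by (simp add: power_add power_mult)
    have "1 - \<eta> \<le> fidelity d n M L \<rho>" if r: "\<rho> \<in> ?X" for \<rho>
    proof -
      have rs: "\<rho> \<in> density_operators (d * d)" using r by simp
      let ?X = "bipartite_power d \<rho> q" and ?Y = "bipartite_power (d ^ m) (bipartite_power d \<rho> m) N"
      have Y: "?Y \<in> carrier_mat ((d ^ m) ^ N * (d ^ m) ^ N) ((d ^ m) ^ N * (d ^ m) ^ N)" by (rule bipartite_power_carrier)
      have "bipartite_power d \<rho> n = tensor (d ^ q) (d ^ q) ((d ^ m) ^ N) ((d ^ m) ^ N) ?X ?Y"
        unfolding nq bipartite_power_add bipartite_power_mult power_mult ..
      then have "bell M (L (bipartite_power d \<rho> n)) 0 0 = (\<Sum>s<d ^ q. \<Sum>t<d ^ q. ?X $$ (s * d ^ q + t, s * d ^ q + t) * bell M (H ?Y) 0 0)"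
        using L(2)[OF bipartite_power_carrier Y] bell_smult[OF locc_carrier[OF H(1) Y], of 0] by (simp add: bell_family_sum)
      also have "\<dots> = mat_trace ?X * bell M (H ?Y) 0 0"
        unfolding mat_trace_eq[OF bipartite_power_carrier] sum_idx sum_distrib_right ..
      also have "\<dots> = bell M (D (bipartite_power (2 ^ k) (\<Gamma> (bipartite_power d \<rho> m)) N)) 0 0"
        using bipartite_power_state(2)[OF rs, of q] H(2)[OF Y] GN(2)[OF bipartite_power_carrier] by simp
      finally have "1 - 2 * (1 / 2) ^ N \<le> fidelity d n M L \<rho>"
        unfolding fidelity_def using D(2)[OF output_state[OF G rs]] r by simp
      moreover have "(1 / 2 :: real) ^ N \<le> (1 / 2) ^ N0" using NN by (intro power_decreasing) auto
      ultimately show ?thesis using N0 by linarith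
    qed
    then show "\<exists>\<Lambda>. locc (2 ^ M) (2 ^ M) (d ^ n) (d ^ n) \<Lambda> \<and> (\<forall>\<rho>\<in>?X. 1 - \<eta> \<le> fidelity d n M \<Lambda> \<rho>)"
      using L(1) unfolding dim by blast
  qed
qed

text \<open>
  A protocol with output close to \<open>k\<close> ebits on \<open>\<rho>\<^sup>m\<close> is still close on nearby states. Testing bit and
  phase errors of its output decides whether to continue with hashing or with the protocol for \<open>W\<close>.
\<close>

lemma reaches_neighbourhood:
  assumes r: "\<rho> \<in> density_operators (d * d)" and R0: "0 \<le> R0" and E: "ereal R0 < distillable_entanglement d \<rho>"
  shows "\<exists>m k \<Gamma> c. locc (2 ^ k) (2 ^ k) (d ^ m) (d ^ m) \<Gamma> \<and> c < fidelity d m k \<Gamma> \<rho> \<and>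
    (\<forall>W\<subseteq>density_operators (d * d). (\<forall>R. 0 \<le> R \<longrightarrow> R < R0 \<longrightarrow> reaches d W R) \<longrightarrow>
      (\<forall>R. 0 \<le> R \<longrightarrow> R < R0 \<longrightarrow> reaches d ({\<sigma> \<in> density_operators (d * d). c < fidelity d m k \<Gamma> \<sigma>} \<union> W) R))"
proof -
  obtain R' L where R': "R0 < R'" and L: "\<And>n. L n \<in> distillation_channels d R' n"
    and lim: "(\<lambda>n. distillation_error d R' n (L n) \<rho>) \<longlonglongrightarrow> 0"
    using E unfolding distillable_entanglement_def less_Sup_iff by auto
  \<comment> \<open>Makes the loss factor \<open>1 - 4 / p\<close> of hashing small enough for
    \<open>R'\<close> to stay above \<open>R0\<close>.\<close>
  obtain p where "4 * R' / (R' - R0) < real p" using reals_Archimedean2 by blast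
  then have p4: "4 * R' < real p * (R' - R0)" using R' by (simp add: field_simps)
  have p0: "p > 0" using p4 R0 R' by (cases p) auto
  have gap: "R0 < R' * (1 - 4 / real p)" using p4 p0 by (simp add: field_simps)
  \<comment> \<open>The upper threshold is the error tolerated by hashing; the lower one,
    \<open>e\<close>, is dictated by \<open>reaches_branch\<close>.\<close>
  define e' where "e' = (1 / 4 :: real) ^ p"
  have e': "0 < e'" "e' \<le> 1" by (auto simp: e'_def power_le_one)
  obtain l where l: "(1 - e' / 2) ^ l < 1 / 4" using real_arch_pow_inv[of "1 / 4" "1 - e' / 2"] e' by auto
  define e where "e = (1 / 2 :: real) ^ Suc l"
  have e0: "0 < e" by (simp add: e_def)
  have "eventually (\<lambda>n. distillation_error d R' n (L n) \<rho> < e / 2) sequentially"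
    using lim e0 by (intro order_tendstoD) auto
  \<comment> \<open>A long block makes the constant \<open>5\<close> in the rate condition
    negligible against the gap times \<open>m\<close>.\<close>
  moreover obtain m0 where "5 / (R' * (1 - 4 / real p) - R0) \<le> real m0" using real_arch_simple by blast
  then have "eventually (\<lambda>n. 5 / (R' * (1 - 4 / real p) - R0) \<le> real n \<and> 0 < n) sequentially"
    by (intro eventually_sequentiallyI[of "max m0 1"]) linarith
  ultimately obtain m where m: "distillation_error d R' m (L m) \<rho> < e / 2" "5 / (R' * (1 - 4 / real p) - R0) \<le> real m" "0 < m"
    using eventually_happens[OF eventually_conj] by fastforce
  define k where "k = qubit_pairs R' m"
  have G: "locc (2 ^ k) (2 ^ k) (d ^ m) (d ^ m) (L m)" using L[of m] by (simp add: distillation_channels_def k_def)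
  have F: "1 - e < fidelity d m k (L m) \<rho>" using fidelity_le_error[OF L r, of m] m(1) by (simp add: k_def)
  have kR: "R' * real m \<le> real k" unfolding k_def qubit_pairs_def by linarith
  have p1: "0 \<le> 1 - 4 / real p" using gap R0 R' by (metis less_eq_real_def linorder_not_less mult_pos_neg order_less_trans order_le_less_trans)
  have rate: "R0 * real m + 5 \<le> real k * (1 - 4 / real p)"
  proof -
    have "R0 * real m + 5 \<le> R' * (1 - 4 / real p) * real m" using m(2) gap by (simp add: field_simps)
    also have "\<dots> \<le> real k * (1 - 4 / real p)" using mult_right_mono[OF kR p1] by (simp add: algebra_simps)
    finally show ?thesis .
  qed
  let ?\<tau> = "\<lambda>\<sigma>. L m (bipartite_power d \<sigma> m)"
  define A where "A = {\<sigma> \<in> density_operators (d * d). 1 - bit_marginal k (?\<tau> \<sigma>) 0 \<le> e' \<and> 1 - phase_marginal k (?\<tau> \<sigma>) 0 \<le> e'}"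
  define U where "U = {\<sigma> \<in> density_operators (d * d). 1 - e < fidelity d m k (L m) \<sigma>}"
  \<comment> \<open>Followed by Hadamard transforms, the protocol shows its phase errors as bit
    errors, so the same test applies to them.\<close>
  obtain H where H: "locc (2 ^ k) (2 ^ k) (d ^ m) (d ^ m) H"
    "\<And>X. X \<in> carrier_mat (d ^ m * d ^ m) (d ^ m * d ^ m) \<Longrightarrow> H X = hadamard_map k (L m X)"
    using locc_map_comp[OF locc_map_locc[OF G] locc_map_hadamard] unfolding locc_map_def by blast
  have Herr: "bit_marginal k (H (bipartite_power d \<sigma> m)) 0 = phase_marginal k (?\<tau> \<sigma>) 0" for \<sigma>
    unfolding H(2)[OF bipartite_power_carrier] by (rule bit_marginal_hadamard)
  have Ue: "1 - bit_marginal k (?\<tau> \<sigma>) 0 \<le> e" "1 - phase_marginal k (?\<tau> \<sigma>) 0 \<le> e" if "\<sigma> \<in> U" for \<sigma>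
    using fidelity_le_marginals[OF output_state(1)[OF G]] that unfolding U_def fidelity_def by force+
  \<comment> \<open>States in \<open>U\<close> must lie in \<open>A\<close>. If
    \<open>e > e'\<close>, Bernoulli's inequality would give \<open>3 / 4 < l * e' / 2\<close>,
    which is at most \<open>2 ^ l * e / 2 = 1 / 4\<close>.\<close>
  have ee': "e \<le> e'"
  proof (rule ccontr)
    assume "\<not> e \<le> e'"
    have "1 - real l * (e' / 2) \<le> (1 - e' / 2) ^ l" using Bernoulli_inequality[of "- (e' / 2)" l] e' by simp
    then have "3 / 4 < real l * (e' / 2)" using l by linarith
    also have "\<dots> \<le> real l * (e / 2)" using \<open>\<not> e \<le> e'\<close> by (intro mult_left_mono) auto
    also have "\<dots> \<le> 2 ^ l * (e / 2)" using of_nat_less_two_power[of l, where 'a = real] e0 by (intro mult_right_mono) auto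
    also have "\<dots> = 1 / 4" by (simp add: e_def power_one_over)
    finally show False by simp
  qed
  have "reaches d (U \<union> W) R" if W: "W \<subseteq> density_operators (d * d)" "\<And>R. 0 \<le> R \<Longrightarrow> R < R0 \<Longrightarrow> reaches d W R" and R: "0 \<le> R" "R < R0" for W R
  proof -
    \<comment> \<open>Hashing runs at rate \<open>R2\<close>; the phase test lowers it to
      \<open>R1\<close> and the bit test to \<open>R\<close>.\<close>
    obtain R1 where R1: "R < R1" "R1 < R0" using dense[OF R(2)] by blast
    obtain R2 where R2: "R1 < R2" "R2 < R0" using dense[OF R1(2)] by blast
    have "real m * R2 \<le> real m * R0" using R2 by (intro mult_left_mono) auto
    then have rate2: "R2 * real m + 5 \<le> real k * (1 - 4 / real p)" using rate by (simp add: mult.commute)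
    have A: "reaches d A R2"
      unfolding A_def e'_def by (rule reaches_hashing[OF G m(3) p0 _ rate2]) (use R R1 R2 in simp)
    have "reaches d {\<sigma> \<in> density_operators (d * d). (1 - phase_marginal k (?\<tau> \<sigma>) 0 \<le> e \<and> \<sigma> \<in> A) \<or>
        (e' \<le> 1 - phase_marginal k (?\<tau> \<sigma>) 0 \<and> \<sigma> \<in> W) \<or> (\<sigma> \<in> A \<and> \<sigma> \<in> W)} R1"
      using reaches_branch[OF A W(2) R2(1) _ H(1) e' _ e_def] R R1 R2 l unfolding Herr by simp
    \<comment> \<open>A state of \<open>W\<close> with bit error at most \<open>e'\<close> is served
      by \<open>W\<close> if its phase error is at least \<open>e'\<close>, and lies in
      \<open>A\<close> as well as in \<open>W\<close> otherwise. The bit test below removes the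
      restriction on the bit error in the same way.\<close>
    then have Q: "reaches d {\<sigma> \<in> U \<union> W. 1 - bit_marginal k (?\<tau> \<sigma>) 0 \<le> e'} R1"
    proof (rule reaches_mono, intro subsetI)
      fix \<sigma> assume s: "\<sigma> \<in> {\<sigma> \<in> U \<union> W. 1 - bit_marginal k (?\<tau> \<sigma>) 0 \<le> e'}"
      then have "\<sigma> \<in> density_operators (d * d)" using W(1) by (auto simp: U_def)
      then show "\<sigma> \<in> {\<sigma> \<in> density_operators (d * d). (1 - phase_marginal k (?\<tau> \<sigma>) 0 \<le> e \<and> \<sigma> \<in> A) \<or>
        (e' \<le> 1 - phase_marginal k (?\<tau> \<sigma>) 0 \<and> \<sigma> \<in> W) \<or> (\<sigma> \<in> A \<and> \<sigma> \<in> W)}"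
        using s Ue[of \<sigma>] ee' by (auto simp: A_def)
    qed
    have "reaches d {\<sigma> \<in> density_operators (d * d).
        (1 - bit_marginal k (?\<tau> \<sigma>) 0 \<le> e \<and> \<sigma> \<in> {\<sigma> \<in> U \<union> W. 1 - bit_marginal k (?\<tau> \<sigma>) 0 \<le> e'}) \<or>
        (e' \<le> 1 - bit_marginal k (?\<tau> \<sigma>) 0 \<and> \<sigma> \<in> W) \<or>
        (\<sigma> \<in> {\<sigma> \<in> U \<union> W. 1 - bit_marginal k (?\<tau> \<sigma>) 0 \<le> e'} \<and> \<sigma> \<in> W)} R"
      using reaches_branch[OF Q W(2) R1(1) R(1) G e' _ e_def] R R1 R2 l by simp
    then show ?thesis
    proof (rule reaches_mono, intro subsetI)
      fix \<sigma> assume s: "\<sigma> \<in> U \<union> W"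
      then have "\<sigma> \<in> density_operators (d * d)" using W(1) by (auto simp: U_def)
      then show "\<sigma> \<in> {\<sigma> \<in> density_operators (d * d).
        (1 - bit_marginal k (?\<tau> \<sigma>) 0 \<le> e \<and> \<sigma> \<in> {\<sigma> \<in> U \<union> W. 1 - bit_marginal k (?\<tau> \<sigma>) 0 \<le> e'}) \<or>
        (e' \<le> 1 - bit_marginal k (?\<tau> \<sigma>) 0 \<and> \<sigma> \<in> W) \<or>
        (\<sigma> \<in> {\<sigma> \<in> U \<union> W. 1 - bit_marginal k (?\<tau> \<sigma>) 0 \<le> e'} \<and> \<sigma> \<in> W)}"
        using s Ue[of \<sigma>] ee' by auto
    qed
  qed
  then show ?thesis using G F unfolding U_def by blast
qed

section \<open>Continuity and compactness\<close>

lemma power_entries_tendsto: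
  assumes "\<And>i j. i < d * d \<Longrightarrow> j < d * d \<Longrightarrow> ((\<lambda>t. A t $$ (i, j)) \<longlongrightarrow> B $$ (i, j)) F"
    and "r < d ^ n * d ^ n" "s < d ^ n * d ^ n"
  shows "((\<lambda>t. bipartite_power d (A t) n $$ (r, s)) \<longlongrightarrow> bipartite_power d B n $$ (r, s)) F"
  using assms(2,3)
proof (induction n arbitrary: r s)
  case (Suc n)
  have rs: "r < (d * d ^ n) * (d * d ^ n)" "s < (d * d ^ n) * (d * d ^ n)" using Suc.prems by simp_all
  obtain i j where 1: "i < d * d ^ n" "j < d * d ^ n" "r = i * (d * d ^ n) + j" using idx_exhaust[OF rs(1)] .
  obtain k l where 2: "k < d * d ^ n" "l < d * d ^ n" "s = k * (d * d ^ n) + l" using idx_exhaust[OF rs(2)] .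
  obtain i1 i2 where i: "i1 < d" "i2 < d ^ n" "i = i1 * d ^ n + i2" using idx_exhaust[OF 1(1)] .
  obtain j1 j2 where j: "j1 < d" "j2 < d ^ n" "j = j1 * d ^ n + j2" using idx_exhaust[OF 1(2)] .
  obtain k1 k2 where k: "k1 < d" "k2 < d ^ n" "k = k1 * d ^ n + k2" using idx_exhaust[OF 2(1)] .
  obtain l1 l2 where l: "l1 < d" "l2 < d ^ n" "l = l1 * d ^ n + l2" using idx_exhaust[OF 2(2)] .
  have e: "bipartite_power d C (Suc n) $$ (r, s) = C $$ (i1 * d + j1, k1 * d + l1) * bipartite_power d C n $$ (i2 * d ^ n + j2, k2 * d ^ n + l2)" for C
    unfolding 1(3) 2(3) i(3) j(3) k(3) l(3) bipartite_power.simps bipartite_tensor_eq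
    using i j k l by (intro tensor_index)
  show ?case unfolding e using i j k l by (intro tendsto_mult assms(1) Suc.IH) simp_all
qed simp

text \<open>For a fixed protocol the fidelity is a linear functional of the input, given by its
  values on the matrix units \<open>E t\<close>. Continuity thus reduces to finitely many entries of
  a tensor power.\<close>

lemma locc_bell_expansion:
  assumes L: "locc (2 ^ M) (2 ^ M) a b \<Lambda>" and X: "X \<in> carrier_mat (a * b) (a * b)"
  defines "E t \<equiv> mat (a * b) (a * b) (\<lambda>p. if p = (t div (a * b), t mod (a * b)) then 1 else 0)"
  shows "bell M (\<Lambda> X) 0 0 = (\<Sum>t<(a * b) * (a * b). X $$ (t div (a * b), t mod (a * b)) * bell M (\<Lambda> (E t)) 0 0)"
proof -
  let ?n = "a * b"
  have E: "E t \<in> carrier_mat ?n ?n" for t by (simp add: E_def)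
  have "X = mat_family_sum ?n (?n * ?n) (\<lambda>t. X $$ (t div ?n, t mod ?n) \<cdot>\<^sub>m E t)"
  proof (rule eq_matI)
    fix i j assume "i < dim_row (mat_family_sum ?n (?n * ?n) (\<lambda>t. X $$ (t div ?n, t mod ?n) \<cdot>\<^sub>m E t))"
      "j < dim_col (mat_family_sum ?n (?n * ?n) (\<lambda>t. X $$ (t div ?n, t mod ?n) \<cdot>\<^sub>m E t))"
    then have ij: "i < ?n" "j < ?n" by auto
    have "(\<Sum>t<?n * ?n. (X $$ (t div ?n, t mod ?n) \<cdot>\<^sub>m E t) $$ (i, j)) = (\<Sum>k<?n. \<Sum>l<?n. if l = j then (if k = i then X $$ (k, l) else 0) else 0)"
      unfolding sum_idx[of _ ?n ?n]
    proof (intro sum.cong refl)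
      fix k l assume "k \<in> {..<?n}" "l \<in> {..<?n}"
      then have "(k * ?n + l) div ?n = k" "(k * ?n + l) mod ?n = l" by (intro idx_div idx_mod; simp)+
      then show "(X $$ ((k * ?n + l) div ?n, (k * ?n + l) mod ?n) \<cdot>\<^sub>m E (k * ?n + l)) $$ (i, j) = (if l = j then (if k = i then X $$ (k, l) else 0) else 0)"
        using ij by (auto simp: E_def)
    qed
    then show "X $$ (i, j) = mat_family_sum ?n (?n * ?n) (\<lambda>t. X $$ (t div ?n, t mod ?n) \<cdot>\<^sub>m E t) $$ (i, j)"
      using ij by simp
  qed (use X in auto)
  then have "\<Lambda> X = mat_family_sum (2 ^ M * 2 ^ M) (?n * ?n) (\<lambda>t. \<Lambda> (X $$ (t div ?n, t mod ?n) \<cdot>\<^sub>m E t))"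
    using superoperator_family_sum[OF locc_linear[OF L], of "?n * ?n" "\<lambda>t. X $$ (t div ?n, t mod ?n) \<cdot>\<^sub>m E t"] E by simp
  also have "\<dots> = mat_family_sum (2 ^ M * 2 ^ M) (?n * ?n) (\<lambda>t. X $$ (t div ?n, t mod ?n) \<cdot>\<^sub>m \<Lambda> (E t))"
    using superoperator_smult[OF locc_linear[OF L] E] by simp
  finally show ?thesis
    using bell_smult[OF locc_carrier[OF L E], of 0] by (simp add: bell_family_sum)
qed

text \<open>The filter is arbitrary because the fact serves both sequences in the closure and
  neighbourhoods in a product topology.\<close>

lemma fidelity_tendsto:
  assumes "\<And>i j. i < d * d \<Longrightarrow> j < d * d \<Longrightarrow> ((\<lambda>t. A t $$ (i, j)) \<longlongrightarrow> B $$ (i, j)) F"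
    and L: "locc (2 ^ M) (2 ^ M) (d ^ n) (d ^ n) \<Lambda>"
  shows "((\<lambda>t. fidelity d n M \<Lambda> (A t)) \<longlongrightarrow> fidelity d n M \<Lambda> B) F"
  unfolding fidelity_def locc_bell_expansion[OF L bipartite_power_carrier]
proof (intro tendsto_Re tendsto_sum tendsto_mult tendsto_const power_entries_tendsto assms(1))
  fix t assume t: "t \<in> {..<d ^ n * d ^ n * (d ^ n * d ^ n)}"
  then show "t div (d ^ n * d ^ n) < d ^ n * d ^ n" by (simp add: less_mult_imp_div_less)
  show "t mod (d ^ n * d ^ n) < d ^ n * d ^ n" using t by (cases "d ^ n * d ^ n = 0") auto
qed

lemma trace_norm_closure_entries:
  assumes r: "\<rho> \<in> trace_norm_closure D X" and X: "X \<subseteq> carrier_mat D D" and e: "0 < \<epsilon>"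
  shows "\<exists>\<sigma>\<in>X. \<forall>i<D. \<forall>j<D. cmod (\<sigma> $$ (i, j) - \<rho> $$ (i, j)) < \<epsilon>"
proof -
  obtain \<sigma> where s: "\<sigma> \<in> X" "trace_norm (\<rho> - \<sigma>) < \<epsilon>" using r e unfolding trace_norm_closure_def by blast
  have "\<sigma> \<in> carrier_mat D D" using s X by blast
  then have "cmod (\<sigma> $$ (i, j) - \<rho> $$ (i, j)) \<le> trace_norm (\<rho> - \<sigma>)" if "i < D" "j < D" for i j
    using entry_le_trace_norm[OF minus_carrier_mat, of \<sigma> D i j \<rho>] that by (simp add: norm_minus_commute)
  then show ?thesis using s by (meson order_le_less_trans)
qed

lemma trace_norm_closureI:
  assumes r: "\<rho> \<in> carrier_mat D D" and X: "X \<subseteq> carrier_mat D D"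
    and close: "\<And>\<epsilon>. 0 < \<epsilon> \<Longrightarrow> \<exists>\<sigma>\<in>X. \<forall>i<D. \<forall>j<D. cmod (\<sigma> $$ (i, j) - \<rho> $$ (i, j)) < \<epsilon>"
  shows "\<rho> \<in> trace_norm_closure D X"
  unfolding trace_norm_closure_def
proof (intro CollectI conjI r allI impI)
  fix \<epsilon> :: real assume e: "0 < \<epsilon>"
  \<comment> \<open>The denominator comes from \<open>trace_norm_le_entries\<close>; the summand
    \<open>1\<close> makes the final inequality strict and covers \<open>D = 0\<close>.\<close>
  define \<delta> where "\<delta> = \<epsilon> / (real D * sqrt (real D) + 1)"
  have c: "0 < real D * sqrt (real D) + 1" by (simp add: add_nonneg_pos)
  then have d: "0 < \<delta>" using e by (simp add: \<delta>_def)
  obtain \<sigma> where s: "\<sigma> \<in> X" "\<And>i j. i < D \<Longrightarrow> j < D \<Longrightarrow> cmod (\<sigma> $$ (i, j) - \<rho> $$ (i, j)) < \<delta>" using close[OF d] by blast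
  have sc: "\<sigma> \<in> carrier_mat D D" using s X by blast
  have "trace_norm (\<rho> - \<sigma>) \<le> real D * (sqrt (real D) * \<delta>)"
  proof (rule trace_norm_le_entries[OF minus_carrier_mat[OF sc]])
    fix i j assume "i < D" "j < D"
    then show "cmod ((\<rho> - \<sigma>) $$ (i, j)) \<le> \<delta>" using s(2)[of i j] sc by (simp add: norm_minus_commute)
  qed (use d in simp)
  also have "\<dots> < (real D * sqrt (real D) + 1) * \<delta>" using d by (simp add: algebra_simps)
  also have "\<dots> = \<epsilon>" using c by (simp add: \<delta>_def)
  finally show "\<exists>\<sigma>\<in>X. trace_norm (\<rho> - \<sigma>) < \<epsilon>" using s(1) by blast
qed

lemma trace_norm_closure_sequence:
  assumes "\<rho> \<in> trace_norm_closure D X" "X \<subseteq> carrier_mat D D"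
  shows "\<exists>\<sigma>. (\<forall>n. \<sigma> n \<in> X) \<and> (\<forall>i<D. \<forall>j<D. (\<lambda>n::nat. \<sigma> n $$ (i, j)) \<longlonglongrightarrow> \<rho> $$ (i, j))"
proof -
  have "\<forall>n. \<exists>\<sigma>\<in>X. \<forall>i<D. \<forall>j<D. cmod (\<sigma> $$ (i, j) - \<rho> $$ (i, j)) < 1 / real (Suc n)"
    using trace_norm_closure_entries[OF assms] by simp
  then obtain \<sigma> where s: "\<And>n. \<sigma> n \<in> X" "\<And>n i j. i < D \<Longrightarrow> j < D \<Longrightarrow> cmod (\<sigma> n $$ (i, j) - \<rho> $$ (i, j)) < 1 / real (Suc n)"
    by metis
  have "(\<lambda>n. \<sigma> n $$ (i, j)) \<longlonglongrightarrow> \<rho> $$ (i, j)" if "i < D" "j < D" for i j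
  proof (rule LIM_zero_cancel, rule tendsto_norm_zero_cancel, rule tendsto_sandwich[OF _ _ tendsto_const LIMSEQ_Suc[OF lim_1_over_n]])
    show "\<forall>\<^sub>F n in sequentially. norm (\<sigma> n $$ (i, j) - \<rho> $$ (i, j)) \<le> 1 / real (Suc n)"
      using s(2)[OF that] by (intro always_eventually allI less_imp_le)
  qed simp
  then show ?thesis using s(1) by blast
qed

lemma trace_norm_closure_density:
  assumes X: "X \<subseteq> density_operators D"
  shows "trace_norm_closure D X \<subseteq> density_operators D" "X \<subseteq> trace_norm_closure D X"
proof -
  have Xc: "X \<subseteq> carrier_mat D D" using X psd_carrier by (auto simp: density_operators_def)
  show "trace_norm_closure D X \<subseteq> density_operators D"
  proof
    fix \<rho> assume r: "\<rho> \<in> trace_norm_closure D X"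
    then have rc: "\<rho> \<in> carrier_mat D D" by (simp add: trace_norm_closure_def)
    obtain \<sigma> where s: "\<And>n. \<sigma> n \<in> X" and lim: "\<And>i j. i < D \<Longrightarrow> j < D \<Longrightarrow> (\<lambda>n. \<sigma> n $$ (i, j)) \<longlonglongrightarrow> \<rho> $$ (i, j)"
      using trace_norm_closure_sequence[OF r Xc] by blast
    have sp: "psd D (\<sigma> n)" "mat_trace (\<sigma> n) = 1" for n using s X by (auto simp: density_operators_def)
    have "0 \<le> sesq D \<rho> v v" for v
    proof -
      have l: "(\<lambda>n. sesq D (\<sigma> n) v v) \<longlonglongrightarrow> sesq D \<rho> v v"
        unfolding sesq_def by (intro tendsto_sum tendsto_mult tendsto_const lim) auto
      have "0 \<le> Re (sesq D \<rho> v v)"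
        using psd_sesq[OF sp(1)] by (intro LIMSEQ_le_const[OF tendsto_Re[OF l]]) (auto simp: complex_nonneg_iff)
      moreover have "(\<lambda>n. Im (sesq D (\<sigma> n) v v)) = (\<lambda>n. 0)" using psd_sesq[OF sp(1)] by (auto simp: complex_nonneg_iff)
      then have "Im (sesq D \<rho> v v) = 0" using tendsto_Im[OF l] by (simp add: LIMSEQ_const_iff)
      ultimately show ?thesis by (simp add: complex_nonneg_iff)
    qed
    moreover have "mat_trace \<rho> = 1"
    proof -
      have "(\<lambda>n. \<Sum>i<D. \<sigma> n $$ (i, i)) \<longlonglongrightarrow> (\<Sum>i<D. \<rho> $$ (i, i))" by (intro tendsto_sum lim) auto
      moreover have "(\<lambda>n. \<Sum>i<D. \<sigma> n $$ (i, i)) = (\<lambda>n. 1)" using sp mat_trace_eq[OF psd_carrier[OF sp(1)]] by simp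
      ultimately show ?thesis using mat_trace_eq[OF rc] by (simp add: LIMSEQ_const_iff)
    qed
    ultimately show "\<rho> \<in> density_operators D" using rc by (simp add: density_operators_def psd_iff)
  qed
  show "X \<subseteq> trace_norm_closure D X"
  proof
    fix \<rho> assume r: "\<rho> \<in> X"
    show "\<rho> \<in> trace_norm_closure D X" by (rule trace_norm_closureI) (use r Xc in \<open>auto intro!: bexI[of _ \<rho>]\<close>)
  qed
qed

lemma density_entry_le_1:
  assumes "\<rho> \<in> density_operators D" "i < D" "j < D"
  shows "cmod (\<rho> $$ (i, j)) \<le> 1"
proof -
  have p: "psd D \<rho>" "mat_trace \<rho> = 1" using assms by (auto simp: density_operators_def)
  have d0: "0 \<le> Re (\<rho> $$ (k, k))" if "k < D" for k using psd_diag[OF p(1) that] by (simp add: complex_nonneg_iff)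
  have "(\<Sum>k<D. Re (\<rho> $$ (k, k))) = 1" using p(2) arg_cong[OF mat_trace_eq[OF psd_carrier[OF p(1)]], of Re] by simp
  then have d1: "Re (\<rho> $$ (k, k)) \<le> 1" if "k < D" for k
    using member_le_sum[of k "{..<D}" "\<lambda>k. Re (\<rho> $$ (k, k))"] d0 that by simp
  have "(cmod (\<rho> $$ (i, j)))\<^sup>2 \<le> 1 * 1"
    using order_trans[OF psd_entry_bound[OF p(1) assms(2,3)] mult_mono[OF d1 d1]] d0 assms by simp
  then show ?thesis using power2_le_imp_le[of "cmod (\<rho> $$ (i, j))" 1] by simp
qed

text \<open>Compactness in the only form required, for sets cut out by a fidelity bound. It is used
  for the uniform protocol and again for the attainment of the minimum.\<close>

lemma closure_finite_subcover:
  assumes X: "X \<subseteq> density_operators (d * d)"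
    and G: "\<And>\<rho>. \<rho> \<in> trace_norm_closure (d * d) X \<Longrightarrow> locc (2 ^ k \<rho>) (2 ^ k \<rho>) (d ^ m \<rho>) (d ^ m \<rho>) (\<Gamma> \<rho>)"
    and c: "\<And>\<rho>. \<rho> \<in> trace_norm_closure (d * d) X \<Longrightarrow> c \<rho> < fidelity d (m \<rho>) (k \<rho>) (\<Gamma> \<rho>) \<rho>"
  shows "\<exists>C. finite C \<and> C \<subseteq> trace_norm_closure (d * d) X \<and>
    (\<forall>\<sigma>\<in>trace_norm_closure (d * d) X. \<exists>\<rho>\<in>C. c \<rho> < fidelity d (m \<rho>) (k \<rho>) (\<Gamma> \<rho>) \<sigma>)"
proof -
  let ?D = "d * d" and ?cl = "trace_norm_closure (d * d) X"
  have Xc: "X \<subseteq> carrier_mat ?D ?D" using X psd_carrier by (auto simp: density_operators_def)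
  \<comment> \<open>Matrices are placed into a product of copies of the complex plane, padded by
    zero, where compactness of products is available.\<close>
  define ent :: "complex mat \<Rightarrow> nat \<times> nat \<Rightarrow> complex" where
    "ent \<rho> = (\<lambda>(i, j). if i < ?D \<and> j < ?D then \<rho> $$ (i, j) else 0)" for \<rho>
  \<comment> \<open>A compact square containing the unit disc, in which all entries of density
    operators lie.\<close>
  define Q where "Q = (\<lambda>p. complex_of_real (fst p) + \<i> * complex_of_real (snd p)) ` ({-1..1} \<times> {-1..1})"
  have Q: "compact Q"
    unfolding Q_def by (intro compact_continuous_image compact_Times compact_Icc continuous_intros)
  have inQ: "z \<in> Q" if "cmod z \<le> 1" for z
  proof -
    have "\<bar>Re z\<bar> \<le> 1" "\<bar>Im z\<bar> \<le> 1" using that abs_Re_le_cmod[of z] abs_Im_le_cmod[of z] by linarith+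
    then have "(Re z, Im z) \<in> {-1..1} \<times> {-1..1}" by auto
    then show ?thesis unfolding Q_def by (rule image_eqI[rotated]) (simp add: complex_eq)
  qed
  define K where "K = PiE UNIV (\<lambda>p :: nat \<times> nat. Q)"
  have "compactin (product_topology (\<lambda>_. euclidean) UNIV) K" unfolding K_def compactin_PiE by (simp add: Q)
  then have K: "compact K" by (simp add: euclidean_product_topology)
  have coord: "continuous_on UNIV (\<lambda>h :: nat \<times> nat \<Rightarrow> complex. h p)" for p by simp
  have mat_ent: "mat ?D ?D (ent \<rho>) = \<rho>" if "\<rho> \<in> ?cl" for \<rho>
    by (rule eq_matI) (use that in \<open>auto simp: trace_norm_closure_def ent_def\<close>)
  \<comment> \<open>A limit point vanishes outside the index range, and finitely many entries of it
    can be approximated at once by a member of \<open>X\<close>, via an intermediate member of the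
    closure.\<close>
  have "closed (ent ` ?cl)"
  proof -
    have "closure (ent ` ?cl) \<subseteq> ent ` ?cl"
    proof
      fix h assume h: "h \<in> closure (ent ` ?cl)"
      have "closed {h' :: nat \<times> nat \<Rightarrow> complex. h' p = 0}" for p
        by (rule closed_Collect_eq[OF coord continuous_on_const])
      then have "closure (ent ` ?cl) \<subseteq> {h'. h' p = 0}" if "\<not> (fst p < ?D \<and> snd p < ?D)" for p
        by (rule closure_minimal[rotated]) (use that in \<open>auto simp: ent_def split: prod.splits\<close>)
      then have zero: "h p = 0" if "\<not> (fst p < ?D \<and> snd p < ?D)" for p using h that by blast
      let ?r = "mat ?D ?D h"
      have "ent ?r = h" using zero by (auto simp: ent_def fun_eq_iff)
      moreover have "?r \<in> ?cl"
      proof (rule trace_norm_closureI[OF _ Xc])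
        fix \<epsilon> :: real assume e: "0 < \<epsilon>"
        define O' where "O' = (\<Inter>p\<in>{..<?D} \<times> {..<?D}. {h' :: nat \<times> nat \<Rightarrow> complex. dist (h' p) (h p) < \<epsilon> / 2})"
        have "open O'" unfolding O'_def by (intro open_INT finite_cartesian_product ballI open_Collect_less continuous_on_dist coord continuous_on_const) auto
        moreover have "h \<in> O'" using e by (auto simp: O'_def)
        ultimately have "O' \<inter> ent ` ?cl \<noteq> {}" using h open_Int_closure_eq_empty by blast
        then obtain \<rho> where r: "\<rho> \<in> ?cl" "ent \<rho> \<in> O'" by blast
        obtain \<sigma> where s: "\<sigma> \<in> X" "\<And>i j. i < ?D \<Longrightarrow> j < ?D \<Longrightarrow> cmod (\<sigma> $$ (i, j) - \<rho> $$ (i, j)) < \<epsilon> / 2"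
          using trace_norm_closure_entries[OF r(1) Xc, of "\<epsilon> / 2"] e by auto
        have "cmod (\<sigma> $$ (i, j) - ?r $$ (i, j)) < \<epsilon>" if "i < ?D" "j < ?D" for i j
        proof -
          have "cmod (\<rho> $$ (i, j) - h (i, j)) < \<epsilon> / 2" using r(2) that by (auto simp: O'_def ent_def dist_norm)
          then have "cmod ((\<sigma> $$ (i, j) - \<rho> $$ (i, j)) + (\<rho> $$ (i, j) - h (i, j))) < \<epsilon> / 2 + \<epsilon> / 2"
            using s(2)[OF that] by (intro norm_triangle_lt add_strict_mono)
          then show ?thesis using that by simp
        qed
        then show "\<exists>\<sigma>\<in>X. \<forall>i<?D. \<forall>j<?D. cmod (\<sigma> $$ (i, j) - ?r $$ (i, j)) < \<epsilon>" using s(1) by blast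
      qed simp
      ultimately show "h \<in> ent ` ?cl" by (metis imageI)
    qed
    then show ?thesis by (metis closed_closure closure_subset subset_antisym)
  qed
  moreover have "ent ` ?cl \<subseteq> K"
    using density_entry_le_1 trace_norm_closure_density(1)[OF X] by (auto simp: K_def ent_def intro!: inQ)
  ultimately have comp: "compact (ent ` ?cl)" using compact_Int_closed[OF K] by (metis inf.absorb_iff2)
  define B where "B \<rho> = {h. c \<rho> < fidelity d (m \<rho>) (k \<rho>) (\<Gamma> \<rho>) (mat ?D ?D h)}" for \<rho>
  have "open (B \<rho>)" if r: "\<rho> \<in> ?cl" for \<rho>
  proof -
    have "continuous_on UNIV (\<lambda>h. fidelity d (m \<rho>) (k \<rho>) (\<Gamma> \<rho>) (mat ?D ?D h))"
      unfolding continuous_on_def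
    proof (intro ballI fidelity_tendsto[OF _ G[OF r]])
      fix h :: "nat \<times> nat \<Rightarrow> complex" and i j assume ij: "i < ?D" "j < ?D"
      have "((\<lambda>h. h (i, j)) \<longlongrightarrow> h (i, j)) (at h within UNIV)" using coord[of "(i, j)"] by (simp only: continuous_on_def) simp
      then show "((\<lambda>h. mat ?D ?D h $$ (i, j)) \<longlongrightarrow> mat ?D ?D h $$ (i, j)) (at h within UNIV)" using ij by simp
    qed
    then show ?thesis unfolding B_def by (rule open_Collect_less[OF continuous_on_const])
  qed
  moreover have "ent ` ?cl \<subseteq> (\<Union>\<rho>\<in>?cl. B \<rho>)" using c mat_ent by (auto simp: B_def)
  ultimately obtain C where C: "C \<subseteq> ?cl" "finite C" "ent ` ?cl \<subseteq> (\<Union>\<rho>\<in>C. B \<rho>)"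
    using compactE_image[OF comp, of ?cl B] by blast
  have "\<exists>\<rho>\<in>C. c \<rho> < fidelity d (m \<rho>) (k \<rho>) (\<Gamma> \<rho>) \<sigma>" if "\<sigma> \<in> ?cl" for \<sigma>
    using C(3) that mat_ent[OF that] by (force simp: B_def)
  then show ?thesis using C by blast
qed

section \<open>The universal distillable entanglement\<close>

text \<open>The channels in the hypothesis may depend on \<open>\<eta>\<close>. Taking for each
  \<open>n\<close> a channel within \<open>1 / Suc n\<close> of the best fidelity yields a single
  sequence that works for all \<open>\<eta>\<close>.\<close>

lemma distillable_entanglement_ge:
  assumes r: "\<rho> \<in> density_operators (d * d)" and R: "0 \<le> R"
    and ev: "\<And>\<eta>. 0 < \<eta> \<Longrightarrow> \<forall>\<^sub>F n in sequentially. \<exists>\<Lambda>\<in>distillation_channels d R n. 1 - \<eta> \<le> fidelity d n (qubit_pairs R n) \<Lambda> \<rho>"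
  shows "ereal R \<le> distillable_entanglement d \<rho>"
proof -
  let ?F = "\<lambda>n. (\<lambda>\<Lambda>. fidelity d n (qubit_pairs R n) \<Lambda> \<rho>) ` distillation_channels d R n"
  have bdd: "bdd_above (?F n)" for n
    using fidelity_bounds(2)[OF _ r] by (intro bdd_aboveI[of _ 1]) (auto simp: distillation_channels_def)
  have "\<exists>\<Lambda>\<in>distillation_channels d R n. Sup (?F n) - 1 / real (Suc n) < fidelity d n (qubit_pairs R n) \<Lambda> \<rho>" for n
  proof -
    have "?F n \<noteq> {}" using locc_exists[of "2 ^ qubit_pairs R n" "2 ^ qubit_pairs R n" "d ^ n" "d ^ n"] by (auto simp: distillation_channels_def)
    moreover have "Sup (?F n) - 1 / real (Suc n) < Sup (?F n)" by simp
    ultimately obtain y where "y \<in> ?F n" "Sup (?F n) - 1 / real (Suc n) < y" by (elim less_cSupE)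
    then show ?thesis by blast
  qed
  then obtain L where L: "\<And>n. L n \<in> distillation_channels d R n"
    and best: "\<And>n. Sup (?F n) - 1 / real (Suc n) < fidelity d n (qubit_pairs R n) (L n) \<rho>" by metis
  have "(\<lambda>n. distillation_error d R n (L n) \<rho>) \<longlonglongrightarrow> 0"
  proof (rule order_tendstoI)
    fix a :: real assume "a < 0"
    then show "\<forall>\<^sub>F n in sequentially. a < distillation_error d R n (L n) \<rho>"
      using error_nonneg by (intro always_eventually allI) (meson order_less_le_trans)
  next
    fix a :: real assume a: "0 < a"
    define t where "t = min 1 (a / 4)"
    have t: "0 < t" "t \<le> 1" "2 * t < a" using a by (auto simp: t_def)
    have t2: "0 < t\<^sup>2 / 2" using t by simp
    have "\<forall>\<^sub>F n in sequentially. 1 / real (Suc n) < t\<^sup>2 / 2"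
      using LIMSEQ_Suc[OF lim_1_over_n] t2 by (intro order_tendstoD) auto
    with ev[OF t2] show "\<forall>\<^sub>F n in sequentially. distillation_error d R n (L n) \<rho> < a"
    proof eventually_elim
      case (elim n)
      then obtain \<Lambda> where "\<Lambda> \<in> distillation_channels d R n" "1 - t\<^sup>2 / 2 \<le> fidelity d n (qubit_pairs R n) \<Lambda> \<rho>" by blast
      then have "1 - t\<^sup>2 / 2 \<le> Sup (?F n)" using cSup_upper[OF _ bdd[of n]] by (meson imageI order_trans)
      then have "1 - fidelity d n (qubit_pairs R n) (L n) \<rho> \<le> t\<^sup>2" using best[of n] elim(2) by linarith
      from error_le_fidelity[OF L r this t(1)] have "distillation_error d R n (L n) \<rho> \<le> t\<^sup>2 + t" .
      also have "\<dots> \<le> 2 * t" using t by (simp add: power2_eq_square mult_left_le)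
      finally show ?case using t(3) by simp
    qed
  qed
  then show ?thesis unfolding distillable_entanglement_def using L R by (intro Sup_upper imageI) blast
qed

lemma universal_distillable_entanglement_ge:
  assumes X: "X \<subseteq> density_operators (d * d)" "X \<noteq> {}" and R: "0 \<le> R"
    and ev: "\<And>\<eta>. 0 < \<eta> \<Longrightarrow> \<forall>\<^sub>F n in sequentially. \<exists>\<Lambda>\<in>distillation_channels d R n. \<forall>\<rho>\<in>X. 1 - \<eta> \<le> fidelity d n (qubit_pairs R n) \<Lambda> \<rho>"
  shows "ereal R \<le> universal_distillable_entanglement d X"
proof -
  let ?I = "\<lambda>n. INF \<Lambda>\<in>distillation_channels d R n. SUP \<rho>\<in>X. ereal (distillation_error d R n \<Lambda> \<rho>)"
  have "?I \<longlonglongrightarrow> 0"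
  proof (rule order_tendstoI)
    fix a :: ereal assume a: "a < 0"
    \<comment> \<open>A member of \<open>X\<close> keeps the supremum nonnegative; over an empty
      family it would be minus infinity in the extended reals.\<close>
    obtain \<rho> where r: "\<rho> \<in> X" using X by blast
    have "0 \<le> ?I n" for n
    proof (rule INF_greatest)
      fix \<Lambda>
      have "0 \<le> ereal (distillation_error d R n \<Lambda> \<rho>)" using error_nonneg by simp
      also have "\<dots> \<le> (SUP \<rho>\<in>X. ereal (distillation_error d R n \<Lambda> \<rho>))" by (rule SUP_upper[OF r])
      finally show "0 \<le> (SUP \<rho>\<in>X. ereal (distillation_error d R n \<Lambda> \<rho>))" .
    qed
    then show "\<forall>\<^sub>F n in sequentially. a < ?I n" using a by (intro always_eventually allI) (meson order_less_le_trans)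
  next
    fix a :: ereal assume a: "0 < a"
    obtain b where b: "0 < b" "ereal b < a" using a by (metis ereal_dense2 ereal_less(2) zero_ereal_def)
    define t where "t = min 1 (b / 4)"
    have t: "0 < t" "t \<le> 1" "2 * t \<le> b" using b by (auto simp: t_def)
    have t2: "0 < t\<^sup>2" using t by simp
    show "\<forall>\<^sub>F n in sequentially. ?I n < a"
      using ev[OF t2]
    proof eventually_elim
      case (elim n)
      then obtain \<Lambda> where L: "\<Lambda> \<in> distillation_channels d R n" "\<And>\<rho>. \<rho> \<in> X \<Longrightarrow> 1 - t\<^sup>2 \<le> fidelity d n (qubit_pairs R n) \<Lambda> \<rho>" by blast
      have "?I n \<le> (SUP \<rho>\<in>X. ereal (distillation_error d R n \<Lambda> \<rho>))" by (rule INF_lower[OF L(1)])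
      also have "\<dots> \<le> ereal b"
      proof (rule SUP_least)
        fix \<rho> assume r: "\<rho> \<in> X"
        have "distillation_error d R n \<Lambda> \<rho> \<le> t\<^sup>2 + t"
          by (rule error_le_fidelity[OF L(1) _ _ t(1)]) (use L(2)[OF r] r X(1) in auto)
        also have "\<dots> \<le> 2 * t" using t by (simp add: power2_eq_square mult_left_le)
        finally show "ereal (distillation_error d R n \<Lambda> \<rho>) \<le> ereal b" using t(3) by simp
      qed
      finally show ?case using b(2) by simp
    qed
  qed
  then show ?thesis unfolding universal_distillable_entanglement_def using R by (intro Sup_upper imageI) blast
qed

text \<open>The ceiling adds at most one pair, which the gap \<open>R - R'\<close> pays for once
  \<open>n\<close> is large.\<close>

lemma reaches_eventually:
  assumes "reaches d X R" "0 \<le> R'" "R' < R" "0 < \<eta>"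
  shows "\<forall>\<^sub>F n in sequentially. \<exists>\<Lambda>\<in>distillation_channels d R' n. \<forall>\<rho>\<in>X. 1 - \<eta> \<le> fidelity d n (qubit_pairs R' n) \<Lambda> \<rho>"
proof -
  obtain n0 where n0: "\<And>n M. n0 \<le> n \<Longrightarrow> real M \<le> R * real n \<Longrightarrow>
    \<exists>\<Lambda>. locc (2 ^ M) (2 ^ M) (d ^ n) (d ^ n) \<Lambda> \<and> (\<forall>\<rho>\<in>X. 1 - \<eta> \<le> fidelity d n M \<Lambda> \<rho>)"
    using assms(1,4) unfolding reaches_def by meson
  obtain n1 where n1: "1 / (R - R') \<le> real n1" using real_arch_simple by blast
  show ?thesis
  proof (rule eventually_sequentiallyI[of "max n0 n1"])
    fix n assume n: "max n0 n1 \<le> n"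
    have "1 \<le> (R - R') * real n1" using n1 assms(3) by (simp add: field_simps)
    also have "\<dots> \<le> (R - R') * real n" using n assms(3) by (intro mult_left_mono) auto
    finally have "R' * real n + 1 \<le> R * real n" by (simp add: algebra_simps)
    moreover have "real (qubit_pairs R' n) \<le> R' * real n + 1"
      using assms(2) unfolding qubit_pairs_def by simp
    ultimately have "real (qubit_pairs R' n) \<le> R * real n" by linarith
    then show "\<exists>\<Lambda>\<in>distillation_channels d R' n. \<forall>\<rho>\<in>X. 1 - \<eta> \<le> fidelity d n (qubit_pairs R' n) \<Lambda> \<rho>"
      using n0[of n "qubit_pairs R' n"] n by (auto simp: distillation_channels_def)
  qed
qed

lemma zero_eventually:
  assumes "X \<subseteq> density_operators (d * d)" "0 < \<eta>"
  shows "\<forall>\<^sub>F n in sequentially. \<exists>\<Lambda>\<in>distillation_channels d 0 n. \<forall>\<rho>\<in>X. 1 - \<eta> \<le> fidelity d n (qubit_pairs 0 n) \<Lambda> \<rho>"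
proof (intro always_eventually allI)
  fix n
  obtain \<Lambda> where "locc (2 ^ 0) (2 ^ 0) (d ^ n) (d ^ n) \<Lambda>" using locc_exists[of "2 ^ 0" "2 ^ 0"] by auto
  then show "\<exists>\<Lambda>\<in>distillation_channels d 0 n. \<forall>\<rho>\<in>X. 1 - \<eta> \<le> fidelity d n (qubit_pairs 0 n) \<Lambda> \<rho>"
    using fidelity_zero[of d n \<Lambda>] assms by (intro bexI[of _ \<Lambda>]) (auto simp: distillation_channels_def qubit_pairs_def)
qed

text \<open>The approximating states vary while \<open>n\<close> and the channel stay fixed, so the
  uniform bound survives the limit before \<open>n\<close> grows.\<close>

lemma universal_le_closure:
  assumes X: "X \<subseteq> density_operators (d * d)" and r: "\<rho> \<in> trace_norm_closure (d * d) X"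
  shows "universal_distillable_entanglement d X \<le> distillable_entanglement d \<rho>"
  unfolding universal_distillable_entanglement_def
proof (rule Sup_least, clarify)
  fix R :: real assume R: "0 \<le> R"
    and lim: "(\<lambda>n. INF \<Lambda>\<in>distillation_channels d R n. SUP \<rho>\<in>X. ereal (distillation_error d R n \<Lambda> \<rho>)) \<longlonglongrightarrow> 0"
  have Xc: "X \<subseteq> carrier_mat (d * d) (d * d)" using X psd_carrier by (auto simp: density_operators_def)
  obtain \<sigma> where s: "\<And>n. \<sigma> n \<in> X" and conv: "\<And>i j. i < d * d \<Longrightarrow> j < d * d \<Longrightarrow> (\<lambda>n. \<sigma> n $$ (i, j)) \<longlonglongrightarrow> \<rho> $$ (i, j)"
    using trace_norm_closure_sequence[OF r Xc] by blast
  show "ereal R \<le> distillable_entanglement d \<rho>"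
  proof (rule distillable_entanglement_ge[OF _ R])
    show "\<rho> \<in> density_operators (d * d)" using trace_norm_closure_density(1)[OF X] r by blast
    fix \<eta> :: real assume "0 < \<eta>"
    then have "\<forall>\<^sub>F n in sequentially. (INF \<Lambda>\<in>distillation_channels d R n. SUP \<rho>\<in>X. ereal (distillation_error d R n \<Lambda> \<rho>)) < ereal (\<eta> / 2)"
      using lim by (intro order_tendstoD) auto
    then show "\<forall>\<^sub>F n in sequentially. \<exists>\<Lambda>\<in>distillation_channels d R n. 1 - \<eta> \<le> fidelity d n (qubit_pairs R n) \<Lambda> \<rho>"
    proof eventually_elim
      case (elim n)
      then obtain \<Lambda> where L: "\<Lambda> \<in> distillation_channels d R n" "(SUP \<rho>\<in>X. ereal (distillation_error d R n \<Lambda> \<rho>)) < ereal (\<eta> / 2)"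
        unfolding INF_less_iff by blast
      have "1 - \<eta> \<le> fidelity d n (qubit_pairs R n) \<Lambda> (\<sigma> j)" for j
      proof -
        have "ereal (distillation_error d R n \<Lambda> (\<sigma> j)) < ereal (\<eta> / 2)"
          using SUP_upper[OF s[of j], of "\<lambda>\<rho>. ereal (distillation_error d R n \<Lambda> \<rho>)"] L(2) by (rule order_le_less_trans)
        then have "distillation_error d R n \<Lambda> (\<sigma> j) < \<eta> / 2" by simp
        moreover have "\<sigma> j \<in> density_operators (d * d)" using s X by blast
        ultimately show ?thesis using fidelity_le_error[OF L(1), of "\<sigma> j"] by simp
      qed
      moreover have "(\<lambda>j. fidelity d n (qubit_pairs R n) \<Lambda> (\<sigma> j)) \<longlonglongrightarrow> fidelity d n (qubit_pairs R n) \<Lambda> \<rho>"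
        using L(1) by (intro fidelity_tendsto conv) (simp_all add: distillation_channels_def)
      ultimately have "1 - \<eta> \<le> fidelity d n (qubit_pairs R n) \<Lambda> \<rho>" by (intro LIMSEQ_le_const) auto
      then show ?case using L(1) by blast
    qed
  qed
qed

text \<open>The sets of a finite cover are adjoined one at a time, the union so far playing the role
  of \<open>W\<close> in \<open>reaches_neighbourhood\<close>. Carrying all rates below
  \<open>R0\<close> through the induction keeps the losses of the tests from accumulating.\<close>

lemma reaches_closure:
  assumes X: "X \<subseteq> density_operators (d * d)" and R0: "0 \<le> R0"
    and E: "\<And>\<rho>. \<rho> \<in> trace_norm_closure (d * d) X \<Longrightarrow> ereal R0 < distillable_entanglement d \<rho>"
    and R: "0 \<le> R" "R < R0"
  shows "reaches d (trace_norm_closure (d * d) X) R"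
proof -
  let ?cl = "trace_norm_closure (d * d) X"
  note dens = trace_norm_closure_density(1)[OF X]
  define P where "P \<rho> m k \<Gamma> c \<longleftrightarrow> locc (2 ^ k) (2 ^ k) (d ^ m) (d ^ m) \<Gamma> \<and> c < fidelity d m k \<Gamma> \<rho> \<and>
    (\<forall>W\<subseteq>density_operators (d * d). (\<forall>R. 0 \<le> R \<longrightarrow> R < R0 \<longrightarrow> reaches d W R) \<longrightarrow>
      (\<forall>R. 0 \<le> R \<longrightarrow> R < R0 \<longrightarrow> reaches d ({\<sigma> \<in> density_operators (d * d). c < fidelity d m k \<Gamma> \<sigma>} \<union> W) R))"
    for \<rho> m k \<Gamma> c
  have "\<exists>m k \<Gamma> c. P \<rho> m k \<Gamma> c" if "\<rho> \<in> ?cl" for \<rho>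
    unfolding P_def by (rule reaches_neighbourhood[OF subsetD[OF dens that] R0 E[OF that]])
  then obtain m k \<Gamma> c where P: "\<And>\<rho>. \<rho> \<in> ?cl \<Longrightarrow> P \<rho> (m \<rho>) (k \<rho>) (\<Gamma> \<rho>) (c \<rho>)" by metis
  have G: "locc (2 ^ k \<rho>) (2 ^ k \<rho>) (d ^ m \<rho>) (d ^ m \<rho>) (\<Gamma> \<rho>)"
    and c: "c \<rho> < fidelity d (m \<rho>) (k \<rho>) (\<Gamma> \<rho>) \<rho>" if "\<rho> \<in> ?cl" for \<rho>
    using P[OF that] by (simp_all add: P_def)
  have ext: "reaches d ({\<sigma> \<in> density_operators (d * d). c \<rho> < fidelity d (m \<rho>) (k \<rho>) (\<Gamma> \<rho>) \<sigma>} \<union> W) R"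
    if "\<rho> \<in> ?cl" "W \<subseteq> density_operators (d * d)" "\<And>R. 0 \<le> R \<Longrightarrow> R < R0 \<Longrightarrow> reaches d W R" "0 \<le> R" "R < R0" for \<rho> W R
    using P[OF that(1)] that(2-5) by (simp add: P_def)
  obtain C where C: "finite C" "C \<subseteq> ?cl" "\<And>\<sigma>. \<sigma> \<in> ?cl \<Longrightarrow> \<exists>\<rho>\<in>C. c \<rho> < fidelity d (m \<rho>) (k \<rho>) (\<Gamma> \<rho>) \<sigma>"
    using closure_finite_subcover[OF X G c] by blast
  let ?U = "\<lambda>\<rho>. {\<sigma> \<in> density_operators (d * d). c \<rho> < fidelity d (m \<rho>) (k \<rho>) (\<Gamma> \<rho>) \<sigma>}"
  have "\<forall>R. 0 \<le> R \<longrightarrow> R < R0 \<longrightarrow> reaches d (\<Union>\<rho>\<in>C. ?U \<rho>) R"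
    using C(1,2)
  proof (induction rule: finite_induct)
    case empty
    show ?case by (simp add: reaches_empty)
  next
    case (insert \<rho> C)
    then have IH: "reaches d (\<Union>\<rho>\<in>C. ?U \<rho>) R" if "0 \<le> R" "R < R0" for R using that by blast
    have "reaches d (?U \<rho> \<union> (\<Union>\<rho>\<in>C. ?U \<rho>)) R" if "0 \<le> R" "R < R0" for R
      by (rule ext[OF _ _ IH that]) (use insert.prems in auto)
    then show ?case by simp
  qed
  then have "reaches d (\<Union>\<rho>\<in>C. ?U \<rho>) R" using R by blast
  then show ?thesis by (rule reaches_mono) (use C(3) dens in blast)
qed

text \<open>The case \<open>W = {}\<close> of \<open>reaches_neighbourhood\<close>: all rates below
  \<open>R0\<close> are reached on the neighbourhood, which gives the non-strict bound
  there.\<close>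

lemma distillable_entanglement_lsc:
  assumes r: "\<rho> \<in> density_operators (d * d)" and R0: "0 \<le> R0" and E: "ereal R0 < distillable_entanglement d \<rho>"
  shows "\<exists>m k \<Gamma> c. locc (2 ^ k) (2 ^ k) (d ^ m) (d ^ m) \<Gamma> \<and> c < fidelity d m k \<Gamma> \<rho> \<and>
    (\<forall>\<sigma>\<in>density_operators (d * d). c < fidelity d m k \<Gamma> \<sigma> \<longrightarrow> ereal R0 \<le> distillable_entanglement d \<sigma>)"
proof -
  obtain m k \<Gamma> c where G: "locc (2 ^ k) (2 ^ k) (d ^ m) (d ^ m) \<Gamma>" "c < fidelity d m k \<Gamma> \<rho>"
    and "\<forall>W\<subseteq>density_operators (d * d). (\<forall>R. 0 \<le> R \<longrightarrow> R < R0 \<longrightarrow> reaches d W R) \<longrightarrow>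
      (\<forall>R. 0 \<le> R \<longrightarrow> R < R0 \<longrightarrow> reaches d ({\<sigma> \<in> density_operators (d * d). c < fidelity d m k \<Gamma> \<sigma>} \<union> W) R)"
    using reaches_neighbourhood[OF assms] by (elim exE conjE) (rule that)
  from this(3)[rule_format, of "{}"]
  have ext: "reaches d {\<sigma> \<in> density_operators (d * d). c < fidelity d m k \<Gamma> \<sigma>} R" if "0 \<le> R" "R < R0" for R
    using reaches_empty that by simp
  have "ereal R0 \<le> distillable_entanglement d \<sigma>" if s: "\<sigma> \<in> density_operators (d * d)" "c < fidelity d m k \<Gamma> \<sigma>" for \<sigma>
  proof (rule ccontr)
    assume n: "\<not> ereal R0 \<le> distillable_entanglement d \<sigma>"
    have "ereal 0 \<le> distillable_entanglement d \<sigma>"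
      by (rule distillable_entanglement_ge[OF s(1)]) (use zero_eventually[of "{\<sigma>}"] s(1) in auto)
    moreover obtain R1 where R1: "distillable_entanglement d \<sigma> < ereal R1" "ereal R1 < ereal R0"
      using n ereal_dense2 by (metis not_le)
    ultimately have R1': "0 \<le> R1" "R1 < R0" by (auto dest: order_le_less_trans)
    obtain R2 where R2: "R1 < R2" "R2 < R0" using dense[OF R1'(2)] by blast
    have "reaches d {\<sigma>} R2" by (rule reaches_mono[OF ext]) (use R1' R2 s in auto)
    then have "ereal R1 \<le> distillable_entanglement d \<sigma>"
      using reaches_eventually[OF _ R1'(1) R2(1)] by (intro distillable_entanglement_ge[OF s(1) R1'(1)]) force
    then show False using R1(1) by simp
  qed
  then show ?thesis using G by blast
qed

theorem theorem4:
  fixes d :: nat and X :: "complex mat set"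
  assumes "d \<ge> 2" and "X \<noteq> {}" and "X \<subseteq> density_operators (d * d)"
  shows "\<exists>\<rho> \<in> trace_norm_closure (d * d) X.
    (\<forall>\<sigma> \<in> trace_norm_closure (d * d) X.
      distillable_entanglement d \<rho> \<le> distillable_entanglement d \<sigma>) \<and>
    universal_distillable_entanglement d X = distillable_entanglement d \<rho>"
proof -
  let ?cl = "trace_norm_closure (d * d) X" and ?E = "distillable_entanglement d"
  note dens = trace_norm_closure_density[OF assms(3)]
  define g where "g = (INF \<rho>\<in>?cl. ?E \<rho>)"
  have g_le: "g \<le> ?E \<rho>" if "\<rho> \<in> ?cl" for \<rho> unfolding g_def by (rule INF_lower[OF that])
  have E0: "ereal 0 \<le> ?E \<rho>" if "\<rho> \<in> ?cl" for \<rho>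
  proof (rule distillable_entanglement_ge)
    show "\<rho> \<in> density_operators (d * d)" using that dens by blast
    then show "\<forall>\<^sub>F n in sequentially. \<exists>\<Lambda>\<in>distillation_channels d 0 n. 1 - \<eta> \<le> fidelity d n (qubit_pairs 0 n) \<Lambda> \<rho>" if "0 < \<eta>" for \<eta>
      using zero_eventually[of "{\<rho>}" d \<eta>] that by simp
  qed simp
  have g0: "0 \<le> g" unfolding g_def using E0 by (intro INF_greatest) (simp add: zero_ereal_def)
  have "\<exists>\<rho>\<in>?cl. ?E \<rho> = g"
  proof (rule ccontr)
    assume "\<not> ?thesis"
    then have lt: "g < ?E \<rho>" if "\<rho> \<in> ?cl" for \<rho> using g_le[OF that] that by (metis order_less_le)
    \<comment> \<open>If the infimum is missed everywhere, semicontinuity gives each point a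
      neighbourhood with its own bound \<open>R\<close> strictly above \<open>g\<close>. The minimum
      of finitely many such bounds is then a lower bound exceeding the infimum.\<close>
    have "\<forall>\<rho>\<in>?cl. \<exists>R m k \<Gamma> c. g < ereal R \<and> locc (2 ^ k) (2 ^ k) (d ^ m) (d ^ m) \<Gamma> \<and> c < fidelity d m k \<Gamma> \<rho> \<and>
      (\<forall>\<sigma>\<in>density_operators (d * d). c < fidelity d m k \<Gamma> \<sigma> \<longrightarrow> ereal R \<le> ?E \<sigma>)"
    proof
      fix \<rho> assume r: "\<rho> \<in> ?cl"
      obtain R where R: "g < ereal R" "ereal R < ?E \<rho>" using ereal_dense2[OF lt[OF r]] by blast
      have "0 \<le> R" using order_le_less_trans[OF g0 R(1)] by simp
      then show "\<exists>R m k \<Gamma> c. g < ereal R \<and> locc (2 ^ k) (2 ^ k) (d ^ m) (d ^ m) \<Gamma> \<and> c < fidelity d m k \<Gamma> \<rho> \<and>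
        (\<forall>\<sigma>\<in>density_operators (d * d). c < fidelity d m k \<Gamma> \<sigma> \<longrightarrow> ereal R \<le> ?E \<sigma>)"
        using distillable_entanglement_lsc[OF _ _ R(2)] R(1) r dens by blast
    qed
    then obtain R m k \<Gamma> c where R: "\<And>\<rho>. \<rho> \<in> ?cl \<Longrightarrow> g < ereal (R \<rho>)"
      and G: "\<And>\<rho>. \<rho> \<in> ?cl \<Longrightarrow> locc (2 ^ k \<rho>) (2 ^ k \<rho>) (d ^ m \<rho>) (d ^ m \<rho>) (\<Gamma> \<rho>)"
      and c: "\<And>\<rho>. \<rho> \<in> ?cl \<Longrightarrow> c \<rho> < fidelity d (m \<rho>) (k \<rho>) (\<Gamma> \<rho>) \<rho>"
      and E: "\<And>\<rho> \<sigma>. \<rho> \<in> ?cl \<Longrightarrow> \<sigma> \<in> density_operators (d * d) \<Longrightarrow> c \<rho> < fidelity d (m \<rho>) (k \<rho>) (\<Gamma> \<rho>) \<sigma> \<Longrightarrow> ereal (R \<rho>) \<le> ?E \<sigma>"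
      by metis
    obtain C where C: "finite C" "C \<subseteq> ?cl" "\<And>\<sigma>. \<sigma> \<in> ?cl \<Longrightarrow> \<exists>\<rho>\<in>C. c \<rho> < fidelity d (m \<rho>) (k \<rho>) (\<Gamma> \<rho>) \<sigma>"
      using closure_finite_subcover[OF assms(3) G c] by blast
    have "C \<noteq> {}" using C(3) dens(2) assms(2) by blast
    let ?m = "Min ((\<lambda>\<rho>. ereal (R \<rho>)) ` C)"
    have "g < ?m" using C R \<open>C \<noteq> {}\<close> by (subst Min_gr_iff) auto
    moreover have "?m \<le> g"
      unfolding g_def
    proof (rule INF_greatest)
      fix \<sigma> assume s: "\<sigma> \<in> ?cl"
      then obtain \<rho> where "\<rho> \<in> C" "c \<rho> < fidelity d (m \<rho>) (k \<rho>) (\<Gamma> \<rho>) \<sigma>" using C(3) by blast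
      then have "ereal (R \<rho>) \<le> ?E \<sigma>" "?m \<le> ereal (R \<rho>)" using E C s dens by (blast, simp)
      then show "?m \<le> ?E \<sigma>" by (rule order_trans[rotated])
    qed
    ultimately show False by simp
  qed
  then obtain \<rho> where r: "\<rho> \<in> ?cl" "?E \<rho> = g" by blast
  have "universal_distillable_entanglement d X \<le> g"
    using universal_le_closure[OF assms(3) r(1)] r(2) by simp
  moreover have "g \<le> universal_distillable_entanglement d X"
  proof (rule ccontr)
    assume n: "\<not> ?thesis"
    have "ereal 0 \<le> universal_distillable_entanglement d X"
      by (rule universal_distillable_entanglement_ge[OF assms(3,2)]) (use zero_eventually[OF assms(3)] in auto)
    moreover obtain R where R: "universal_distillable_entanglement d X < ereal R" "ereal R < g"
      using n ereal_dense2 by (metis not_le)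
    ultimately have R0: "0 \<le> R" by (auto dest: order_le_less_trans)
    \<comment> \<open>Two intermediate rates: one gap for the tests that lead from \<open>R2\<close>
      to \<open>R1\<close>, one for the ceiling in the passage from \<open>R1\<close> to
      \<open>R\<close>.\<close>
    obtain R2 where R2: "ereal R < ereal R2" "ereal R2 < g" using ereal_dense2[OF R(2)] by blast
    then obtain R1 where R1: "R < R1" "R1 < R2" using dense[of R R2] by auto
    have "reaches d ?cl R1"
      by (rule reaches_closure[OF assms(3), of R2]) (use R0 R1 R2 g_le in \<open>auto intro: order_less_le_trans\<close>)
    then have "reaches d X R1" using dens(2) by (rule reaches_mono)
    then have "ereal R \<le> universal_distillable_entanglement d X"
      using reaches_eventually[OF _ R0 R1(1)] by (intro universal_distillable_entanglement_ge[OF assms(3,2) R0])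
    then show False using R(1) by simp
  qed
  ultimately show ?thesis using r g_le by (intro bexI[of _ \<rho>]) auto
qed

end
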